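(* Let $n\ge 1$ and $d_1,\dots,d_n\ge 1$ be integers, $D=d_1\cdots d_n$, and let $\mathcal{M}\subset\mathbb{P}^{D-1}_p$ be the complete independence model on $d_1\times\cdots\times d_n$ contingency tables. For $i=1,\dots,n$ let $M_i$ be the $d_i\times(D/d_i+1)$ matrix obtained from the flattening $P_i$ by appending the column of marginal sums $u_{+\cdots+j+\cdots+}$ ($j$ in position $i$, $1\le j\le d_i$). Then the ideal \[ I=\sum_{i=1}^n I_2(M_i)\subset\mathbb{C}[p_{i_1\cdots i_n},u_{i_1\cdots i_n}] \] is prime and is the likelihood ideal of $\mathcal{M}$. Furthermore, the generators of $I$ (the $2\times2$ minors of the matrices $M_1,\dots,M_n$) form a Gröbner basis of $I$ under the lexicographic term order for the $p$'s followed by the lexicographic term order for the $u$'s.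
   Context: Indices $(i_1,\dots,i_n)$ range over $[d_1]\times\cdots\times[d_n]$, where $[d]=\{1,\dots,d\}$. $\mathbb{P}^{D-1}_p$ and $\mathbb{P}^{D-1}_u$ are complex projective spaces with homogeneous coordinates $p_{i_1\cdots i_n}$ and $u_{i_1\cdots i_n}$ respectively. A subscript $+$ in some position denotes summation over all values of that index; e.g. $u_{+\cdots+j+\cdots+}$ with $j$ in position $i$ is the sum of all $u_{i_1\cdots i_n}$ with $i_i=j$. $I_2(N)$ is the ideal generated by the $2\times2$ minors of $N$. Complete independence model: $\mathcal{M}\subset\mathbb{P}^{D-1}_p$ is the set of rank one tensors $(p_{i_1\cdots i_n})$, i.e. the Segre variety $\mathbb{P}^{d_1-1}\times\cdots\times\mathbb{P}^{d_n-1}\subset\mathbb{P}^{D-1}_p$. Matrices: $P_i$ is the $d_i\times(D/d_i)$ flattening of the generic tensor $(p_{i_1\cdots i_n})$, whose rows are indexed by the value $j\in[d_i]$ of the $i$-th index, whose columns are indexed (in lexicographic order) by the values of the remaining indices, and whose entries are the corresponding $p_{i_1\cdots i_n}$. $M_i$ is $P_i$ with one extra last column whose $j$-th entry is $u_{+\cdots+j+\cdots+}$ ($j$ in position $i$). Term order: the lexicographic order with all $p$ variables larger than all $u$ variables, and with $p_{1\cdots1}>\cdots>p_{d_1\cdots d_n}>u_{1\cdots1}>\cdots>u_{d_1\cdots d_n}$, where within the $p$'s and within the $u$'s the variables are ordered lexicographically by index, smaller index meaning larger variable (e.g. for $2\times3\times4$: $p_{111}>p_{112}>\cdots>p_{234}>u_{111}>\cdots>u_{234}$).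 Likelihood correspondence and likelihood ideal: write $s$ for a multi-index, $p_s,u_s$ for the corresponding coordinates, and (in this paragraph) $p_+=\sum_s p_s$, $u_+=\sum_s u_s$ for the total sums. The likelihood function is $\ell_u(p)=\prod_s p_s^{u_s}/(\sum_s p_s)^{\sum_s u_s}$, and $\operatorname{dlog}\ell_u(p)=\sum_s\left(\frac{u_s}{p_s}-\frac{u_+}{p_+}\right)dp_s$. Let $\mathcal{H}\subset\mathbb{P}^{D-1}_p$ be the union of all coordinate hyperplanes $V(p_s)$ and $V(\sum_s p_s)$. For a closed irreducible $\mathcal{M}\subseteq\mathbb{P}^{D-1}_p$ with smooth locus $\mathcal{M}_{\mathrm{reg}}$, \[ \mathcal{L}_{\mathcal{M}}=\overline{\{(p,u)\in(\mathcal{M}_{\mathrm{reg}}\setminus\mathcal{H})\times\mathbb{P}^{D-1}_u : \operatorname{dlog}\ell_u|_{\mathcal{M}}(p)=0\}}\subseteq\mathbb{P}^{D-1}_p\times\mathbb{P}^{D-1}_u \] (Zariski closure), where the condition means that the one-form vanishes on the tangent space of $\mathcal{M}$ at $p$ (equivalently, of its affine cone at a representative of $p$). The likelihood ideal of $\mathcal{M}$ is the (bihomogeneous) vanishing ideal of $\mathcal{L}_{\mathcal{M}}$ in $\mathbb{C}[p_{i_1\cdots i_n},u_{i_1\cdots i_n}]$. *)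

theory Defs
  imports
    Complex_Main
    "Jordan_Normal_Form.Matrix"
    "HOL-Algebra.Ideal"
    "HOL-Library.Function_Algebras"
    "HOL-Library.Poly_Mapping"
begin

section \<open>Polynomial rings\<close>

text \<open>Monomials are finitely supported exponent functions.  The ring of polynomials in the
  variables \<open>V\<close> is the carrier-based ring of those polynomials in which only variables from \<open>V\<close>
  occur.\<close>

type_synonym 'v mono = "'v \<Rightarrow>\<^sub>0 nat"
type_synonym 'v mpoly = "('v \<Rightarrow>\<^sub>0 nat) \<Rightarrow>\<^sub>0 complex"

definition Var :: "'v \<Rightarrow> 'v mpoly" where
  "Var v = Poly_Mapping.single (Poly_Mapping.single v 1) 1"

definition poly_ring :: "'v set \<Rightarrow> 'v mpoly ring" where
  "poly_ring V = \<lparr>carrier = {f. \<forall>m\<in>Poly_Mapping.keys f. Poly_Mapping.keys m \<subseteq> V},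
     monoid.mult = (*), one = 1, zero = 0, add = (+)\<rparr>"

definition eval :: "('v \<Rightarrow> complex) \<Rightarrow> 'v mpoly \<Rightarrow> complex" where
  "eval x f = (\<Sum>m\<in>Poly_Mapping.keys f.
     Poly_Mapping.lookup f m * (\<Prod>v\<in>Poly_Mapping.keys m. x v ^ Poly_Mapping.lookup m v))"

definition partial :: "'v \<Rightarrow> 'v mpoly \<Rightarrow> 'v mpoly" where
  "partial v f = (\<Sum>m\<in>Poly_Mapping.keys f.
     Poly_Mapping.single (m - Poly_Mapping.single v 1)
       (of_nat (Poly_Mapping.lookup m v) * Poly_Mapping.lookup f m))"

definition homogeneous :: "nat \<Rightarrow> 'v mpoly \<Rightarrow> bool" where
  "homogeneous a f \<longleftrightarrow> (\<forall>m\<in>Poly_Mapping.keys f.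
     (\<Sum>v\<in>Poly_Mapping.keys m. Poly_Mapping.lookup m v) = a)"


section \<open>Groebner bases\<close>

text \<open>The lexicographic order determined by a list of variables, largest variable first:
  \<open>lex_less vs m m'\<close> means that \<open>m\<close> is smaller than \<open>m'\<close>.\<close>

definition lex_less :: "'v list \<Rightarrow> 'v mono \<Rightarrow> 'v mono \<Rightarrow> bool" where
  "lex_less vs m m' \<longleftrightarrow> (\<exists>k<length vs.
     Poly_Mapping.lookup m (vs ! k) < Poly_Mapping.lookup m' (vs ! k) \<and>
     (\<forall>l<k. Poly_Mapping.lookup m (vs ! l) = Poly_Mapping.lookup m' (vs ! l)))"

definition lead_mono :: "('v mono \<Rightarrow> 'v mono \<Rightarrow> bool) \<Rightarrow> 'v mpoly \<Rightarrow> 'v mono" where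
  "lead_mono lt f = (THE m. m \<in> Poly_Mapping.keys f \<and>
     (\<forall>m'\<in>Poly_Mapping.keys f. m' \<noteq> m \<longrightarrow> lt m' m))"

definition lead_term :: "('v mono \<Rightarrow> 'v mono \<Rightarrow> bool) \<Rightarrow> 'v mpoly \<Rightarrow> 'v mpoly" where
  "lead_term lt f =
     Poly_Mapping.single (lead_mono lt f) (Poly_Mapping.lookup f (lead_mono lt f))"

definition initial_ideal ::
  "'v set \<Rightarrow> ('v mono \<Rightarrow> 'v mono \<Rightarrow> bool) \<Rightarrow> 'v mpoly set \<Rightarrow> 'v mpoly set" where
  "initial_ideal V lt F = genideal (poly_ring V) (lead_term lt ` (F - {0}))"

definition groebner_basis ::
  "'v set \<Rightarrow> ('v mono \<Rightarrow> 'v mono \<Rightarrow> bool) \<Rightarrow> 'v mpoly set \<Rightarrow> 'v mpoly set \<Rightarrow> bool" where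
  "groebner_basis V lt G I \<longleftrightarrow>
     finite G \<and> G \<subseteq> I \<and> initial_ideal V lt G = initial_ideal V lt I"


section \<open>Ideals of two-by-two minors\<close>

definition minors2 :: "'a::ring mat \<Rightarrow> 'a set" where
  "minors2 N = {N $$ (r, c) * N $$ (r', c') - N $$ (r, c') * N $$ (r', c) | r r' c c'.
     r < r' \<and> r' < dim_row N \<and> c < c' \<and> c' < dim_col N}"

definition ideal_minors2 :: "'v set \<Rightarrow> 'v mpoly mat \<Rightarrow> 'v mpoly set" where
  "ideal_minors2 V N = genideal (poly_ring V) (minors2 N)"


section \<open>Projective space\<close>

text \<open>The coordinates are indexed by a finite set \<open>S\<close>; vectors are functions vanishing outside
  \<open>S\<close>, and a projective point is the set of all its representatives.  Hence \<open>\<Union>M\<close> is the affine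
  cone over \<open>M\<close> without the origin.\<close>

definition vecs :: "'s set \<Rightarrow> ('s \<Rightarrow> complex) set" where
  "vecs S = {x. \<forall>s. s \<notin> S \<longrightarrow> x s = 0}"

definition scale :: "complex \<Rightarrow> ('s \<Rightarrow> complex) \<Rightarrow> 's \<Rightarrow> complex" where
  "scale c x = (\<lambda>s. c * x s)"

lemma vector_space_scale: "vector_space scale"
  by unfold_locales (auto simp: scale_def algebra_simps)

type_synonym 's point = "('s \<Rightarrow> complex) set"

definition proj_pt :: "('s \<Rightarrow> complex) \<Rightarrow> 's point" where
  "proj_pt x = {scale c x | c. c \<noteq> 0}"

definition proj_space :: "'s set \<Rightarrow> 's point set" where
  "proj_space S = proj_pt ` (vecs S - {0})"

definition vanishing_ideal :: "'s set \<Rightarrow> 's point set \<Rightarrow> 's mpoly set" where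
  "vanishing_ideal S M = genideal (poly_ring S)
     {f \<in> carrier (poly_ring S). (\<exists>a. homogeneous a f) \<and> (\<forall>q\<in>M. \<forall>x\<in>q. eval x f = 0)}"

text \<open>The tangent space of the affine cone over \<open>M\<close> at \<open>x\<close>:\<close>

definition tangent_space ::
  "'s set \<Rightarrow> 's point set \<Rightarrow> ('s \<Rightarrow> complex) \<Rightarrow> ('s \<Rightarrow> complex) set" where
  "tangent_space S M x =
     {v \<in> vecs S. \<forall>f\<in>vanishing_ideal S M. (\<Sum>s\<in>S. eval x (partial s f) * v s) = 0}"

text \<open>The smooth points of an irreducible variety are those at which the tangent space has the
  least possible dimension (Shafarevich, Basic Algebraic Geometry 1, II.1.4); this least dimension
  is the dimension of the variety.  For a projective variety, the tangent spaces of the affine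
  cone have one dimension more at every point.\<close>

definition smooth_locus :: "'s set \<Rightarrow> 's point set \<Rightarrow> 's point set" where
  "smooth_locus S M = {q \<in> M. \<forall>x\<in>q. \<forall>y\<in>\<Union>M.
     vector_space.dim scale (tangent_space S M x) \<le> vector_space.dim scale (tangent_space S M y)}"


section \<open>Products of two projective spaces\<close>

datatype 's var = Pvar 's | Uvar 's

definition pu_vars :: "'s set \<Rightarrow> 's var set" where
  "pu_vars S = Pvar ` S \<union> Uvar ` S"

definition pu_point :: "('s \<Rightarrow> complex) \<Rightarrow> ('s \<Rightarrow> complex) \<Rightarrow> 's var \<Rightarrow> complex" where
  "pu_point x y = case_var x y"

definition bihomogeneous :: "nat \<Rightarrow> nat \<Rightarrow> 's var mpoly \<Rightarrow> bool" where
  "bihomogeneous a b f \<longleftrightarrow> (\<forall>m\<in>Poly_Mapping.keys f.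
     (\<Sum>v\<in>Poly_Mapping.keys m \<inter> range Pvar. Poly_Mapping.lookup m v) = a \<and>
     (\<Sum>v\<in>Poly_Mapping.keys m \<inter> range Uvar. Poly_Mapping.lookup m v) = b)"

definition bihom_polys :: "'s set \<Rightarrow> 's var mpoly set" where
  "bihom_polys S = {f \<in> carrier (poly_ring (pu_vars S)). \<exists>a b. bihomogeneous a b f}"

definition bizeros :: "'s set \<Rightarrow> 's var mpoly set \<Rightarrow> ('s point \<times> 's point) set" where
  "bizeros S F = {(q, r) \<in> proj_space S \<times> proj_space S.
     \<forall>f\<in>F. \<forall>x\<in>q. \<forall>y\<in>r. eval (pu_point x y) f = 0}"

definition zariski_closure ::
  "'s set \<Rightarrow> ('s point \<times> 's point) set \<Rightarrow> ('s point \<times> 's point) set" where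
  "zariski_closure S X = \<Inter>{bizeros S F | F. F \<subseteq> bihom_polys S \<and> X \<subseteq> bizeros S F}"

definition bihom_vanishing_ideal ::
  "'s set \<Rightarrow> ('s point \<times> 's point) set \<Rightarrow> 's var mpoly set" where
  "bihom_vanishing_ideal S X = genideal (poly_ring (pu_vars S))
     {f \<in> bihom_polys S. \<forall>(q, r)\<in>X. \<forall>x\<in>q. \<forall>y\<in>r. eval (pu_point x y) f = 0}"


section \<open>Likelihood correspondence and likelihood ideal\<close>

definition hyperplanes :: "'s set \<Rightarrow> 's point set" where
  "hyperplanes S = {q \<in> proj_space S. \<forall>x\<in>q. (\<exists>s\<in>S. x s = 0) \<or> (\<Sum>s\<in>S. x s) = 0}"

definition dlog_likelihood ::
  "'s set \<Rightarrow> ('s \<Rightarrow> complex) \<Rightarrow> ('s \<Rightarrow> complex) \<Rightarrow> ('s \<Rightarrow> complex) \<Rightarrow> complex" where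
  "dlog_likelihood S u p v =
     (\<Sum>s\<in>S. (u s / p s - (\<Sum>t\<in>S. u t) / (\<Sum>t\<in>S. p t)) * v s)"

definition likelihood_correspondence ::
  "'s set \<Rightarrow> 's point set \<Rightarrow> ('s point \<times> 's point) set" where
  "likelihood_correspondence S M = zariski_closure S
     {(q, r) \<in> (smooth_locus S M - hyperplanes S) \<times> proj_space S.
        \<forall>p\<in>q. \<forall>u\<in>r. \<forall>v\<in>tangent_space S M p. dlog_likelihood S u p v = 0}"

definition likelihood_ideal :: "'s set \<Rightarrow> 's point set \<Rightarrow> 's var mpoly set" where
  "likelihood_ideal S M = bihom_vanishing_ideal S (likelihood_correspondence S M)"


section \<open>Complete independence\<close>

text \<open>A format is the list \<open>[d\<^sub>1, \<dots>, d\<^sub>n]\<close>.  A multi-index is a list \<open>s\<close> with \<open>1 \<le> s ! i \<le> ds ! i\<close>;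
  positions \<open>i\<close> in these lists count from \<open>0\<close>.\<close>

definition multi_indices :: "nat list \<Rightarrow> nat list list" where \<comment> \<open>in lexicographic order\<close>
  "multi_indices ds = product_lists (map (\<lambda>d. [1..<Suc d]) ds)"

definition indices :: "nat list \<Rightarrow> nat list set" where
  "indices ds = set (multi_indices ds)"

lemma indices_iff:
  "s \<in> indices ds \<longleftrightarrow> length s = length ds \<and> (\<forall>i<length ds. 1 \<le> s ! i \<and> s ! i \<le> ds ! i)"
  by (auto simp: indices_def multi_indices_def product_lists_set list_all2_conv_all_nth
      simp del: upt_Suc)

definition independence_model :: "nat list \<Rightarrow> nat list point set" where
  "independence_model ds = {proj_pt x | x. x \<in> vecs (indices ds) - {0} \<and>
     (\<exists>a. \<forall>s\<in>indices ds. x s = (\<Prod>i<length ds. a i (s ! i)))}"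

text \<open>Row \<open>r\<close> of a flattening, for \<open>r = 0, 1, \<dots>\<close>, corresponds to the value \<open>r + 1\<close> of the
  index in position \<open>i\<close>.\<close>

definition remaining_indices :: "nat list \<Rightarrow> nat \<Rightarrow> nat list list" where
  "remaining_indices ds i = multi_indices (take i ds @ drop (Suc i) ds)"

definition insert_index :: "nat \<Rightarrow> nat \<Rightarrow> nat list \<Rightarrow> nat list" where
  "insert_index i j t = take i t @ j # drop i t"

definition flattening :: "nat list \<Rightarrow> nat \<Rightarrow> nat list var mpoly mat" where
  "flattening ds i = mat (ds ! i) (prod_list ds div ds ! i)
     (\<lambda>(r, c). Var (Pvar (insert_index i (Suc r) (remaining_indices ds i ! c))))"

definition u_marginal :: "nat list \<Rightarrow> nat \<Rightarrow> nat \<Rightarrow> nat list var mpoly" where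
  "u_marginal ds i j = (\<Sum>s | s \<in> indices ds \<and> s ! i = j. Var (Uvar s))"

definition M_matrix :: "nat list \<Rightarrow> nat \<Rightarrow> nat list var mpoly mat" where
  "M_matrix ds i = mat (ds ! i) (prod_list ds div ds ! i + 1)
     (\<lambda>(r, c). if c < prod_list ds div ds ! i then flattening ds i $$ (r, c)
               else u_marginal ds i (Suc r))"

lemma length_multi_indices: "length (multi_indices ds) = prod_list ds"
  by (induction ds) (auto simp: multi_indices_def length_concat comp_def sum_list_triv)

lemma length_remaining_indices:
  assumes "i < length ds" "ds ! i \<ge> 1"
  shows "length (remaining_indices ds i) = prod_list ds div ds ! i"
proof -
  have "prod_list ds = prod_list (take i ds @ ds ! i # drop (Suc i) ds)"
    using assms(1) by (simp add: id_take_nth_drop[symmetric])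
  then show ?thesis
    using assms(2) by (simp add: remaining_indices_def length_multi_indices)
qed

definition independence_ideal :: "nat list \<Rightarrow> nat list var mpoly set" where
  "independence_ideal ds = {\<Sum>i<length ds. f i | f.
     \<forall>i<length ds. f i \<in> ideal_minors2 (pu_vars (indices ds)) (M_matrix ds i)}"

definition pu_order :: "nat list \<Rightarrow> nat list var list" where
  "pu_order ds = map Pvar (multi_indices ds) @ map Uvar (multi_indices ds)"

end

theory Submission
  imports Defs "HOL-Library.List_Lexorder" "HOL-Library.Multiset"
    "HOL-Computational_Algebra.Polynomial"
begin

text \<open>A critical point \<open>(p, u)\<close> of the likelihood function consists of a rank one tensor \<open>p\<close> and a
  vector \<open>u\<close> whose marginals in every direction are proportional to those of \<open>p\<close>.  Given \<open>p\<close>, this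
  is a linear condition on \<open>u\<close>, so the critical points have a polynomial parametrization by an affine
  space.  The polynomials vanishing on its image form a prime ideal containing all the minors, and
  it agrees with the likelihood ideal because a general point of the image is a critical point.

  Call a monomial standard if it is not divisible by \<open>p\<^sub>s p\<^sub>t\<close> or \<open>p\<^sub>s u\<^sub>e\<close> for certain pairs that are
  leading monomials of minors.  Every polynomial is congruent modulo the minors to a combination of
  standard monomials, in which a standard leading monomial survives.  It therefore remains to see
  that no nonzero combination of standard monomials vanishes on the image of the parametrization.
  Substituting suitable powers of one variable for the parameters turns standard monomials into
  monic polynomials of distinct degrees: the degree determines the leading exponents, these determine
  the part in \<open>u\<close>, and a standard monomial in \<open>p\<close> is determined by its multisets of indices in
  the separate directions.\<close>

section \<open>Polynomials\<close>

text \<open>No S-pairs are computed. With the ideal \<open>J\<close> of the parametrized set as an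
  upper bound for \<open>I\<close>, one independence statement modulo \<open>J\<close> yields both
  \<open>I = J\<close> and the Groebner property. Knowing only some leading monomials of minors is
  enough for this.

  The term order dictates the shape of the parametrization. Among the multi-indices with j in
  position i, the least is the one that is 1 elsewhere, so its u variable leads the corresponding
  marginal sum. These are the coordinates solved for. For j \<ge> 2 each is the only axis coordinate
  in its sum and has coefficient 1, so nothing is divided and the parametrization makes sense over
  \<open>complex poly\<close> too. The obstacle is j = 1, where all directions share the corner: one
  equation must settle all these sums at once. It does, because the prescribed marginals have the
  same grand total in every direction.

  Passages from general points to all points run along a line in parameter space and use only that
  polynomials in one variable form an integral domain.\<close>

abbreviation "lookup \<equiv> Poly_Mapping.lookup"
abbreviation "keys \<equiv> Poly_Mapping.keys"
abbreviation "single \<equiv> Poly_Mapping.single"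

lemma sum_single_keys: "(\<Sum>m\<in>keys f. single m (lookup f m)) = f"
  by (rule poly_mapping_eqI)
    (auto simp: lookup_sum lookup_single when_def in_keys_iff sum.delta)

lemma keys_diff_subset: "keys (f - g) \<subseteq> keys f \<union> keys (g :: _ \<Rightarrow>\<^sub>0 'a::ab_group_add)"
  by (auto simp: in_keys_iff lookup_minus)

lemma keys_sum_subset: "keys (sum f A) \<subseteq> (\<Union>a\<in>A. keys (f a))"
  by (induction A rule: infinite_finite_induct) (use keys_add in fastforce)+

lemma keys_add_nat: "keys (m + m') = keys m \<union> keys (m' :: _ \<Rightarrow>\<^sub>0 nat)"
  by (auto simp: in_keys_iff lookup_add)

text \<open>Values lie in an arbitrary commutative semiring because monomials are evaluated both at
  complex points and at points with coordinates in \<open>complex poly\<close>.\<close>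

definition meval :: "('v \<Rightarrow> 'r::comm_semiring_1) \<Rightarrow> 'v mono \<Rightarrow> 'r" where
  "meval x m = (\<Prod>v\<in>keys m. x v ^ lookup m v)"

lemma meval_superset:
  assumes "finite A" "keys m \<subseteq> A"
  shows "meval x m = (\<Prod>v\<in>A. x v ^ lookup m v)"
  unfolding meval_def by (rule prod.mono_neutral_left) (use assms in \<open>auto simp: in_keys_iff\<close>)

lemma meval_0 [simp]: "meval x 0 = 1"
  by (simp add: meval_def)

lemma meval_single [simp]: "meval x (single v k) = x v ^ k"
  by (simp add: meval_def)

lemma meval_add: "meval x (m + m') = meval x m * meval x m'"
proof -
  let ?A = "keys m \<union> keys m'"
  have "meval x (m + m') = (\<Prod>v\<in>?A. x v ^ lookup (m + m') v)"
    by (rule meval_superset) (auto simp: keys_add_nat)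
  also have "\<dots> = (\<Prod>v\<in>?A. x v ^ lookup m v) * (\<Prod>v\<in>?A. x v ^ lookup m' v)"
    by (simp add: lookup_add power_add prod.distrib)
  also have "\<dots> = meval x m * meval x m'"
    by (simp add: meval_superset[of ?A])
  finally show ?thesis .
qed

lemma eval_meval: "eval x f = (\<Sum>m\<in>keys f. lookup f m * meval x m)"
  by (simp add: eval_def meval_def)

lemma eval_superset:
  assumes "finite A" "keys f \<subseteq> A"
  shows "eval x f = (\<Sum>m\<in>A. lookup f m * meval x m)"
  unfolding eval_meval
  by (rule sum.mono_neutral_left) (use assms in \<open>auto simp: in_keys_iff\<close>)

lemma eval_0 [simp]: "eval x 0 = 0"
  by (simp add: eval_meval)

lemma eval_single: "eval x (single m c) = c * meval x m"
  by (simp add: eval_meval)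

lemma eval_1 [simp]: "eval x 1 = 1"
  using eval_single[of x 0 1] by simp

lemma eval_Var [simp]: "eval x (Var v) = x v"
  by (simp add: Var_def eval_single)

lemma eval_add [simp]: "eval x (f + g) = eval x f + eval x g"
proof -
  let ?A = "keys f \<union> keys g"
  have "eval x (f + g) = (\<Sum>m\<in>?A. lookup (f + g) m * meval x m)"
    by (rule eval_superset) (auto dest!: subsetD[OF keys_add])
  then show ?thesis
    by (simp add: eval_superset[of ?A] lookup_add distrib_right sum.distrib)
qed

lemma eval_uminus [simp]: "eval x (- f) = - eval x f"
  using eval_add[of x f "- f"] by (simp add: add_eq_0_iff)

lemma eval_diff [simp]: "eval x (f - g) = eval x f - eval x g"
  using eval_add[of x f "- g"] by simp

lemma eval_sum [simp]: "eval x (sum f A) = (\<Sum>a\<in>A. eval x (f a))"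
  by (induction A rule: infinite_finite_induct) auto

lemma eval_mult [simp]: "eval x (f * g) = eval x f * eval x g"
proof -
  have "f * g = (\<Sum>m\<in>keys f. \<Sum>m'\<in>keys g. single (m + m') (lookup f m * lookup g m'))"
    by (subst (1 2) sum_single_keys[symmetric]) (simp add: sum_product mult_single)
  then show ?thesis
    by (simp add: eval_single meval_add eval_meval[of x f] eval_meval[of x g] sum_product mult_ac)
qed

lemma eval_cong:
  assumes "\<And>m v. m \<in> keys f \<Longrightarrow> v \<in> keys m \<Longrightarrow> x v = y v"
  shows "eval x f = eval y f"
  unfolding eval_def by (intro sum.cong refl arg_cong2[where f = "(*)"] prod.cong) (simp add: assms)

text \<open>The restriction of \<open>f\<close> to a polynomial curve. Its vanishing is checked
  pointwise through \<open>poly_peval\<close>, since a complex polynomial with all values 0 is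
  0.\<close>

definition peval :: "('v \<Rightarrow> complex poly) \<Rightarrow> 'v mpoly \<Rightarrow> complex poly" where
  "peval x f = (\<Sum>m\<in>keys f. smult (lookup f m) (meval x m))"

lemma poly_meval: "poly (meval x m) z = meval (\<lambda>v. poly (x v) z) m"
  by (simp add: meval_def poly_prod)

lemma poly_peval: "poly (peval x f) z = eval (\<lambda>v. poly (x v) z) f"
  by (simp add: peval_def poly_sum eval_meval poly_meval)

lemma lookup_diff_nat: "lookup (m - m') v = lookup m v - (lookup m' v :: nat)"
  by (simp add: lookup_minus)

text \<open>Connects the formal derivatives in \<open>tangent_space\<close> with calculus: tangent
  vectors can be found by differentiating along lines, and their linear equations by the product
  rule.\<close>

lemma eval_has_derivative_line:
  assumes S: "finite S" and f: "\<And>m. m \<in> keys f \<Longrightarrow> keys m \<subseteq> S"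
  shows "((\<lambda>z. eval (\<lambda>s. x s + z * v s) f) has_field_derivative
    (\<Sum>s\<in>S. eval x (partial s f) * v s)) (at 0)"
proof -
  have 1: "((\<lambda>z. meval (\<lambda>s. x s + z * v s) m) has_field_derivative
      (\<Sum>s\<in>S. of_nat (lookup m s) * meval x (m - single s 1) * v s)) (at 0)"
    if m: "keys m \<subseteq> S" for m
  proof -
    have "((\<lambda>z. \<Prod>s\<in>S. (x s + z * v s) ^ lookup m s) has_field_derivative
       (\<Sum>s\<in>S. (of_nat (lookup m s) * (v s * (x s + 0 * v s) ^ (lookup m s - Suc 0))) *
          (\<Prod>t\<in>S - {s}. (x t + 0 * v t) ^ lookup m t))) (at 0)"
      by (rule has_field_derivative_prod) (auto intro!: derivative_eq_intros)
    also have "(\<lambda>z. \<Prod>s\<in>S. (x s + z * v s) ^ lookup m s) = (\<lambda>z. meval (\<lambda>s. x s + z * v s) m)"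
      using S m by (auto simp: meval_superset[of S])
    also have "(\<Sum>s\<in>S. (of_nat (lookup m s) * (v s * (x s + 0 * v s) ^ (lookup m s - Suc 0))) *
          (\<Prod>t\<in>S - {s}. (x t + 0 * v t) ^ lookup m t)) =
        (\<Sum>s\<in>S. of_nat (lookup m s) * meval x (m - single s 1) * v s)"
    proof (intro sum.cong refl)
      fix s assume s: "s \<in> S"
      have "keys (m - single s 1) \<subseteq> S"
        using m by (auto simp: in_keys_iff lookup_diff_nat)
      then have "meval x (m - single s 1) = (\<Prod>t\<in>S. x t ^ lookup (m - single s 1) t)"
        using S by (simp add: meval_superset)
      also have "\<dots> = x s ^ (lookup m s - 1) * (\<Prod>t\<in>S - {s}. x t ^ lookup (m - single s 1) t)"
        using S s by (simp add: prod.remove lookup_diff_nat)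
      also have "(\<Prod>t\<in>S - {s}. x t ^ lookup (m - single s 1) t) = (\<Prod>t\<in>S - {s}. x t ^ lookup m t)"
        by (intro prod.cong refl) (auto simp: lookup_diff_nat lookup_single when_def)
      finally show "(of_nat (lookup m s) * (v s * (x s + 0 * v s) ^ (lookup m s - Suc 0))) *
          (\<Prod>t\<in>S - {s}. (x t + 0 * v t) ^ lookup m t) =
          of_nat (lookup m s) * meval x (m - single s 1) * v s"
        by simp
    qed
    finally show ?thesis .
  qed
  have "((\<lambda>z. \<Sum>m\<in>keys f. lookup f m * meval (\<lambda>s. x s + z * v s) m) has_field_derivative
      (\<Sum>m\<in>keys f. lookup f m * (\<Sum>s\<in>S. of_nat (lookup m s) * meval x (m - single s 1) * v s))) (at 0)"
    by (intro DERIV_sum DERIV_cmult 1 f)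
  also have "(\<Sum>m\<in>keys f. lookup f m * (\<Sum>s\<in>S. of_nat (lookup m s) * meval x (m - single s 1) * v s)) =
      (\<Sum>s\<in>S. eval x (partial s f) * v s)"
    unfolding partial_def
    by (simp add: eval_single sum_distrib_left sum_distrib_right) (subst sum.swap, simp add: mult_ac)
  finally show ?thesis by (simp add: eval_meval)
qed

lemma lookup_single_var: "lookup (single v (Suc 0)) w = of_bool (v = w)"
  by (simp add: lookup_single when_def)

lemma Var_mult_Var: "Var v * Var w = single (single v 1 + single w 1) 1"
  by (simp add: Var_def mult_single)

text \<open>Subtraction of exponents is truncated. With \<open>v \<noteq> w\<close> each variable is
  removed only once, so its occurrence in \<open>m\<close> is enough to undo the
  subtraction.\<close>

lemma mono_diff_add:
  fixes m :: "'v mono"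
  assumes "v \<in> keys m" "w \<in> keys m" "v \<noteq> w"
  shows "m = (m - (single v 1 + single w 1)) + (single v 1 + single w 1)"
proof (rule poly_mapping_eqI)
  fix x
  have "lookup (single v 1 + single w (1 :: nat)) x \<le> lookup m x"
    using assms by (auto simp: lookup_add lookup_single when_def in_keys_iff)
  then show "lookup m x = lookup ((m - (single v 1 + single w 1)) + (single v 1 + single w 1)) x"
    by (simp add: lookup_add[of "m - _"] lookup_minus)
qed

section \<open>Ideals in polynomial rings\<close>

lemma carrier_poly_ring: "f \<in> carrier (poly_ring V) \<longleftrightarrow> (\<forall>m\<in>keys f. keys m \<subseteq> V)"
  by (simp add: poly_ring_def)

lemma poly_ring_simps [simp]:
  "mult (poly_ring V) = (*)" "one (poly_ring V) = 1" "zero (poly_ring V) = 0" "add (poly_ring V) = (+)"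
  by (simp_all add: poly_ring_def)

lemma carrier_poly_ring_add: "f \<in> carrier (poly_ring V) \<Longrightarrow> g \<in> carrier (poly_ring V) \<Longrightarrow>
    f + g \<in> carrier (poly_ring V)"
  using keys_add[of f g] by (auto simp: carrier_poly_ring)

lemma carrier_poly_ring_diff: "f \<in> carrier (poly_ring V) \<Longrightarrow> g \<in> carrier (poly_ring V) \<Longrightarrow>
    f - g \<in> carrier (poly_ring V)"
  using keys_diff_subset[of f g] by (auto simp: carrier_poly_ring)

lemma carrier_poly_ring_mult: "f \<in> carrier (poly_ring V) \<Longrightarrow> g \<in> carrier (poly_ring V) \<Longrightarrow>
    f * g \<in> carrier (poly_ring V)"
  using keys_mult[of f g] by (fastforce simp: carrier_poly_ring keys_add_nat)

lemma carrier_poly_ring_0 [simp]: "0 \<in> carrier (poly_ring V)"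
  by (simp add: carrier_poly_ring)

lemma carrier_poly_ring_1 [simp]: "1 \<in> carrier (poly_ring V)"
  by (simp add: carrier_poly_ring)

lemma carrier_poly_ring_single: "keys m \<subseteq> V \<Longrightarrow> single m c \<in> carrier (poly_ring V)"
  by (simp add: carrier_poly_ring)

lemma carrier_poly_ring_Var: "v \<in> V \<Longrightarrow> Var v \<in> carrier (poly_ring V)"
  by (simp add: carrier_poly_ring Var_def)

lemma carrier_poly_ring_sum: "(\<And>a. a \<in> A \<Longrightarrow> f a \<in> carrier (poly_ring V)) \<Longrightarrow>
    sum f A \<in> carrier (poly_ring V)"
  by (induction A rule: infinite_finite_induct) (auto simp: carrier_poly_ring_add)

lemmas carrier_poly_ring_closed = carrier_poly_ring_add carrier_poly_ring_diff
  carrier_poly_ring_mult carrier_poly_ring_single carrier_poly_ring_Var carrier_poly_ring_sum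

lemma cring_poly_ring: "cring (poly_ring V)"
proof (intro cringI abelian_groupI comm_monoidI)
  fix f assume f: "f \<in> carrier (poly_ring V)"
  have "- f \<in> carrier (poly_ring V)"
    using carrier_poly_ring_diff[OF carrier_poly_ring_0 f] by simp
  then show "\<exists>g\<in>carrier (poly_ring V). g \<oplus>\<^bsub>poly_ring V\<^esub> f = \<zero>\<^bsub>poly_ring V\<^esub>"
    by (intro bexI[of _ "- f"]) auto
qed (auto simp: carrier_poly_ring_closed algebra_simps)

lemma ring_poly_ring: "ring (poly_ring V)"
  using cring_poly_ring by (rule cring.axioms)

lemma ideal_poly_ringI:
  assumes sub: "I \<subseteq> carrier (poly_ring V)" and z: "0 \<in> I"
    and add: "\<And>f g. f \<in> I \<Longrightarrow> g \<in> I \<Longrightarrow> f + g \<in> I"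
    and mult: "\<And>f g. f \<in> carrier (poly_ring V) \<Longrightarrow> g \<in> I \<Longrightarrow> f * g \<in> I"
  shows "ideal I (poly_ring V)"
proof (rule idealI)
  interpret cring "poly_ring V" by (rule cring_poly_ring)
  show "ring (poly_ring V)" by (rule ring_poly_ring)
  show "subgroup I (add_monoid (poly_ring V))"
  proof (rule add.subgroupI)
    fix f assume f: "f \<in> I"
    have "- 1 \<in> carrier (poly_ring V)"
      using carrier_poly_ring_diff[OF carrier_poly_ring_0 carrier_poly_ring_1] by simp
    then have "- 1 * f \<in> I" using mult f by blast
    moreover have "f \<in> carrier (poly_ring V)" using f sub by auto
    then have "\<ominus>\<^bsub>poly_ring V\<^esub> f = - f"
      by (intro minus_equality) (use carrier_poly_ring_diff[OF carrier_poly_ring_0, of f] in auto)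
    ultimately show "\<ominus>\<^bsub>poly_ring V\<^esub> f \<in> I" by simp
  qed (use sub z add in auto)
  fix a x assume "a \<in> I" "x \<in> carrier (poly_ring V)"
  then show "x \<otimes>\<^bsub>poly_ring V\<^esub> a \<in> I" "a \<otimes>\<^bsub>poly_ring V\<^esub> x \<in> I"
    using mult[of x a] by (simp_all add: mult.commute)
qed

lemma ideal_poly_ringD:
  assumes "ideal I (poly_ring V)"
  shows "I \<subseteq> carrier (poly_ring V)" "0 \<in> I"
    "\<And>f g. f \<in> I \<Longrightarrow> g \<in> I \<Longrightarrow> f + g \<in> I"
    "\<And>f g. f \<in> carrier (poly_ring V) \<Longrightarrow> g \<in> I \<Longrightarrow> f * g \<in> I"
    "\<And>f g. f \<in> I \<Longrightarrow> g \<in> I \<Longrightarrow> f - g \<in> I"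
proof -
  interpret ideal I "poly_ring V" by fact
  show "I \<subseteq> carrier (poly_ring V)" using a_subset by simp
  show z: "0 \<in> I"
    using additive_subgroup.zero_closed[OF is_additive_subgroup] by simp
  show add: "f + g \<in> I" if "f \<in> I" "g \<in> I" for f g using additive_subgroup.a_closed[OF is_additive_subgroup that] by simp
  show mult: "f * g \<in> I" if "f \<in> carrier (poly_ring V)" "g \<in> I" for f g
    using I_l_closed[OF that(2,1)] by simp
  have m1: "- 1 \<in> carrier (poly_ring V)"
    using carrier_poly_ring_diff[OF carrier_poly_ring_0 carrier_poly_ring_1] by simp
  show "f - g \<in> I" if "f \<in> I" "g \<in> I" for f g
    using add[OF that(1) mult[OF m1 that(2)]] by simp
qed

lemma genideal_poly_ring:
  assumes "F \<subseteq> carrier (poly_ring V)"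
  shows "ideal (genideal (poly_ring V) F) (poly_ring V)" "F \<subseteq> genideal (poly_ring V) F"
    "\<And>I. ideal I (poly_ring V) \<Longrightarrow> F \<subseteq> I \<Longrightarrow> genideal (poly_ring V) F \<subseteq> I"
  by (rule ring.genideal_ideal[OF ring_poly_ring assms] ring.genideal_self[OF ring_poly_ring assms]
    ring.genideal_minimal[OF ring_poly_ring]; assumption)+

lemma ideal_vanishing:
  "ideal {f \<in> carrier (poly_ring V). \<forall>x\<in>X. eval x f = 0} (poly_ring V)"
  by (rule ideal_poly_ringI) (auto simp: carrier_poly_ring_closed)

section \<open>Lexicographic orders and reduction\<close>

text \<open>\<open>lex less_than\<close> relates only lists of equal length, which keeps it
  well-founded; exponent vectors along \<open>vs\<close> all have the length of
  \<open>vs\<close>.\<close>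

lemma wf_lex_less: "wf {(m, m'). lex_less vs m m'}"
proof (rule wf_subset)
  show "wf (inv_image (lex less_than) (\<lambda>m. map (lookup m) vs))"
    by (intro wf_inv_image wf_lex wf_less_than)
  show "{(m, m'). lex_less vs m m'} \<subseteq> inv_image (lex less_than) (\<lambda>m. map (lookup m) vs)"
  proof clarify
    fix m m' assume "lex_less vs m m'"
    then obtain k where k: "k < length vs" "lookup m (vs ! k) < lookup m' (vs ! k)"
      and l: "\<And>l. l < k \<Longrightarrow> lookup m (vs ! l) = lookup m' (vs ! l)"
      unfolding lex_less_def by blast
    have split: "map (lookup p) vs = map (lookup p) (take k vs) @ lookup p (vs ! k) # map (lookup p) (drop (Suc k) vs)"
      for p
      using k(1) by (metis id_take_nth_drop list.simps(9) map_append)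
    have "map (lookup m) (take k vs) = map (lookup m') (take k vs)"
      by (rule nth_equalityI) (use k l in auto)
    then show "(m, m') \<in> inv_image (lex less_than) (\<lambda>m. map (lookup m) vs)"
      unfolding in_inv_image split[of m] split[of m']
      by (metis (lifting) Cons_in_lex k(2) length_drop length_map lex_append_leftI less_than_iff)
  qed
qed

lemma lex_less_irrefl: "\<not> lex_less vs m m"
  by (auto simp: lex_less_def)

lemma lex_less_trans:
  assumes "lex_less vs m m'" "lex_less vs m' m''"
  shows "lex_less vs m m''"
proof -
  obtain k where k: "k < length vs" "lookup m (vs ! k) < lookup m' (vs ! k)"
    "\<And>l. l < k \<Longrightarrow> lookup m (vs ! l) = lookup m' (vs ! l)"
    using assms(1) unfolding lex_less_def by blast
  obtain k' where k': "k' < length vs" "lookup m' (vs ! k') < lookup m'' (vs ! k')"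
    "\<And>l. l < k' \<Longrightarrow> lookup m' (vs ! l) = lookup m'' (vs ! l)"
    using assms(2) unfolding lex_less_def by blast
  have "lookup m (vs ! min k k') < lookup m'' (vs ! min k k')"
    using k(2,3) k'(2,3) by (cases k k' rule: linorder_cases) (auto simp: min_def)
  moreover have "lookup m (vs ! l) = lookup m'' (vs ! l)" if "l < min k k'" for l
    using that k(3) k'(3) by simp
  ultimately show ?thesis
    unfolding lex_less_def using k(1) by (intro exI[of _ "min k k'"]) auto
qed

lemma lex_less_total:
  assumes "keys m \<subseteq> set vs" "keys m' \<subseteq> set vs" "m \<noteq> m'"
  shows "lex_less vs m m' \<or> lex_less vs m' m"
proof -
  obtain v where v: "lookup m v \<noteq> lookup m' v"
    using assms(3) by (meson poly_mapping_eqI)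
  then have "v \<in> keys m \<union> keys m'"
    by (metis UnI1 UnI2 in_keys_iff)
  then have "v \<in> set vs" using assms(1,2) by blast
  then obtain k0 where k0: "k0 < length vs" "vs ! k0 = v" by (auto simp: in_set_conv_nth)
  define k where "k = (LEAST k. lookup m (vs ! k) \<noteq> lookup m' (vs ! k))"
  have "lookup m (vs ! k) \<noteq> lookup m' (vs ! k)"
    unfolding k_def by (rule LeastI[of _ k0]) (use v k0 in simp)
  moreover have "k \<le> k0"
    unfolding k_def by (rule Least_le) (use v k0 in simp)
  moreover have "lookup m (vs ! l) = lookup m' (vs ! l)" if "l < k" for l
    using not_less_Least[of l "\<lambda>k. lookup m (vs ! k) \<noteq> lookup m' (vs ! k)"] that
    unfolding k_def by blast
  ultimately have "k < length vs \<and> lookup m (vs ! k) \<noteq> lookup m' (vs ! k) \<and>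
      (\<forall>l<k. lookup m (vs ! l) = lookup m' (vs ! l))"
    using k0(1) by auto
  then show ?thesis
    unfolding lex_less_def by (cases "lookup m (vs ! k) < lookup m' (vs ! k)") (auto intro!: exI[of _ k])
qed

lemma lex_less_add: "lex_less vs m m' \<Longrightarrow> lex_less vs (q + m) (q + m')"
  by (auto simp: lex_less_def lookup_add)

lemma lead_mono_eqI:
  assumes "m \<in> keys f" "\<And>m'. m' \<in> keys f \<Longrightarrow> m' \<noteq> m \<Longrightarrow> lex_less vs m' m"
  shows "lead_mono (lex_less vs) f = m"
  unfolding lead_mono_def
proof (rule the_equality)
  fix m' assume m': "m' \<in> keys f \<and> (\<forall>m''\<in>keys f. m'' \<noteq> m' \<longrightarrow> lex_less vs m'' m')"
  show "m' = m"
  proof (rule ccontr)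
    assume "m' \<noteq> m"
    then have "lex_less vs m m'" "lex_less vs m' m" using m' assms by auto
    then show False using lex_less_trans lex_less_irrefl by blast
  qed
qed (use assms in auto)

lemma lead_mono:
  assumes f: "f \<in> carrier (poly_ring (set vs))" "f \<noteq> 0"
  shows "lead_mono (lex_less vs) f \<in> keys f"
    "\<And>m. m \<in> keys f \<Longrightarrow> m \<noteq> lead_mono (lex_less vs) f \<Longrightarrow> lex_less vs m (lead_mono (lex_less vs) f)"
proof -
  have max: "\<exists>m\<in>A. \<forall>m'\<in>A. m' \<noteq> m \<longrightarrow> lex_less vs m' m" if "finite A" "A \<noteq> {}" "A \<subseteq> keys f" for A
    using that
  proof (induction A rule: finite_ne_induct)
    case (insert x F)
    then obtain m where m: "m \<in> F" "\<And>m'. m' \<in> F \<Longrightarrow> m' \<noteq> m \<Longrightarrow> lex_less vs m' m" by auto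
    have "lex_less vs m x \<or> lex_less vs x m"
      using f(1) insert m by (intro lex_less_total) (auto simp: carrier_poly_ring)
    then show ?case
    proof
      assume "lex_less vs m x"
      then show ?thesis using m lex_less_trans by (intro bexI[of _ x]) blast+
    next
      assume "lex_less vs x m"
      then show ?thesis using m by (intro bexI[of _ m]) auto
    qed
  qed auto
  have "keys f \<noteq> {}" using f(2) sum_single_keys[of f] by auto
  from max[OF finite_keys this subset_refl] obtain m where
    m: "m \<in> keys f" "\<And>m'. m' \<in> keys f \<Longrightarrow> m' \<noteq> m \<Longrightarrow> lex_less vs m' m"
    by blast
  then have "lead_mono (lex_less vs) f = m" by (rule lead_mono_eqI)
  with m show "lead_mono (lex_less vs) f \<in> keys f"
    "\<And>m. m \<in> keys f \<Longrightarrow> m \<noteq> lead_mono (lex_less vs) f \<Longrightarrow> lex_less vs m (lead_mono (lex_less vs) f)"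
    by auto
qed

section \<open>Division modulo an ideal\<close>

lemma reduce_linear:
  fixes f :: "'v mpoly"
  assumes I: "ideal I (poly_ring V)"
    and R: "\<And>m. m \<in> keys f \<Longrightarrow> \<exists>r \<in> carrier (poly_ring V). single m 1 - r \<in> I \<and> (\<forall>k\<in>keys r. P m k)"
  shows "\<exists>r \<in> carrier (poly_ring V). f - r \<in> I \<and> (\<forall>k\<in>keys r. \<exists>m\<in>keys f. P m k)"
proof -
  obtain r where r: "\<And>m. m \<in> keys f \<Longrightarrow> r m \<in> carrier (poly_ring V)"
    "\<And>m. m \<in> keys f \<Longrightarrow> single m 1 - r m \<in> I"
    "\<And>m k. m \<in> keys f \<Longrightarrow> k \<in> keys (r m) \<Longrightarrow> P m k"
    using R by metis
  define c :: "'v mono \<Rightarrow> 'v mpoly" where "c m = single 0 (lookup f m)" for m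
  have c: "c m \<in> carrier (poly_ring V)" for m
    by (simp add: c_def carrier_poly_ring)
  define r' where "r' = (\<Sum>m\<in>keys f. c m * r m)"
  have "f - r' = (\<Sum>m\<in>keys f. c m * (single m 1 - r m))"
    unfolding r'_def right_diff_distrib sum_subtractf
    by (subst sum_single_keys[of f, symmetric]) (simp add: c_def mult_single)
  also have "\<dots> \<in> I"
  proof -
    have "(\<Sum>m\<in>A. c m * (single m 1 - r m)) \<in> I" if "A \<subseteq> keys f" for A
      using finite_subset[OF that finite_keys] that
      by (induction A rule: finite_induct) (auto intro!: ideal_poly_ringD(2-4)[OF I] c r)
    then show ?thesis by blast
  qed
  finally have "f - r' \<in> I" .
  moreover have "r' \<in> carrier (poly_ring V)"
    unfolding r'_def by (intro carrier_poly_ring_closed c r)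
  moreover have "\<exists>m\<in>keys f. P m k" if k: "k \<in> keys r'" for k
  proof -
    obtain m where m: "m \<in> keys f" "k \<in> keys (c m * r m)"
      using k keys_sum_subset[of "\<lambda>m. c m * r m" "keys f"] unfolding r'_def by blast
    then have "k \<in> keys (r m)"
      using keys_mult[of "c m" "r m"] by (auto simp: c_def split: if_splits)
    then show ?thesis using m r by blast
  qed
  ultimately show ?thesis by blast
qed

text \<open>An element of \<open>I\<close> with leading term \<open>L\<close> rewrites
  \<open>q + L\<close> into smaller monomials, so well-founded induction applies. The bound by
  monomials of \<open>f\<close> is kept in the conclusion because reducing the lower terms of a
  polynomial must not touch its leading monomial.\<close>

lemma reduce_to_standard:
  assumes I: "ideal I (poly_ring (set vs))"
    and red: "\<And>m. keys m \<subseteq> set vs \<Longrightarrow> \<not> Std m \<Longrightarrow>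
      \<exists>L q r. m = q + L \<and> single L 1 + r \<in> I \<and> (\<forall>k\<in>keys r. lex_less vs k L)"
    and f: "f \<in> carrier (poly_ring (set vs))"
  shows "\<exists>r \<in> carrier (poly_ring (set vs)). f - r \<in> I \<and>
    (\<forall>k\<in>keys r. \<exists>m\<in>keys f. Std k \<and> (k = m \<or> lex_less vs k m))"
proof (rule reduce_linear[OF I])
  fix m assume "m \<in> keys f"
  then have "keys m \<subseteq> set vs" using f by (auto simp: carrier_poly_ring)
  then show "\<exists>r \<in> carrier (poly_ring (set vs)). single m 1 - r \<in> I \<and>
    (\<forall>k\<in>keys r. Std k \<and> (k = m \<or> lex_less vs k m))"
  proof (induction m rule: wf_induct_rule[OF wf_lex_less[of vs]])
    case (1 m)
    show ?case
    proof (cases "Std m")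
      case True
      then show ?thesis
        using 1(2) ideal_poly_ringD(2)[OF I]
        by (intro bexI[of _ "single m 1"]) (auto simp: carrier_poly_ring)
    next
      case False
      then obtain L q r where L: "m = q + L" "single L 1 + r \<in> I" "\<And>k. k \<in> keys r \<Longrightarrow> lex_less vs k L"
        using red[of m] 1(2) by blast
      have q: "keys q \<subseteq> set vs" "keys L \<subseteq> set vs" using 1(2) L(1) by (auto simp: keys_add_nat)
      have "single L 1 + r - single L 1 \<in> carrier (poly_ring (set vs))"
        using ideal_poly_ringD(1)[OF I] L(2) q by (intro carrier_poly_ring_diff carrier_poly_ring_single) auto
      then have rc: "r \<in> carrier (poly_ring (set vs))" by (simp only: add_diff_cancel_left')
      define r1 where "r1 = single q 1 * r"
      have r1: "r1 \<in> carrier (poly_ring (set vs))"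
        unfolding r1_def by (intro carrier_poly_ring_closed q rc)
      have lt: "lex_less vs k m" if "k \<in> keys r1" for k
        using that keys_mult[of "single q 1" r] L(3) lex_less_add[of vs _ L q]
        by (auto simp: r1_def L(1))
      have "single q 1 * (single L 1 + r) \<in> I"
        by (intro ideal_poly_ringD(4)[OF I] L carrier_poly_ring_closed q)
      then have a: "single m 1 + r1 \<in> I"
        by (simp add: r1_def L(1) distrib_left mult_single)
      have "\<exists>r2 \<in> carrier (poly_ring (set vs)). r1 - r2 \<in> I \<and>
        (\<forall>k\<in>keys r2. \<exists>m\<in>keys r1. Std k \<and> (k = m \<or> lex_less vs k m))"
        by (rule reduce_linear[OF I]) (use 1(1) r1 lt in \<open>auto simp: carrier_poly_ring\<close>)
      then obtain r2 where r2: "r2 \<in> carrier (poly_ring (set vs))" "r1 - r2 \<in> I"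
        "\<And>k. k \<in> keys r2 \<Longrightarrow> \<exists>m\<in>keys r1. Std k \<and> (k = m \<or> lex_less vs k m)"
        by blast
      \<comment> \<open>Modulo \<open>I\<close> the monomial is congruent to \<open>- r1\<close>,
        hence to \<open>- r2\<close>, written \<open>0 - r2\<close> to use closure under
        differences.\<close>
      have "(single m 1 + r1) - (r1 - r2) \<in> I"
        by (intro ideal_poly_ringD(5)[OF I] a r2)
      then have "single m 1 - (0 - r2) \<in> I" by (simp add: algebra_simps)
      moreover have "0 - r2 \<in> carrier (poly_ring (set vs))"
        by (intro carrier_poly_ring_closed r2) simp
      moreover have "keys (0 - r2) = keys r2" by (auto simp: in_keys_iff)
      moreover have "Std k \<and> (k = m \<or> lex_less vs k m)" if "k \<in> keys r2" for k
        using r2(3)[OF that] lt lex_less_trans by blast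
      ultimately show ?thesis by (intro bexI[of _ "0 - r2"]) auto
    qed
  qed
qed

text \<open>An element of \<open>J\<close> reduces modulo \<open>I\<close> to a standard combination
  that still lies in \<open>J\<close>, hence to 0. Likewise the leading monomial of an element of
  \<open>I\<close> cannot be standard, so it is divisible by the leading monomial of an element of
  \<open>G\<close>.\<close>

lemma groebner_basis_standard:
  assumes I: "ideal I (poly_ring (set vs))" and J: "ideal J (poly_ring (set vs))" and IJ: "I \<subseteq> J"
    and G: "finite G" "G \<subseteq> I"
    and red: "\<And>m. keys m \<subseteq> set vs \<Longrightarrow> \<not> Std m \<Longrightarrow>
      \<exists>L q r. m = q + L \<and> single L 1 + r \<in> G \<and> (\<forall>k\<in>keys r. lex_less vs k L)"
    and indep: "\<And>f. f \<in> J \<Longrightarrow> (\<And>k. k \<in> keys f \<Longrightarrow> Std k) \<Longrightarrow> f = 0"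
  shows "I = J" "groebner_basis (set vs) (lex_less vs) G I"
proof -
  let ?lm = "lead_mono (lex_less vs)" and ?lt = "lead_term (lex_less vs)" and ?C = "carrier (poly_ring (set vs))"
  note D = ideal_poly_ringD[OF I]
  have red': "\<And>m. keys m \<subseteq> set vs \<Longrightarrow> \<not> Std m \<Longrightarrow>
      \<exists>L q r. m = q + L \<and> single L 1 + r \<in> I \<and> (\<forall>k\<in>keys r. lex_less vs k L)"
    using red G(2) by blast
  have R: "\<exists>r \<in> ?C. f - r \<in> I \<and> (\<forall>k\<in>keys r. \<exists>m\<in>keys f. Std k \<and> (k = m \<or> lex_less vs k m))"
    if "f \<in> ?C" for f
    by (rule reduce_to_standard[OF I _ that]) (use red' in blast)
  show IJ_eq: "I = J"
  proof (intro equalityI IJ subsetI)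
    fix f assume f: "f \<in> J"
    then have "f \<in> ?C" using ideal_poly_ringD(1)[OF J] by auto
    from R[OF this] obtain r where r: "r \<in> ?C" "f - r \<in> I" "\<And>k. k \<in> keys r \<Longrightarrow> Std k" by blast
    have "f - (f - r) \<in> J" using ideal_poly_ringD(5)[OF J f] r(2) IJ by blast
    then have "r = 0" using indep r(3) by simp
    then show "f \<in> I" using r(2) by simp
  qed
  have lt_C: "?lt f \<in> ?C" if "f \<in> I - {0}" for f
  proof -
    have "?lm f \<in> keys f" "f \<in> ?C" using that D(1) lead_mono(1)[of f vs] by auto
    then show ?thesis unfolding lead_term_def
      by (intro carrier_poly_ring_closed) (auto simp: carrier_poly_ring)
  qed
  then have lt_G: "?lt ` (G - {0}) \<subseteq> ?C" and lt_I: "?lt ` (I - {0}) \<subseteq> ?C" using G(2) by auto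
  note gG = genideal_poly_ring[OF lt_G] and gI = genideal_poly_ring[OF lt_I]
  have "?lt f \<in> genideal (poly_ring (set vs)) (?lt ` (G - {0}))" if f: "f \<in> I" "f \<noteq> 0" for f
  proof -
    define m where "m = ?lm f"
    define c where "c = lookup f m"
    have fC: "f \<in> ?C" using f D(1) by auto
    have m: "m \<in> keys f" "\<And>k. k \<in> keys f \<Longrightarrow> k \<noteq> m \<Longrightarrow> lex_less vs k m"
      using lead_mono[OF fC f(2)] by (auto simp: m_def)
    have mV: "keys m \<subseteq> set vs" using m(1) fC by (auto simp: carrier_poly_ring)
    have c0: "c \<noteq> 0" using m(1) by (simp add: c_def in_keys_iff)
    have "\<not> Std m"
    proof
      assume std: "Std m"
      \<comment> \<open>Only the lower terms are reduced. Their remainder stays below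
        \<open>m\<close>, so the coefficient \<open>c\<close> survives in a standard combination
        belonging to \<open>J\<close>.\<close>
      define f' where "f' = f - single m c"
      have f'C: "f' \<in> ?C" unfolding f'_def by (intro carrier_poly_ring_closed fC mV)
      have f': "lex_less vs k m" if "k \<in> keys f'" for k
        using that m(2)[of k] by (cases "k = m") (auto simp: f'_def c_def in_keys_iff lookup_minus lookup_single_not_eq)
      from R[OF f'C] obtain r where r: "r \<in> ?C" "f' - r \<in> I"
        "\<And>k. k \<in> keys r \<Longrightarrow> \<exists>m\<in>keys f'. Std k \<and> (k = m \<or> lex_less vs k m)" by blast
      have rm: "m \<notin> keys r"
      proof
        assume "m \<in> keys r"
        then obtain k where "k \<in> keys f'" "m = k \<or> lex_less vs m k" using r(3) by blast
        then have "lex_less vs m m" using f' lex_less_trans by blast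
        then show False by (simp add: lex_less_irrefl)
      qed
      have "f - (f' - r) \<in> J" using ideal_poly_ringD(5)[OF J] f r(2) IJ by blast
      then have "single m c + r \<in> J" by (simp add: f'_def)
      moreover have "Std k" if "k \<in> keys (single m c + r)" for k
        using that keys_add[of "single m c" r] std r(3) by (auto split: if_splits)
      ultimately have "single m c + r = 0" using indep by blast
      then have "lookup (single m c + r) m = 0" by simp
      then show False using rm c0 by (simp add: lookup_add in_keys_iff)
    qed
    from red[OF mV this] obtain L q r where L: "m = q + L" "single L 1 + r \<in> G"
      "\<And>k. k \<in> keys r \<Longrightarrow> lex_less vs k L" by blast
    define g where "g = single L 1 + r"
    have rL: "lookup r L = 0" using L(3) lex_less_irrefl by (meson in_keys_iff)
    then have gL: "lookup g L = 1" by (simp add: g_def lookup_add)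
    have "?lm g = L"
    proof (rule lead_mono_eqI)
      show "L \<in> keys g" using gL by (simp add: in_keys_iff)
      fix k assume "k \<in> keys g" "k \<noteq> L"
      then have "k \<in> keys r" by (auto simp: g_def in_keys_iff lookup_add lookup_single_not_eq)
      then show "lex_less vs k L" by (rule L)
    qed
    then have lg: "?lt g = single L 1" using gL by (simp add: lead_term_def)
    have "?lt f = single m c"
      by (simp add: lead_term_def m_def[symmetric] c_def[symmetric])
    also have "\<dots> = single q c * ?lt g"
      by (simp add: lg L(1) mult_single)
    finally have "?lt f = single q c * ?lt g" .
    moreover have "g \<in> G - {0}" using L(2) gL by (auto simp: g_def)
    then have "?lt g \<in> genideal (poly_ring (set vs)) (?lt ` (G - {0}))" using gG(2) by auto
    moreover have "single q c \<in> ?C" using mV L(1) by (intro carrier_poly_ring_closed) (auto simp: keys_add_nat)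
    ultimately show ?thesis using ideal_poly_ringD(4)[OF gG(1)] by simp
  qed
  then have "genideal (poly_ring (set vs)) (?lt ` (I - {0})) \<subseteq> genideal (poly_ring (set vs)) (?lt ` (G - {0}))"
    by (intro gI(3) gG(1)) auto
  moreover have "genideal (poly_ring (set vs)) (?lt ` (G - {0})) \<subseteq> genideal (poly_ring (set vs)) (?lt ` (I - {0}))"
    using gI(2) G(2) by (intro gG(3) gI(1)) auto
  ultimately show "groebner_basis (set vs) (lex_less vs) G I"
    using G by (simp add: groebner_basis_def initial_ideal_def)
qed

section \<open>Combinatorics of exponents\<close>

text \<open>The pair formed by the least first and the greatest second component must occur, so it can
  be split off.\<close>

lemma antitone_pairs_unique:
  fixes A B :: "('a::linorder \<times> 'b::linorder) multiset"
  assumes "\<And>p q. p \<in># A \<Longrightarrow> q \<in># A \<Longrightarrow> fst p < fst q \<Longrightarrow> snd q \<le> snd p"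
    and "\<And>p q. p \<in># B \<Longrightarrow> q \<in># B \<Longrightarrow> fst p < fst q \<Longrightarrow> snd q \<le> snd p"
    and "image_mset fst A = image_mset fst B" "image_mset snd A = image_mset snd B"
  shows "A = B"
  using assms
proof (induction "size A" arbitrary: A B)
  case 0
  then show ?case by auto
next
  case (Suc n)
  define x where "x = Min (fst ` set_mset A)"
  define y where "y = Max (snd ` set_mset A)"
  have corner: "(Min (fst ` set_mset C), Max (snd ` set_mset C)) \<in># C"
    if C: "C \<noteq> {#}" "\<And>p q. p \<in># C \<Longrightarrow> q \<in># C \<Longrightarrow> fst p < fst q \<Longrightarrow> snd q \<le> snd p"
    for C :: "('a \<times> 'b) multiset"
  proof -
    let ?x = "Min (fst ` set_mset C)" and ?y = "Max (snd ` set_mset C)"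
    have "?x \<in> fst ` set_mset C" "?y \<in> snd ` set_mset C" using C(1) by simp_all
    then obtain p q where p: "p \<in># C" "?x = fst p" and q: "q \<in># C" "?y = snd q"
      by (elim imageE) blast
    have le: "?x \<le> fst q" "snd p \<le> ?y" using p(1) q(1) by simp_all
    show ?thesis
    proof (cases "fst q = ?x")
      case True
      then show ?thesis using q by (cases q) simp
    next
      case False
      then have "snd q \<le> snd p" using C(2)[OF p(1) q(1)] le p(2) by auto
      then have "snd p = ?y" using le q by auto
      then show ?thesis using p by (cases p) simp
    qed
  qed
  have ne: "A \<noteq> {#}" "B \<noteq> {#}" using Suc(2,5) by auto
  have sets: "fst ` set_mset A = fst ` set_mset B" "snd ` set_mset A = snd ` set_mset B"
    using Suc(5,6) by (metis set_image_mset)+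
  have "(x, y) \<in># A" "(x, y) \<in># B"
    using corner[OF ne(1) Suc(3)] corner[OF ne(2) Suc(4)] by (auto simp: x_def y_def sets)
  then obtain A' B' where AB: "A = add_mset (x, y) A'" "B = add_mset (x, y) B'"
    by (metis insert_DiffM)
  have "A' = B'"
    by (rule Suc(1)) (use Suc(2-) AB in auto)
  then show ?case using AB by simp
qed

text \<open>A prefix of length \<open>Suc k\<close> is a pair of a prefix of length \<open>k\<close>
  and an entry. For the lexicographic order on prefixes these pairs are antitone, so by
  \<open>antitone_pairs_unique\<close> they are determined by the shorter prefixes and the next
  marginal.\<close>

lemma standard_lists_unique:
  fixes A B :: "nat list multiset"
  assumes lenA: "\<And>s. s \<in># A \<Longrightarrow> length s = n" and lenB: "\<And>s. s \<in># B \<Longrightarrow> length s = n"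
    and A: "\<And>s t k l. s \<in># A \<Longrightarrow> t \<in># A \<Longrightarrow> k < l \<Longrightarrow> l < n \<Longrightarrow> take k s = take k t \<Longrightarrow>
      s ! k < t ! k \<Longrightarrow> t ! l \<le> s ! l"
    and B: "\<And>s t k l. s \<in># B \<Longrightarrow> t \<in># B \<Longrightarrow> k < l \<Longrightarrow> l < n \<Longrightarrow> take k s = take k t \<Longrightarrow>
      s ! k < t ! k \<Longrightarrow> t ! l \<le> s ! l"
    and sz: "size A = size B"
    and marg: "\<And>i. i < n \<Longrightarrow> image_mset (\<lambda>s. s ! i) A = image_mset (\<lambda>s. s ! i) B"
  shows "A = B"
proof -
  have "image_mset (take k) A = image_mset (take k) B" if "k \<le> n" for k
    using that
  proof (induction k)
    case 0
    \<comment> \<open>All prefixes are empty here, so only the number of lists matters.\<close>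
    then show ?case using sz by (simp add: image_mset_const_eq)
  next
    case (Suc k)
    let ?p = "\<lambda>s :: nat list. (take k s, s ! k)"
    have less: "t ! k \<le> s ! k" if st: "take k s < take k t" and len: "length s = n" "length t = n"
      and C: "\<And>i l. i < l \<Longrightarrow> l < n \<Longrightarrow> take i s = take i t \<Longrightarrow> s ! i < t ! i \<Longrightarrow> t ! l \<le> s ! l"
      for s t :: "nat list"
    proof -
      \<comment> \<open>The two prefixes first differ at some \<open>i < k\<close>; the hypothesis
        for \<open>i\<close> and \<open>k\<close> then orders the entries at
        \<open>k\<close>.\<close>
      have "(take k s, take k t) \<in> lexord {(u, v). u < v}"
        using st by (simp add: list_less_def)
      then have "\<exists>i. i < min k n \<and> take i (take k s) = take i (take k t) \<and> (take k s ! i, take k t ! i) \<in> {(u, v). u < v}"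
        using len Suc(2) unfolding lexord_take_index_conv by auto
      then obtain i where "i < k" "take i s = take i t" "s ! i < t ! i"
        using Suc(2) by (auto simp: min_def split: if_splits)
      then show ?thesis using C[of i k] Suc(2) by auto
    qed
    have "image_mset ?p A = image_mset ?p B"
    proof (rule antitone_pairs_unique)
      fix p q
      show "snd q \<le> snd p" if "p \<in># image_mset ?p A" "q \<in># image_mset ?p A" "fst p < fst q"
        using that by (auto intro!: less A dest: lenA)
      show "snd q \<le> snd p" if "p \<in># image_mset ?p B" "q \<in># image_mset ?p B" "fst p < fst q"
        using that by (auto intro!: less B dest: lenB)
      show "image_mset fst (image_mset ?p A) = image_mset fst (image_mset ?p B)"
        using Suc by (simp add: image_mset.compositionality comp_def)
      show "image_mset snd (image_mset ?p A) = image_mset snd (image_mset ?p B)"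
        using Suc marg[of k] by (simp add: image_mset.compositionality comp_def)
    qed
    then have "image_mset (\<lambda>(x, y). x @ [y]) (image_mset ?p A) = image_mset (\<lambda>(x, y). x @ [y]) (image_mset ?p B)"
      by simp
    moreover have "image_mset (\<lambda>(x, y). x @ [y]) (image_mset ?p C) = image_mset (take (Suc k)) C"
      if "\<And>s. s \<in># C \<Longrightarrow> length s = n" for C
      unfolding image_mset.compositionality comp_def
      by (rule image_mset_cong) (use that Suc(2) in \<open>auto simp: take_Suc_conv_app_nth\<close>)
    ultimately show ?case using lenA lenB by simp
  qed
  from this[OF order_refl] show ?thesis
    using image_mset_cong[of A "take n" id] image_mset_cong[of B "take n" id] lenA lenB by simp
qed

text \<open>View \<open>a\<close> as the bottom part of a multiset with multiplicities
  \<open>a j + b j\<close>: every value used by \<open>a\<close> is at most every value used by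
  \<open>b\<close>. The size of \<open>a\<close> then fixes which elements belong to it.\<close>

lemma separated_sum_unique:
  fixes a b a' b' :: "nat \<Rightarrow> nat"
  assumes "\<And>j. j \<in> {1..d} \<Longrightarrow> a j + b j = a' j + b' j"
    and "(\<Sum>j=1..d. a j) = (\<Sum>j=1..d. a' j)"
    and "\<And>j j'. j \<in> {1..d} \<Longrightarrow> j' \<in> {1..d} \<Longrightarrow> a j > 0 \<Longrightarrow> b j' > 0 \<Longrightarrow> j \<le> j'"
    and "\<And>j j'. j \<in> {1..d} \<Longrightarrow> j' \<in> {1..d} \<Longrightarrow> a' j > 0 \<Longrightarrow> b' j' > 0 \<Longrightarrow> j \<le> j'"
    and "j \<in> {1..d}"
  shows "a j = a' j"
proof (rule ccontr)
  assume "a j \<noteq> a' j"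
  define k where "k = (LEAST k. k \<in> {1..d} \<and> a k \<noteq> a' k)"
  have k: "k \<in> {1..d} \<and> a k \<noteq> a' k"
    unfolding k_def by (rule LeastI[of _ j]) (use assms(5) \<open>a j \<noteq> a' j\<close> in auto)
  have below: "a i = a' i" if "i \<in> {1..d}" "i < k" for i
    using not_less_Least[of i "\<lambda>k. k \<in> {1..d} \<and> a k \<noteq> a' k"] that by (auto simp: k_def)
  have False if eq: "\<And>j. j \<in> {1..d} \<Longrightarrow> a j + b j = a' j + b' j"
    and s: "(\<Sum>j=1..d. a j) = (\<Sum>j=1..d. a' j)"
    and sep: "\<And>j j'. j \<in> {1..d} \<Longrightarrow> j' \<in> {1..d} \<Longrightarrow> a j > 0 \<Longrightarrow> b j' > 0 \<Longrightarrow> j \<le> j'"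
    and lt: "a k < a' k" and below: "\<And>i. i \<in> {1..d} \<Longrightarrow> i < k \<Longrightarrow> a i = a' i"
    for a b a' b' :: "nat \<Rightarrow> nat"
  proof -
    \<comment> \<open>Beyond the first difference \<open>k\<close> nothing of \<open>a\<close> is
      left, because \<open>b\<close> already uses \<open>k\<close>. Hence \<open>a\<close> is
      pointwise below \<open>a'\<close>, strictly at \<open>k\<close>.\<close>
    have "b k > 0" using eq[of k] k lt by linarith
    then have "a i = 0" if "i \<in> {1..d}" "k < i" for i
      using sep[of i k] that k by fastforce
    then have "a i \<le> a' i" if "i \<in> {1..d}" for i
      using that below[of i] lt by (cases i k rule: linorder_cases) auto
    then have "(\<Sum>j=1..d. a j) < (\<Sum>j=1..d. a' j)"
      using k lt by (intro sum_strict_mono_ex1) auto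
    then show False using s by simp
  qed
  from this[of a b a' b'] this[of a' b' a b] show False
    using assms k below by (cases "a k < a' k") (metis linorder_neqE_nat)+
qed

section \<open>Weights that separate exponent vectors\<close>

lemma digits_unique:
  fixes c c' :: "nat \<Rightarrow> nat"
  assumes "\<And>i. i < K \<Longrightarrow> c i < B" "\<And>i. i < K \<Longrightarrow> c' i < B"
    and "(\<Sum>i<K. B ^ i * c i) = (\<Sum>i<K. B ^ i * c' i)" and "i < K"
  shows "c i = c' i"
  using assms
proof (induction K arbitrary: c c' i)
  case (Suc K)
  have eq: "c 0 + B * (\<Sum>i<K. B ^ i * c (Suc i)) = c' 0 + B * (\<Sum>i<K. B ^ i * c' (Suc i))"
    using Suc(4) unfolding sum.lessThan_Suc_shift by (simp add: sum_distrib_left mult.assoc)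
  have B: "c 0 < B" "c' 0 < B" using Suc(2,3) by auto
  from arg_cong[OF eq, of "\<lambda>x. x mod B"] B have "c 0 = c' 0" by simp
  then have s: "(\<Sum>i<K. B ^ i * c (Suc i)) = (\<Sum>i<K. B ^ i * c' (Suc i))"
    using eq B by simp
  have "c (Suc i) = c' (Suc i)" if "i < K" for i
    by (rule Suc(1)[of "\<lambda>i. c (Suc i)" "\<lambda>i. c' (Suc i)", OF _ _ s that]) (simp_all add: Suc(2,3))
  then show ?case using Suc(5) \<open>c 0 = c' 0\<close> by (cases i) auto
qed simp

text \<open>With powers of a large base as weights, the weighted sum is a numeral whose digits are
  the entries of \<open>E\<close>, so equal sums force equal entries. A higher rank gets a larger
  power.\<close>

lemma separating_weights:
  fixes F :: "('x \<Rightarrow> nat) set" and rank :: "'x \<Rightarrow> nat"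
  assumes X: "finite X" and F: "finite F"
  obtains w :: "'x \<Rightarrow> nat" where
    "\<And>x. x \<in> X \<Longrightarrow> 1 \<le> w x"
    "\<And>x y. x \<in> X \<Longrightarrow> y \<in> X \<Longrightarrow> rank x < rank y \<Longrightarrow> w x < w y"
    "\<And>E E' x. E \<in> F \<Longrightarrow> E' \<in> F \<Longrightarrow> (\<Sum>x\<in>X. w x * E x) = (\<Sum>x\<in>X. w x * E' x) \<Longrightarrow> x \<in> X \<Longrightarrow> E x = E' x"
proof -
  obtain e :: "'x \<Rightarrow> nat" and M where e: "e ` X = {i. i < M}" "inj_on e X"
    using finite_imp_inj_to_nat_seg[OF X] by blast
  have eM: "e x < M" if "x \<in> X" for x using e(1) that by blast
  \<comment> \<open>\<open>e\<close> enumerates \<open>X\<close> below \<open>M\<close>; putting the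
    rank in front keeps positions distinct and makes them increase with the rank.\<close>
  define pos where "pos x = rank x * M + e x" for x
  have pos_inj: "inj_on pos X"
  proof (rule inj_onI)
    fix x y assume xy: "x \<in> X" "y \<in> X" "pos x = pos y"
    from arg_cong[OF xy(3), of "\<lambda>n. n mod M"] have "e x = e y"
      using eM xy(1,2) by (simp add: pos_def)
    then show "x = y" using e(2) xy by (auto dest: inj_onD)
  qed
  \<comment> \<open>Larger than the sum of the entries of any member of \<open>F\<close>, hence than
    every digit; the summand 2 makes it a base even if \<open>F\<close> is empty.\<close>
  define B where "B = 2 + (\<Sum>E\<in>F. \<Sum>x\<in>X. E x)"
  define K where "K = Suc (\<Sum>x\<in>X. pos x)"
  have posK: "pos x < K" if "x \<in> X" for x
    unfolding K_def using member_le_sum[of x X pos] X that by simp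
  define w where "w x = B ^ pos x" for x
  have B: "B > 1" by (simp add: B_def)
  show ?thesis
  proof (rule that)
    show "1 \<le> w x" if "x \<in> X" for x
      using B by (simp add: w_def)
    show "w x < w y" if xy: "x \<in> X" "y \<in> X" "rank x < rank y" for x y
    proof -
      have "Suc (rank x) * M \<le> rank y * M" using xy(3) by (intro mult_right_mono) auto
      then have "pos x < pos y" using eM[OF xy(1)] by (simp add: pos_def)
      then show ?thesis using B by (simp add: w_def)
    qed
    fix E E' x assume E: "E \<in> F" "E' \<in> F" and eq: "(\<Sum>x\<in>X. w x * E x) = (\<Sum>x\<in>X. w x * E' x)" and x: "x \<in> X"
    \<comment> \<open>A position that no \<open>x\<close> occupies carries the digit 0, an occupied
      one exactly one entry.\<close>
    define c where "c E i = (\<Sum>x | x \<in> X \<and> pos x = i. E x)" for E :: "'x \<Rightarrow> nat" and i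
    have digits: "(\<Sum>x\<in>X. w x * E x) = (\<Sum>i<K. B ^ i * c E i)" for E
    proof -
      have "(\<Sum>i<K. \<Sum>x | x \<in> X \<and> pos x = i. w x * E x) = (\<Sum>x\<in>X. w x * E x)"
        by (rule sum.group) (use X posK in auto)
      moreover have "(\<Sum>x | x \<in> X \<and> pos x = i. w x * E x) = B ^ i * c E i" for i
        unfolding c_def sum_distrib_left by (rule sum.cong) (auto simp: w_def)
      ultimately show ?thesis by simp
    qed
    have cB: "c E i < B" if "E \<in> F" for E i
    proof -
      have "c E i \<le> (\<Sum>x\<in>X. E x)"
        unfolding c_def by (rule sum_mono2) (use X in auto)
      also have "\<dots> \<le> (\<Sum>E\<in>F. \<Sum>x\<in>X. E x)"
        using that F by (intro member_le_sum) auto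
      finally show ?thesis by (simp add: B_def)
    qed
    have "c E (pos x) = c E' (pos x)"
      by (rule digits_unique[of K _ B]) (use eq digits cB E posK x in auto)
    moreover have "{y. y \<in> X \<and> pos y = pos x} = {x}"
      using pos_inj x by (auto dest: inj_onD)
    ultimately show "E x = E' x" by (simp add: c_def)
  qed
qed

section \<open>Monic polynomials in one variable\<close>

text \<open>Degree and leading coefficient are tracked together: the leading coefficient 1 rules out
  the zero polynomial, whose degree is 0 as well.\<close>

definition monic_deg :: "nat \<Rightarrow> complex poly \<Rightarrow> bool" where
  "monic_deg d p \<longleftrightarrow> degree p = d \<and> lead_coeff p = 1"

lemma monic_deg_1: "monic_deg 0 1"
  by (simp add: monic_deg_def)

lemma monic_deg_monom: "monic_deg d (monom 1 d)"
  by (simp add: monic_deg_def degree_monom_eq)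

lemma monic_deg_mult: "monic_deg d p \<Longrightarrow> monic_deg e q \<Longrightarrow> monic_deg (d + e) (p * q)"
  unfolding monic_deg_def by (metis degree_mult_eq lead_coeff_mult leading_coeff_0_iff mult_1 zero_neq_one)

lemma monic_deg_power: "monic_deg d p \<Longrightarrow> monic_deg (k * d) (p ^ k)"
  by (induction k) (auto simp: monic_deg_1 intro: monic_deg_mult)

lemma monic_deg_prod: "(\<And>i. i \<in> A \<Longrightarrow> monic_deg (d i) (p i)) \<Longrightarrow> monic_deg (sum d A) (prod p A)"
  by (induction A rule: infinite_finite_induct) (auto simp: monic_deg_1 intro: monic_deg_mult)

lemma monic_deg_add: "monic_deg d p \<Longrightarrow> degree q < d \<Longrightarrow> monic_deg d (p + q)"
  by (auto simp: monic_deg_def degree_add_eq_left coeff_eq_0)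

lemma monic_deg_diff: "monic_deg d p \<Longrightarrow> degree q < d \<Longrightarrow> monic_deg d (p - q)"
  using monic_deg_add[of d p "- q"] by simp

lemma degree_sum_less:
  "d > 0 \<Longrightarrow> (\<And>i. i \<in> A \<Longrightarrow> degree (p i) < d) \<Longrightarrow> degree (sum p A :: 'a::comm_monoid_add poly) < d"
  by (induction A rule: infinite_finite_induct) (auto intro: degree_add_less)

text \<open>The largest degree is attained only once, so its coefficient cannot cancel.\<close>

lemma sum_monic_neq_0:
  assumes M: "finite M" "M \<noteq> {}" and inj: "inj_on d M"
    and p: "\<And>m. m \<in> M \<Longrightarrow> monic_deg (d m) (p m)" and c: "\<And>m. m \<in> M \<Longrightarrow> c m \<noteq> 0"
  shows "(\<Sum>m\<in>M. smult (c m) (p m)) \<noteq> 0"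
proof
  assume z: "(\<Sum>m\<in>M. smult (c m) (p m)) = 0"
  have "Max (d ` M) \<in> d ` M" using M by simp
  then obtain m where m: "m \<in> M" "d m = Max (d ` M)" by auto
  have "coeff (p m') (d m) = 0" if "m' \<in> M" "m' \<noteq> m" for m'
  proof (rule coeff_eq_0)
    have "d m' \<le> d m" using m M that by simp
    moreover have "d m' \<noteq> d m" using inj_onD[OF inj, of m' m] that m(1) by auto
    ultimately show "degree (p m') < d m" using p[OF that(1)] by (simp add: monic_deg_def)
  qed
  then have "coeff (\<Sum>m\<in>M. smult (c m) (p m)) (d m) = c m * coeff (p m) (d m)"
    unfolding coeff_sum using M m by (subst sum.remove[of M m]) auto
  also have "coeff (p m) (d m) = 1" using p[OF m(1)] by (auto simp: monic_deg_def)
  finally show False using z c[OF m(1)] by simp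
qed

section \<open>Multi-indices\<close>

lemma list_lessI:
  fixes s t :: "nat list"
  assumes "length s = length t" "k < length s" "take k s = take k t" "s ! k < t ! k"
  shows "s < t"
  unfolding list_less_def lexord_take_index_conv using assms by auto

lemma list_lessI_least:
  fixes s t :: "nat list"
  assumes len: "length s = length t" and ne: "s \<noteq> t"
    and le: "\<And>k. k < length s \<Longrightarrow> s ! k \<le> t ! k"
  shows "s < t"
proof -
  obtain k0 where k0: "k0 < length s" "s ! k0 \<noteq> t ! k0"
    using len ne nth_equalityI by blast
  define k where "k = (LEAST k. s ! k \<noteq> t ! k)"
  have k: "s ! k \<noteq> t ! k" unfolding k_def by (rule LeastI[of _ k0]) (use k0 in simp)
  have kk0: "k \<le> k0" unfolding k_def by (rule Least_le) (use k0 in simp)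
  have eq: "s ! l = t ! l" if "l < k" for l
    using not_less_Least[of l "\<lambda>k. s ! k \<noteq> t ! k"] that unfolding k_def by blast
  show ?thesis
  proof (rule list_lessI[OF len])
    show "k < length s" using kk0 k0 by simp
    then show "take k s = take k t" using len eq by (intro nth_equalityI) auto
    show "s ! k < t ! k" using le[of k] k kk0 k0 by simp
  qed
qed

text \<open>The order of variables in \<open>pu_order\<close> thereby agrees with \<open><\<close>
  on index lists, so leading monomials are found by comparing multi-indices.\<close>

lemma sorted_multi_indices: "sorted_wrt (<) (multi_indices ds)"
proof (induction ds)
  case (Cons d ds)
  have "sorted_wrt (<) (concat (map (\<lambda>x. map (Cons x) (multi_indices ds)) xs))"
    if "sorted_wrt (<) xs" for xs :: "nat list"
    using that Cons by (induction xs) (auto simp: sorted_wrt_append sorted_wrt_map)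
  then show ?case
    by (simp add: multi_indices_def del: upt_Suc)
qed (simp add: multi_indices_def)

lemma sorted_wrt_nth_lessD:
  assumes "sorted_wrt (<) xs" "i < length xs" "j < length xs" "xs ! i < (xs ! j :: 'a::linorder)"
  shows "i < j"
proof (rule ccontr)
  assume "\<not> i < j"
  then have "j < i \<or> i = j" by auto
  then show False
    using sorted_wrt_nth_less[OF assms(1), of j i] assms by auto
qed

definition omit :: "nat \<Rightarrow> 'a list \<Rightarrow> 'a list" where
  "omit i s = take i s @ drop (Suc i) s"

section \<open>Parametrization of the likelihood correspondence\<close>

locale format =
  fixes ds :: "nat list"
  assumes nonempty: "length ds \<ge> 1"
    and positive: "\<forall>i<length ds. ds ! i \<ge> 1"
begin

abbreviation n :: nat where "n \<equiv> length ds"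
abbreviation S :: "nat list set" where "S \<equiv> indices ds"
abbreviation V :: "nat list var set" where "V \<equiv> pu_vars S"

lemma n_pos: "0 < n"
  using nonempty by linarith

lemma finite_S [simp]: "finite S"
  by (simp add: indices_def)

lemma finite_V [simp]: "finite V"
  by (simp add: pu_vars_def)

lemma length_S: "s \<in> S \<Longrightarrow> length s = n"
  by (simp add: indices_iff)

lemma nth_S: "s \<in> S \<Longrightarrow> i < n \<Longrightarrow> s ! i \<in> {1..ds ! i}"
  by (auto simp: indices_iff)

lemma update_S: "s \<in> S \<Longrightarrow> j \<in> {1..ds ! i} \<Longrightarrow> s[i := j] \<in> S"
  by (cases "i < length s") (auto simp: indices_iff nth_list_update)

definition ones :: "nat list" where "ones = replicate n 1"
definition axis :: "nat \<Rightarrow> nat \<Rightarrow> nat list" where "axis i j = ones[i := j]"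
definition Axis :: "nat list set" where "Axis = {axis i j | i j. i < n \<and> j \<in> {1..ds ! i}}"

lemma ones_S: "ones \<in> S"
  using positive by (auto simp: ones_def indices_iff)

lemma axis_S: "j \<in> {1..ds ! i} \<Longrightarrow> axis i j \<in> S"
  by (simp add: axis_def update_S ones_S)

lemma Axis_S: "Axis \<subseteq> S"
  by (auto simp: Axis_def axis_S)

lemma axis_nth: "k < n \<Longrightarrow> axis i j ! k = (if k = i then j else 1)"
  by (simp add: axis_def ones_def nth_list_update)

lemma axis_1: "axis i 1 = ones"
  unfolding axis_def ones_def by (cases "i < n") (auto simp: list_eq_iff_nth_eq nth_list_update)

lemma ones_Axis: "ones \<in> Axis"
proof -
  have "1 \<in> {1..ds ! 0}" using positive n_pos by simp
  then show ?thesis unfolding Axis_def using n_pos axis_1[of 0] by force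
qed

lemma axis_ne_ones: "i < n \<Longrightarrow> j \<ge> 2 \<Longrightarrow> axis i j \<noteq> ones"
proof
  assume "i < n" "j \<ge> 2" "axis i j = ones"
  then show False using axis_nth[of i i j] by (simp add: ones_def)
qed

text \<open>For \<open>j \<ge> 2\<close> a slice meets the axes in one point only. This makes the
  equations for the axis coordinates of \<open>u\<close> independent of each other.\<close>

lemma Axis_eq_axis:
  assumes "s \<in> Axis" "i < n" "s ! i = j" "j \<ge> 2"
  shows "s = axis i j"
proof -
  obtain i' j' where s: "s = axis i' j'" "i' < n" using assms(1) by (auto simp: Axis_def)
  then have "i' = i" using assms axis_nth[of i i' j'] by (auto split: if_splits)
  then show ?thesis using s assms axis_nth[of i i' j'] by auto
qed

lemma Axis_cases:
  assumes "s \<in> Axis"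
  obtains "s = ones" | i j where "i < n" "2 \<le> j" "j \<le> ds ! i" "s = axis i j"
proof -
  obtain i j where s: "s = axis i j" "i < n" "j \<in> {1..ds ! i}" using assms by (auto simp: Axis_def)
  show ?thesis
  proof (cases "j = 1")
    case True
    then show ?thesis using that(1) s axis_1 by simp
  next
    case False
    then show ?thesis using that(2)[of i j] s by auto
  qed
qed

lemma axis_off: "i < n \<Longrightarrow> j \<ge> 2 \<Longrightarrow> {k. k < n \<and> axis i j ! k \<noteq> 1} = {i}"
  by (auto simp: axis_nth split: if_splits)

section \<open>Rank one tensors and vectors with proportional marginals\<close>

definition total :: "(nat \<Rightarrow> nat \<Rightarrow> 'r::comm_ring_1) \<Rightarrow> nat \<Rightarrow> 'r" where
  "total a k = (\<Sum>j=1..ds ! k. a k j)"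

definition rank1 :: "(nat \<Rightarrow> nat \<Rightarrow> 'r::comm_ring_1) \<Rightarrow> nat list \<Rightarrow> 'r" where
  "rank1 a s = (\<Prod>i<n. a i (s ! i))"

text \<open>By \<open>sum_rank1_fiber\<close> this is a marginal of \<open>t\<close> times
  \<open>rank1 a\<close>. Here \<open>t\<close> stands for the ratio of the total sums of
  \<open>u\<close> and \<open>p\<close>, taken as a parameter to avoid a quotient.\<close>

definition marginal :: "(nat \<Rightarrow> nat \<Rightarrow> 'r::comm_ring_1) \<Rightarrow> 'r \<Rightarrow> nat \<Rightarrow> nat \<Rightarrow> 'r" where
  "marginal a t i j = t * (a i j * (\<Prod>k\<in>{..<n} - {i}. total a k))"

text \<open>The coordinates of \<open>u\<close> off the axes through \<open>(1, \<dots>, 1)\<close> are free; those on the axes are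
  solved for from the marginals, and the one at \<open>(1, \<dots>, 1)\<close> from the total sum.  The sum over \<open>i\<close>
  has a single term.\<close>

definition param_u' :: "(nat \<Rightarrow> nat \<Rightarrow> 'r::comm_ring_1) \<Rightarrow> 'r \<Rightarrow> (nat list \<Rightarrow> 'r) \<Rightarrow> nat list \<Rightarrow> 'r" where
  "param_u' a t u s = (if s \<in> Axis
     then \<Sum>i | i < n \<and> s ! i \<noteq> 1. marginal a t i (s ! i) - (\<Sum>r | r \<in> S \<and> r ! i = s ! i \<and> r \<noteq> s. u r)
     else u s)"

definition param_u :: "(nat \<Rightarrow> nat \<Rightarrow> 'r::comm_ring_1) \<Rightarrow> 'r \<Rightarrow> (nat list \<Rightarrow> 'r) \<Rightarrow> nat list \<Rightarrow> 'r" where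
  "param_u a t u s = (if s = ones
     then t * (\<Prod>k<n. total a k) - (\<Sum>r\<in>S - {ones}. param_u' a t u r) else param_u' a t u s)"

definition param :: "(nat \<Rightarrow> nat \<Rightarrow> 'r::comm_ring_1) \<Rightarrow> 'r \<Rightarrow> (nat list \<Rightarrow> 'r) \<Rightarrow> nat list var \<Rightarrow> 'r" where
  "param a t u = case_var (rank1 a) (param_u a t u)"

lemma param_simps [simp]:
  "param a t u (Pvar s) = rank1 a s" "param a t u (Uvar s) = param_u a t u s"
  by (simp_all add: param_def)

lemma param_u_free: "s \<notin> Axis \<Longrightarrow> param_u a t u s = u s"
  using ones_Axis by (auto simp: param_u_def param_u'_def)

lemma param_u_axis:
  assumes "i < n" "2 \<le> j" "j \<le> ds ! i"
  shows "param_u a t u (axis i j) = marginal a t i j - (\<Sum>r | r \<in> S \<and> r ! i = j \<and> r \<noteq> axis i j. u r)"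
proof -
  have "axis i j \<in> Axis" unfolding Axis_def using assms by force
  then show ?thesis
    using assms by (simp add: param_u_def param_u'_def axis_ne_ones axis_off[simplified] axis_nth)
qed

lemma param_u_ones:
  "param_u a t u ones = t * (\<Prod>k<n. total a k) - (\<Sum>r\<in>S - {ones}. param_u a t u r)"
  by (simp add: param_u_def)

lemma sum_param_u: "(\<Sum>s\<in>S. param_u a t u s) = t * (\<Prod>k<n. total a k)"
  using ones_S by (simp add: sum.remove[of S ones] param_u_ones)

lemma sum_fibers: "i < n \<Longrightarrow> (\<Sum>j=1..ds ! i. \<Sum>s | s \<in> S \<and> s ! i = j. f s) = (\<Sum>s\<in>S. f s)"
  by (rule sum.group) (use nth_S in auto)

text \<open>For \<open>j \<ge> 2\<close> the axis coordinate was chosen to make this true. The slice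
  \<open>j = 1\<close> is the rest of the total sum, and in every direction the prescribed marginals
  add up to the same \<open>t * (\<Prod>k<n. total a k)\<close>.\<close>

lemma sum_param_u_fiber:
  assumes i: "i < n" and j: "j \<in> {1..ds ! i}"
  shows "(\<Sum>s | s \<in> S \<and> s ! i = j. param_u a t u s) = marginal a t i j"
proof -
  have ge2: "(\<Sum>s | s \<in> S \<and> s ! i = j. param_u a t u s) = marginal a t i j" if "j \<in> {2..ds ! i}" for j
  proof -
    let ?R = "{r. r \<in> S \<and> r ! i = j \<and> r \<noteq> axis i j}"
    have "{s. s \<in> S \<and> s ! i = j} = insert (axis i j) ?R"
      using that i axis_S axis_nth by auto
    then have "(\<Sum>s | s \<in> S \<and> s ! i = j. param_u a t u s) = param_u a t u (axis i j) + (\<Sum>r\<in>?R. param_u a t u r)"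
      by simp
    also have "(\<Sum>r\<in>?R. param_u a t u r) = (\<Sum>r\<in>?R. u r)"
    proof (rule sum.cong)
      fix r assume "r \<in> ?R"
      then have "r \<notin> Axis" using Axis_eq_axis[of r i j] i that by auto
      then show "param_u a t u r = u r" by (rule param_u_free)
    qed simp
    finally show ?thesis using that i by (simp add: param_u_axis)
  qed
  show ?thesis
  proof (cases "j = 1")
    case False
    then show ?thesis using ge2 j by auto
  next
    case True
    have split: "{1..ds ! i} = insert 1 {2..ds ! i}" using j by auto
    have "marginal a t i 1 + (\<Sum>j=2..ds ! i. marginal a t i j) = (\<Sum>j=1..ds ! i. marginal a t i j)"
      unfolding split by simp
    also have "\<dots> = t * (total a i * (\<Prod>k\<in>{..<n} - {i}. total a k))"
      by (simp add: marginal_def total_def sum_distrib_left sum_distrib_right)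
    also have "\<dots> = (\<Sum>s\<in>S. param_u a t u s)"
      using i by (simp add: sum_param_u prod.remove[of "{..<n}" i])
    also have "\<dots> = (\<Sum>j=1..ds ! i. \<Sum>s | s \<in> S \<and> s ! i = j. param_u a t u s)"
      by (rule sum_fibers[OF i, symmetric])
    also have "\<dots> = (\<Sum>s | s \<in> S \<and> s ! i = 1. param_u a t u s) + (\<Sum>j=2..ds ! i. marginal a t i j)"
      unfolding split by (simp add: ge2)
    finally show ?thesis using True by simp
  qed
qed

lemma rank1_update:
  assumes "s \<in> S" "i < n"
  shows "rank1 a (s[i := j]) = a i j * (\<Prod>k\<in>{..<n} - {i}. a k (s ! k))"
proof -
  have "rank1 a (s[i := j]) = a i (s[i := j] ! i) * (\<Prod>k\<in>{..<n} - {i}. a k (s[i := j] ! k))"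
    unfolding rank1_def using assms(2) by (intro prod.remove) auto
  moreover have "(\<Prod>k\<in>{..<n} - {i}. a k (s[i := j] ! k)) = (\<Prod>k\<in>{..<n} - {i}. a k (s ! k))"
    by (rule prod.cong) auto
  ultimately show ?thesis using assms length_S by simp
qed

lemma sum_rank1: "(\<Sum>s\<in>S. rank1 a s) = (\<Prod>k<n. total a k)"
proof -
  have "(\<Prod>k<n. total a k) = (\<Sum>f\<in>Pi\<^sub>E {..<n} (\<lambda>k. {1..ds ! k}). \<Prod>k<n. a k (f k))"
    unfolding total_def by (rule prod_sum_PiE) auto
  also have "\<dots> = (\<Sum>s\<in>S. rank1 a s)"
    unfolding rank1_def
    by (rule sum.reindex_bij_witness[where i = "\<lambda>s. restrict (nth s) {..<n}" and j = "\<lambda>f. map f [0..<n]"])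
      (auto simp: indices_iff PiE_iff extensional_def fun_eq_iff intro!: nth_equalityI prod.cong)
  finally show ?thesis by simp
qed

lemma sum_rank1_fiber:
  assumes i: "i < n" and j: "j \<in> {1..ds ! i}"
  shows "(\<Sum>s | s \<in> S \<and> s ! i = j. rank1 a s) = a i j * (\<Prod>k\<in>{..<n} - {i}. total a k)"
proof -
  \<comment> \<open>Zeroing all other values in direction \<open>i\<close> turns the slice sum into
    a full sum, which \<open>sum_rank1\<close> factors.\<close>
  define b where "b k l = (if k = i then (if l = j then a i j else 0) else a k l)" for k l
  have "(\<Sum>s | s \<in> S \<and> s ! i = j. rank1 a s) = (\<Sum>s\<in>S. rank1 b s)"
  proof (rule sum.mono_neutral_cong_left)
    show "\<forall>s\<in>S - {s. s \<in> S \<and> s ! i = j}. rank1 b s = 0"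
    proof
      fix s assume "s \<in> S - {s. s \<in> S \<and> s ! i = j}"
      then show "rank1 b s = 0"
        unfolding rank1_def using i by (intro prod_zero) (auto simp: b_def)
    qed
    fix s assume "s \<in> {s. s \<in> S \<and> s ! i = j}"
    then show "rank1 a s = rank1 b s" unfolding rank1_def by (intro prod.cong) (auto simp: b_def)
  qed auto
  also have "\<dots> = total b i * (\<Prod>k\<in>{..<n} - {i}. total b k)"
    using i by (simp add: sum_rank1 prod.remove[of "{..<n}" i])
  also have "total b i = a i j" using j by (simp add: total_def b_def sum.delta)
  also have "(\<Prod>k\<in>{..<n} - {i}. total b k) = (\<Prod>k\<in>{..<n} - {i}. total a k)"
    by (rule prod.cong) (auto simp: total_def b_def)
  finally show ?thesis .
qed

section \<open>The matrices and their minors\<close>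

text \<open>A column is represented by its multi-index with value 1 in position \<open>i\<close>;
  the entry in row \<open>r\<close> arises by updating that position to
  \<open>Suc r\<close>.\<close>

definition col :: "nat \<Rightarrow> nat \<Rightarrow> nat list" where
  "col i c = insert_index i 1 (remaining_indices ds i ! c)"

abbreviation ncol :: "nat \<Rightarrow> nat" where "ncol i \<equiv> prod_list ds div ds ! i"

lemma insert_index_update: "i \<le> length t \<Longrightarrow> insert_index i j t = (insert_index i 1 t)[i := j]"
  by (simp add: insert_index_def list_update_append)

lemma omit_indices: "s \<in> S \<Longrightarrow> omit i s \<in> indices (omit i ds)"
  by (auto simp: omit_def indices_iff nth_append)

lemma insert_omit: "s \<in> S \<Longrightarrow> i < n \<Longrightarrow> insert_index i j (omit i s) = s[i := j]"
  using length_S[of s] by (simp add: insert_index_def omit_def upd_conv_take_nth_drop)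

lemma remaining_set: "set (remaining_indices ds i) = indices (omit i ds)"
  by (simp add: remaining_indices_def omit_def indices_def)

lemma length_remaining: "i < n \<Longrightarrow> length (remaining_indices ds i) = ncol i"
  using positive by (intro length_remaining_indices) auto

lemma insert_index_S:
  assumes "t \<in> indices (omit i ds)" "i < n" "j \<in> {1..ds ! i}"
  shows "insert_index i j t \<in> S"
proof -
  have len: "length t = n - 1" using assms by (auto simp: indices_iff omit_def)
  have t: "1 \<le> t ! k \<and> t ! k \<le> omit i ds ! k" if "k < n - 1" for k
    using assms that by (auto simp: indices_iff omit_def)
  have "1 \<le> insert_index i j t ! k \<and> insert_index i j t ! k \<le> ds ! k" if k: "k < n" for k
  proof (cases k i rule: linorder_cases)
    case less
    then have "k < n - 1" using assms(2) by auto
    then show ?thesis using t[of k] less len assms(2) by (auto simp: insert_index_def omit_def nth_append)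
  next
    case equal
    then show ?thesis using assms len by (auto simp: insert_index_def nth_append)
  next
    case greater
    then obtain k' where k': "k = Suc k'" "i \<le> k'" by (cases k) auto
    then show ?thesis using t[of k'] k len assms(2)
      by (auto simp: insert_index_def omit_def nth_append nth_Cons' split: if_splits)
  qed
  moreover have "length (insert_index i j t) = n" using len assms(2) by (auto simp: insert_index_def)
  ultimately show ?thesis by (simp add: indices_iff)
qed

lemma col_S:
  assumes "i < n" "c < ncol i"
  shows "col i c \<in> S"
proof -
  have "remaining_indices ds i ! c \<in> indices (omit i ds)"
    using assms length_remaining[OF assms(1)] by (metis nth_mem remaining_set)
  then show ?thesis using assms positive unfolding col_def by (intro insert_index_S) auto
qed

lemma dim_M [simp]: "dim_row (M_matrix ds i) = ds ! i" "dim_col (M_matrix ds i) = Suc (ncol i)"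
  by (simp_all add: M_matrix_def)

lemma M_entry:
  assumes "i < n" "r < ds ! i" "c < ncol i"
  shows "M_matrix ds i $$ (r, c) = Var (Pvar ((col i c)[i := Suc r]))"
proof -
  have "remaining_indices ds i ! c \<in> indices (omit i ds)"
    using assms length_remaining[OF assms(1)] by (metis nth_mem remaining_set)
  then have "i \<le> length (remaining_indices ds i ! c)" using assms by (auto simp: indices_iff omit_def)
  then show ?thesis
    using assms insert_index_update[of i _ "Suc r"] by (simp add: M_matrix_def flattening_def col_def)
qed

lemma M_entry_last:
  assumes "r < ds ! i"
  shows "M_matrix ds i $$ (r, ncol i) = (\<Sum>s | s \<in> S \<and> s ! i = Suc r. Var (Uvar s))"
  using assms by (simp add: M_matrix_def u_marginal_def)

lemma column_exists:
  assumes "i < n" "s \<in> S"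
  obtains c where "c < ncol i" "remaining_indices ds i ! c = omit i s" "\<And>j. (col i c)[i := j] = s[i := j]"
proof -
  obtain c where c: "c < ncol i" "remaining_indices ds i ! c = omit i s"
    using omit_indices[OF assms(2), of i] length_remaining[OF assms(1)] remaining_set[of i]
    by (metis in_set_conv_nth)
  have "(col i c)[i := j] = s[i := j]" for j
    using assms by (simp add: col_def c insert_omit)
  then show ?thesis using that c by blast
qed

text \<open>\<open>minors2\<close> takes columns in increasing order. Translating lexicographic
  comparison into this order fixes the sign of a minor, so that its leading coefficient is
  1.\<close>

lemma column_less:
  assumes "i < n" "c < ncol i" "c' < ncol i" "remaining_indices ds i ! c < remaining_indices ds i ! c'"
  shows "c < c'"
  using sorted_wrt_nth_lessD[of "remaining_indices ds i" c c'] assms length_remaining[OF assms(1)]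
  by (simp add: remaining_indices_def sorted_multi_indices)

definition minors :: "nat list var mpoly set" where
  "minors = (\<Union>i<n. minors2 (M_matrix ds i))"

lemma M_entry_carrier:
  assumes "i < n" "r < ds ! i" "c \<le> ncol i"
  shows "M_matrix ds i $$ (r, c) \<in> carrier (poly_ring V)"
proof (cases "c = ncol i")
  case True
  then show ?thesis unfolding True M_entry_last[OF assms(2)]
    by (auto intro!: carrier_poly_ring_sum carrier_poly_ring_Var simp: pu_vars_def)
next
  case False
  then have "c < ncol i" using assms by simp
  then show ?thesis using assms update_S[OF col_S, of i c "Suc r" i]
    by (auto intro!: carrier_poly_ring_Var simp: M_entry pu_vars_def)
qed

lemma minors2_carrier: "i < n \<Longrightarrow> minors2 (M_matrix ds i) \<subseteq> carrier (poly_ring V)"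
  unfolding minors2_def
  by (auto intro!: carrier_poly_ring_diff carrier_poly_ring_mult M_entry_carrier)

lemma finite_minors: "finite minors"
proof -
  have "finite (minors2 N)" for N :: "nat list var mpoly mat"
  proof (rule finite_subset)
    show "minors2 N \<subseteq> (\<lambda>(r, r', c, c'). N $$ (r, c) * N $$ (r', c') - N $$ (r, c') * N $$ (r', c)) `
      ({..<dim_row N} \<times> {..<dim_row N} \<times> {..<dim_col N} \<times> {..<dim_col N})"
      unfolding minors2_def by (force simp: image_iff)
  qed auto
  then show ?thesis by (simp add: minors_def)
qed

text \<open>After evaluation every column, the last included, is a multiple of the vector
  \<open>a i\<close>, so the matrix has rank at most one. The hypotheses fit both points of the
  parametrization and critical points.\<close>

lemma minors_vanish:
  assumes g: "g \<in> minors"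
    and x: "\<And>s. s \<in> S \<Longrightarrow> x s = rank1 a s"
    and y: "\<And>i. i < n \<Longrightarrow> \<exists>l. \<forall>j\<in>{1..ds ! i}. (\<Sum>s | s \<in> S \<and> s ! i = j. y s) = l * a i j"
  shows "eval (case_var x y) g = 0"
proof -
  obtain i where i: "i < n" and gi: "g \<in> minors2 (M_matrix ds i)"
    using g by (auto simp: minors_def)
  obtain l where l: "\<And>j. j \<in> {1..ds ! i} \<Longrightarrow> (\<Sum>s | s \<in> S \<and> s ! i = j. y s) = l * a i j"
    using y[OF i] by blast
  define \<kappa> where "\<kappa> c = (if c = ncol i then l else (\<Prod>k\<in>{..<n} - {i}. a k (col i c ! k)))" for c
  have entry: "eval (case_var x y) (M_matrix ds i $$ (r, c)) = a i (Suc r) * \<kappa> c"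
    if "r < ds ! i" "c < Suc (ncol i)" for r c
  proof (cases "c = ncol i")
    case True
    then show ?thesis using that l[of "Suc r"] by (simp add: M_entry_last \<kappa>_def)
  next
    case False
    then have "c < ncol i" using that by simp
    then show ?thesis
      using that i x[OF update_S[OF col_S, of i c "Suc r" i]]
      by (simp add: M_entry \<kappa>_def rank1_update col_S)
  qed
  obtain r r' c c' where "g = M_matrix ds i $$ (r, c) * M_matrix ds i $$ (r', c') -
      M_matrix ds i $$ (r, c') * M_matrix ds i $$ (r', c)"
    "r < r'" "r' < ds ! i" "c < c'" "c' < Suc (ncol i)"
    using gi by (auto simp: minors2_def)
  then show ?thesis by (simp add: entry)
qed

lemma minors_vanish_param: "g \<in> minors \<Longrightarrow> eval (param a t u) g = 0"
  unfolding param_def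
proof (rule minors_vanish)
  fix i assume "i < n"
  then show "\<exists>l. \<forall>j\<in>{1..ds ! i}. (\<Sum>s | s \<in> S \<and> s ! i = j. param_u a t u s) = l * a i j"
    by (intro exI[of _ "t * (\<Prod>k\<in>{..<n} - {i}. total a k)"]) (simp add: sum_param_u_fiber marginal_def)
qed auto

subsection \<open>Leading monomials\<close>

lemma set_pu_order: "set (pu_order ds) = V"
  by (simp add: pu_order_def pu_vars_def indices_def)

lemma multi_indices_nth:
  assumes "s \<in> S"
  obtains k where "k < length (multi_indices ds)" "multi_indices ds ! k = s"
    "\<And>l. l < k \<Longrightarrow> multi_indices ds ! l \<in> S \<and> multi_indices ds ! l < s"
proof -
  obtain k where k: "k < length (multi_indices ds)" "multi_indices ds ! k = s"
    using assms by (auto simp: indices_def in_set_conv_nth)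
  moreover have "multi_indices ds ! l \<in> S \<and> multi_indices ds ! l < s" if "l < k" for l
    using that k sorted_wrt_nth_less[OF sorted_multi_indices that k(1)] by (auto simp: indices_def)
  ultimately show ?thesis using that by blast
qed

lemma lex_less_P:
  assumes s: "s \<in> S" "lookup m (Pvar s) < lookup m' (Pvar s)"
    and eq: "\<And>t. t \<in> S \<Longrightarrow> t < s \<Longrightarrow> lookup m (Pvar t) = lookup m' (Pvar t)"
  shows "lex_less (pu_order ds) m m'"
proof -
  obtain k where "k < length (multi_indices ds)" "multi_indices ds ! k = s"
    "\<And>l. l < k \<Longrightarrow> multi_indices ds ! l \<in> S \<and> multi_indices ds ! l < s"
    using multi_indices_nth[OF s(1)] by blast
  then show ?thesis
    unfolding lex_less_def pu_order_def using s eq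
    by (intro exI[of _ k]) (auto simp: nth_append)
qed

lemma lex_less_U:
  assumes s: "s \<in> S" "lookup m (Uvar s) < lookup m' (Uvar s)"
    and eq: "\<And>t. t \<in> S \<Longrightarrow> t < s \<Longrightarrow> lookup m (Uvar t) = lookup m' (Uvar t)"
    and eqP: "\<And>t. t \<in> S \<Longrightarrow> lookup m (Pvar t) = lookup m' (Pvar t)"
  shows "lex_less (pu_order ds) m m'"
proof -
  obtain k where k: "k < length (multi_indices ds)" "multi_indices ds ! k = s"
    "\<And>l. l < k \<Longrightarrow> multi_indices ds ! l \<in> S \<and> multi_indices ds ! l < s"
    using multi_indices_nth[OF s(1)] by blast
  let ?N = "length (multi_indices ds)"
  have "lookup m (pu_order ds ! l) = lookup m' (pu_order ds ! l)" if "l < ?N + k" for l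
  proof (cases "l < ?N")
    case True
    then show ?thesis using eqP[of "multi_indices ds ! l"]
      by (simp add: pu_order_def nth_append indices_def)
  next
    case False
    then have "l - ?N < k" "l - ?N < ?N" using that k by auto
    then show ?thesis using eq[of "multi_indices ds ! (l - ?N)"] k(3)[of "l - ?N"] False
      by (simp add: pu_order_def nth_append)
  qed
  then show ?thesis
    unfolding lex_less_def using k s
    by (intro exI[of _ "?N + k"]) (auto simp: pu_order_def nth_append)
qed

lemma minor_in_minors:
  assumes "i < n" "r < r'" "r' < ds ! i" "c < c'" "c' \<le> ncol i"
  shows "M_matrix ds i $$ (r, c) * M_matrix ds i $$ (r', c') -
      M_matrix ds i $$ (r, c') * M_matrix ds i $$ (r', c) \<in> minors"
proof -
  have "M_matrix ds i $$ (r, c) * M_matrix ds i $$ (r', c') -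
      M_matrix ds i $$ (r, c') * M_matrix ds i $$ (r', c) \<in> minors2 (M_matrix ds i)"
    unfolding minors2_def using assms by (intro CollectI exI[of _ r] exI[of _ r'] exI[of _ c] exI[of _ c']) auto
  then show ?thesis using assms(1) by (auto simp: minors_def)
qed

text \<open>Rows and columns are chosen so that the diagonal carries \<open>Pvar s\<close> and
  \<open>Pvar t\<close>. Of the four indices involved \<open>s\<close> is the least: exchanging the
  entries at \<open>l\<close> raises \<open>s\<close>, while \<open>t\<close> exceeds
  \<open>s\<close> at \<open>k\<close> before and after the exchange.\<close>

lemma minor_PP:
  assumes s: "s \<in> S" and t: "t \<in> S" and k: "k < l" "l < n"
    and pre: "take k s = take k t" "s ! k < t ! k" and l: "s ! l < t ! l"
  shows "\<exists>r. single (single (Pvar s) 1 + single (Pvar t) 1) 1 + r \<in> minors \<and>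
    (\<forall>m\<in>keys r. lex_less (pu_order ds) m (single (Pvar s) 1 + single (Pvar t) 1))"
proof -
  let ?m = "single (Pvar s) (1::nat) + single (Pvar t) 1"
  let ?s' = "s[l := t ! l]" and ?t' = "t[l := s ! l]"
  let ?m' = "single (Pvar ?s') (1::nat) + single (Pvar ?t') 1"
  have len: "length s = n" "length t = n" using s t length_S by auto
  obtain c where c: "c < ncol l" "remaining_indices ds l ! c = omit l s" "\<And>j. (col l c)[l := j] = s[l := j]"
    using column_exists[OF k(2) s] by blast
  obtain c' where c': "c' < ncol l" "remaining_indices ds l ! c' = omit l t" "\<And>j. (col l c')[l := j] = t[l := j]"
    using column_exists[OF k(2) t] by blast
  have "omit l s < omit l t"
    by (rule list_lessI[of _ _ k]) (use k len pre in \<open>auto simp: omit_def nth_append min_def\<close>)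
  then have cc': "c < c'" using column_less[OF k(2) c(1) c'(1)] c c' by simp
  have rows: "1 \<le> s ! l" "t ! l \<le> ds ! l" "1 \<le> t ! l" "s ! l \<le> ds ! l"
    using nth_S[OF s k(2)] nth_S[OF t k(2)] by auto
  let ?M = "M_matrix ds l" and ?r = "s ! l - 1" and ?r' = "t ! l - 1"
  have "?M $$ (?r, c) * ?M $$ (?r', c') - ?M $$ (?r, c') * ?M $$ (?r', c) \<in> minors"
    by (rule minor_in_minors) (use k rows l cc' c' in auto)
  moreover have "?M $$ (?r, c) = Var (Pvar s)" "?M $$ (?r', c') = Var (Pvar t)"
    "?M $$ (?r, c') = Var (Pvar ?t')" "?M $$ (?r', c) = Var (Pvar ?s')"
    using k rows l c c' by (auto simp: M_entry)
  ultimately have "Var (Pvar s) * Var (Pvar t) - Var (Pvar ?t') * Var (Pvar ?s') \<in> minors" by simp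
  then have g: "single ?m 1 + (- single ?m' 1) \<in> minors"
    unfolding Var_mult_Var by (simp add: add.commute)
  have "s < ?s'" by (rule list_lessI[of _ _ l]) (use len k l in auto)
  moreover have "s < ?t'" by (rule list_lessI[of _ _ k]) (use len k pre in auto)
  moreover have "s < t" by (rule list_lessI[of _ _ k]) (use len k pre in auto)
  ultimately have "lex_less (pu_order ds) ?m' ?m"
    by (intro lex_less_P[of s]) (use s in \<open>auto simp: lookup_add lookup_single_var\<close>)
  then show ?thesis using g by (intro exI[of _ "- single ?m' 1"]) (auto simp: in_keys_iff lookup_single when_def split: if_splits)
qed

text \<open>The minor uses the column of \<open>s\<close> and the last column. Replacing
  \<open>s ! i\<close> by \<open>j\<close> increases \<open>s\<close>, so the terms with
  \<open>Pvar s\<close> win; among them the least index of the slice, \<open>axis i j\<close>, gives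
  the largest u variable.\<close>

lemma minor_PU:
  assumes s: "s \<in> S" and i: "i < n" and j: "s ! i < j" "j \<le> ds ! i"
  shows "\<exists>r. single (single (Pvar s) 1 + single (Uvar (axis i j)) 1) 1 + r \<in> minors \<and>
    (\<forall>m\<in>keys r. lex_less (pu_order ds) m (single (Pvar s) 1 + single (Uvar (axis i j)) 1))"
proof -
  let ?e = "axis i j"
  let ?m = "single (Pvar s) (1::nat) + single (Uvar ?e) 1"
  let ?s' = "s[i := j]"
  have len: "length s = n" using s length_S by auto
  obtain c where c: "c < ncol i" "remaining_indices ds i ! c = omit i s" "\<And>j. (col i c)[i := j] = s[i := j]"
    using column_exists[OF i s] by blast
  have rows: "1 \<le> s ! i" "s ! i \<le> ds ! i"
    using nth_S[OF s i] by auto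
  let ?M = "M_matrix ds i" and ?r = "s ! i - 1" and ?r' = "j - 1"
  let ?F = "\<lambda>j. {t. t \<in> S \<and> t ! i = j}"
  have "?M $$ (?r, c) * ?M $$ (?r', ncol i) - ?M $$ (?r, ncol i) * ?M $$ (?r', c) \<in> minors"
    by (rule minor_in_minors) (use i rows j c in auto)
  moreover have "?M $$ (?r, c) = Var (Pvar s)" "?M $$ (?r', c) = Var (Pvar ?s')"
    using i rows j c by (auto simp: M_entry)
  moreover have "?M $$ (?r, ncol i) = (\<Sum>t\<in>?F (s ! i). Var (Uvar t))"
    "?M $$ (?r', ncol i) = (\<Sum>t\<in>?F j. Var (Uvar t))"
    using rows j by (auto simp: M_entry_last)
  ultimately have g: "Var (Pvar s) * (\<Sum>t\<in>?F j. Var (Uvar t)) - (\<Sum>t\<in>?F (s ! i). Var (Uvar t)) * Var (Pvar ?s') \<in> minors"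
    by simp
  have e: "?e \<in> ?F j" using axis_S[of j i] axis_nth[of i i j] i j by auto
  \<comment> \<open>\<open>A\<close> is the rest of the diagonal product, \<open>B\<close> the
    off-diagonal one.\<close>
  define A where "A = (\<Sum>t\<in>?F j - {?e}. Var (Pvar s) * Var (Uvar t))"
  define B where "B = (\<Sum>t\<in>?F (s ! i). Var (Pvar ?s') * Var (Uvar t))"
  have "Var (Pvar s) * (\<Sum>t\<in>?F j. Var (Uvar t)) - (\<Sum>t\<in>?F (s ! i). Var (Uvar t)) * Var (Pvar ?s') =
      single ?m 1 + (A - B)"
    using e by (simp add: A_def B_def sum.remove[of "?F j" ?e] Var_mult_Var[symmetric, simplified] distrib_left
        sum_distrib_left mult.commute)
  then have "single ?m 1 + (A - B) \<in> minors" using g by simp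
  moreover have "lex_less (pu_order ds) m ?m" if "m \<in> keys (A - B)" for m
  proof -
    have "m \<in> keys A \<or> m \<in> keys B" using that keys_diff_subset[of A B] by blast
    then show ?thesis
    proof
      assume "m \<in> keys A"
      then obtain t where "t \<in> ?F j - {?e}" "m \<in> keys (Var (Pvar s) * Var (Uvar t))"
        using keys_sum_subset[of "\<lambda>t. Var (Pvar s) * Var (Uvar t)" "?F j - {?e}"] unfolding A_def by blast
      then have t: "t \<in> S" "t ! i = j" "t \<noteq> ?e" and m: "m = single (Pvar s) 1 + single (Uvar t) 1"
        by (auto simp: Var_mult_Var)
      have "?e < t"
      proof (rule list_lessI_least)
        show "length ?e = length t" using t(1) length_S by (simp add: axis_def ones_def)
        fix k assume "k < length ?e"
        then have "k < n" by (simp add: axis_def ones_def)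
        then show "?e ! k \<le> t ! k" using t nth_S[of t k] by (auto simp: axis_nth)
      qed (use t in auto)
      then have "lex_less (pu_order ds) (single (Uvar t) 1) (single (Uvar ?e) 1)"
        by (intro lex_less_U[of ?e]) (use e t in \<open>auto simp: lookup_single_var\<close>)
      then show ?thesis unfolding m by (rule lex_less_add)
    next
      assume "m \<in> keys B"
      then obtain t where "m \<in> keys (Var (Pvar ?s') * Var (Uvar t))"
        using keys_sum_subset[of "\<lambda>t. Var (Pvar ?s') * Var (Uvar t)" "?F (s ! i)"] unfolding B_def by blast
      then have m: "m = single (Pvar ?s') 1 + single (Uvar t) 1"
        by (auto simp: Var_mult_Var)
      have "s < ?s'" by (rule list_lessI[of _ _ i]) (use len i j in auto)
      then show ?thesis unfolding m
        by (intro lex_less_P[of s]) (use s in \<open>auto simp: lookup_add lookup_single_var\<close>)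
    qed
  qed
  ultimately show ?thesis by blast
qed

end

section \<open>Independence of the standard monomials\<close>

text \<open>Names for the coordinates of parameter space, that is \<open>t\<close>,
  \<open>a k j\<close> and \<open>u s\<close> in \<open>param\<close>, so that exponents and weights
  can be indexed by them.\<close>

datatype parameter = Scale | Factor nat nat | Free "nat list"

context format
begin

text \<open>Excluded are the multiples of the leading monomials in \<open>minor_PP\<close> and
  \<open>minor_PU\<close>. Products of u variables are unrestricted, as every term of a minor
  contains a p variable.\<close>

definition standard :: "nat list var mono \<Rightarrow> bool" where
  "standard m \<longleftrightarrow>
    (\<forall>s t k l. Pvar s \<in> keys m \<longrightarrow> Pvar t \<in> keys m \<longrightarrow> k < l \<longrightarrow> l < n \<longrightarrow> take k s = take k t \<longrightarrow>
      s ! k < t ! k \<longrightarrow> t ! l \<le> s ! l) \<and>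
    (\<forall>s i j. Pvar s \<in> keys m \<longrightarrow> i < n \<longrightarrow> 2 \<le> j \<longrightarrow> j \<le> ds ! i \<longrightarrow> Uvar (axis i j) \<in> keys m \<longrightarrow> j \<le> s ! i)"

lemma nonstandard_reducible:
  assumes m: "keys m \<subseteq> V" "\<not> standard m"
  shows "\<exists>L q r. m = q + L \<and> single L 1 + r \<in> minors \<and> (\<forall>k\<in>keys r. lex_less (pu_order ds) k L)"
proof -
  have V: "s \<in> S" if "Pvar s \<in> keys m" for s
    using m(1) that by (auto simp: pu_vars_def)
  consider (PP) s t k l where "Pvar s \<in> keys m" "Pvar t \<in> keys m" "k < l" "l < n" "take k s = take k t"
      "s ! k < t ! k" "s ! l < t ! l"
    | (PU) s i j where "Pvar s \<in> keys m" "i < n" "2 \<le> j" "j \<le> ds ! i" "Uvar (axis i j) \<in> keys m" "s ! i < j"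
    using m(2) unfolding standard_def not_le[symmetric] by metis
  then show ?thesis
  proof cases
    case PP
    then show ?thesis
      using minor_PP[OF V[OF PP(1)] V[OF PP(2)] PP(3-7)] mono_diff_add[OF PP(1,2)] by blast
  next
    case PU
    then show ?thesis
      using minor_PU[OF V[OF PU(1)] PU(2,6,4)] mono_diff_add[OF PU(1,5)] by blast
  qed
qed

section \<open>Exponents of the parameters in the image of a monomial\<close>

definition parameters :: "parameter set" where
  "parameters = insert Scale ((\<lambda>(k, j). Factor k j) ` (SIGMA k:{..<n}. {1..ds ! k}) \<union> Free ` (S - Axis))"

lemma finite_parameters [simp]: "finite parameters"
  by (simp add: parameters_def)

lemma parameters_iff [simp]:
  "Scale \<in> parameters" "Factor k j \<in> parameters \<longleftrightarrow> k < n \<and> j \<in> {1..ds ! k}"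
  "Free s \<in> parameters \<longleftrightarrow> s \<in> S - Axis"
  by (auto simp: parameters_def)

lemma sum_parameters:
  "(\<Sum>x\<in>parameters. f x) = f Scale + (\<Sum>k<n. \<Sum>j=1..ds ! k. f (Factor k j)) + (\<Sum>s\<in>S - Axis. f (Free s))"
proof -
  let ?A = "(\<lambda>(k, j). Factor k j) ` (SIGMA k:{..<n}. {1..ds ! k})"
  have "(\<Sum>x\<in>parameters. f x) = f Scale + ((\<Sum>x\<in>?A. f x) + (\<Sum>x\<in>Free ` (S - Axis). f x))"
    unfolding parameters_def
    by (subst sum.insert, simp, force, subst sum.union_disjoint) auto
  also have "(\<Sum>x\<in>?A. f x) = (\<Sum>k<n. \<Sum>j=1..ds ! k. f (Factor k j))"
    by (subst sum.reindex) (auto simp: inj_on_def sum.Sigma split_def)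
  also have "(\<Sum>x\<in>Free ` (S - Axis). f x) = (\<Sum>s\<in>S - Axis. f (Free s))"
    by (subst sum.reindex) (auto simp: inj_on_def)
  finally show ?thesis by (simp add: add.assoc)
qed

lemma sum_V: "(\<Sum>v\<in>V. f v) = (\<Sum>s\<in>S. f (Pvar s)) + (\<Sum>s\<in>S. f (Uvar s))"
  unfolding pu_vars_def by (subst sum.union_disjoint) (auto simp: sum.reindex inj_on_def)

text \<open>The exponent of a parameter in the leading monomial of the image of a variable.\<close>

fun incidence :: "nat list var \<Rightarrow> parameter \<Rightarrow> nat" where
  "incidence (Pvar s) Scale = 0"
| "incidence (Pvar s) (Factor k j) = of_bool (s ! k = j)"
| "incidence (Pvar s) (Free r) = 0"
| "incidence (Uvar s) Scale = of_bool (s \<in> Axis)"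
| "incidence (Uvar s) (Factor k j) = of_bool (s \<in> Axis \<and> s ! k = j)"
| "incidence (Uvar s) (Free r) = of_bool (s \<notin> Axis \<and> r = s)"

definition exponent :: "nat list var mono \<Rightarrow> parameter \<Rightarrow> nat" where
  "exponent m x = (\<Sum>v\<in>V. lookup m v * incidence v x)"

text \<open>The exponent of \<open>Factor k j\<close> shows only the sum of \<open>p_count\<close>
  and \<open>u_count\<close>; \<open>separated_sum_unique\<close> recovers the summands.\<close>

definition p_count :: "nat list var mono \<Rightarrow> nat \<Rightarrow> nat \<Rightarrow> nat" where
  "p_count m k j = (\<Sum>s\<in>S. lookup m (Pvar s) * of_bool (s ! k = j))"

definition u_count :: "nat list var mono \<Rightarrow> nat \<Rightarrow> nat \<Rightarrow> nat" where
  "u_count m k j = (\<Sum>s\<in>Axis. lookup m (Uvar s) * of_bool (s ! k = j))"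

lemma finite_Axis [simp]: "finite Axis"
  using Axis_S finite_S by (rule finite_subset)

lemma exponent_Scale: "exponent m Scale = (\<Sum>s\<in>Axis. lookup m (Uvar s))"
proof -
  have "(\<Sum>s\<in>S. lookup m (Uvar s) * of_bool (s \<in> Axis)) = (\<Sum>s\<in>Axis. lookup m (Uvar s))"
    by (rule sum.mono_neutral_cong_right) (use Axis_S in auto)
  then show ?thesis by (simp add: exponent_def sum_V)
qed

lemma exponent_Factor: "exponent m (Factor k j) = p_count m k j + u_count m k j"
proof -
  have "(\<Sum>s\<in>S. lookup m (Uvar s) * of_bool (s \<in> Axis \<and> s ! k = j)) = u_count m k j"
    unfolding u_count_def by (rule sum.mono_neutral_cong_right) (use Axis_S in auto)
  then show ?thesis by (simp add: exponent_def sum_V p_count_def)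
qed

lemma exponent_Free: "s \<in> S - Axis \<Longrightarrow> exponent m (Free s) = lookup m (Uvar s)"
proof -
  assume s: "s \<in> S - Axis"
  have "(\<Sum>r\<in>S. lookup m (Uvar r) * of_bool (r \<notin> Axis \<and> s = r)) = (\<Sum>r\<in>S. if r = s then lookup m (Uvar s) else 0)"
    by (rule sum.cong) (use s in auto)
  then show ?thesis using s by (simp add: exponent_def sum_V)
qed

text \<open>Each axis index has exactly one value in direction \<open>k\<close>. The exponent of
  \<open>Scale\<close> thus supplies the total that \<open>separated_sum_unique\<close>
  requires.\<close>

lemma sum_u_count:
  assumes "k < n"
  shows "(\<Sum>j=1..ds ! k. u_count m k j) = exponent m Scale"
proof -
  have "(\<Sum>j=1..ds ! k. u_count m k j) = (\<Sum>s\<in>Axis. \<Sum>j=1..ds ! k. lookup m (Uvar s) * of_bool (s ! k = j))"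
    unfolding u_count_def by (rule sum.swap)
  also have "\<dots> = (\<Sum>s\<in>Axis. lookup m (Uvar s))"
  proof (rule sum.cong)
    fix s assume "s \<in> Axis"
    then have "s ! k \<in> {1..ds ! k}" using Axis_S nth_S assms by blast
    then show "(\<Sum>j=1..ds ! k. lookup m (Uvar s) * of_bool (s ! k = j)) = lookup m (Uvar s)"
      by (simp add: of_bool_def if_distrib sum.delta cong: if_cong)
  qed simp
  finally show ?thesis by (simp add: exponent_Scale)
qed

lemma u_count_axis:
  assumes "k < n" "2 \<le> j" "j \<le> ds ! k"
  shows "u_count m k j = lookup m (Uvar (axis k j))"
proof -
  have ax: "axis k j \<in> Axis" unfolding Axis_def using assms by force
  have "u_count m k j = (\<Sum>s\<in>Axis. if s = axis k j then lookup m (Uvar s) else 0)"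
    unfolding u_count_def
  proof (rule sum.cong)
    fix s assume s: "s \<in> Axis"
    have "s ! k = j \<longleftrightarrow> s = axis k j"
      using Axis_eq_axis[OF s assms(1) _ assms(2)] axis_nth[of k k j] assms(1) by auto
    then show "lookup m (Uvar s) * of_bool (s ! k = j) = (if s = axis k j then lookup m (Uvar s) else 0)"
      by simp
  qed simp
  then show ?thesis using ax by simp
qed

definition p_multiset :: "nat list var mono \<Rightarrow> nat list multiset" where
  "p_multiset m = (\<Sum>s\<in>S. replicate_mset (lookup m (Pvar s)) s)"

lemma count_p_multiset: "count (p_multiset m) s = (if s \<in> S then lookup m (Pvar s) else 0)"
  by (auto simp: p_multiset_def count_sum)

lemma p_multiset_iff: "s \<in># p_multiset m \<longleftrightarrow> s \<in> S \<and> Pvar s \<in> keys m"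
  by (auto simp: count_greater_zero_iff[symmetric] count_p_multiset in_keys_iff simp del: count_greater_zero_iff)

lemma count_marginal:
  "count (image_mset (\<lambda>s. s ! k) (p_multiset m)) j = p_count m k j"
proof -
  have image_mset_sum: "image_mset f (sum g T) = (\<Sum>s\<in>T. image_mset f (g s))" for f :: "nat list \<Rightarrow> nat" and g and T :: "nat list set"
    by (induction T rule: infinite_finite_induct) auto
  have "image_mset (\<lambda>s. s ! k) (p_multiset m) = (\<Sum>s\<in>S. replicate_mset (lookup m (Pvar s)) (s ! k))"
    unfolding p_multiset_def
    by (simp add: image_mset_sum)
  then show ?thesis
    unfolding p_count_def count_sum by (simp only: count_sum) (rule sum.cong, auto)
qed

lemma p_count_outside: "k < n \<Longrightarrow> j \<notin> {1..ds ! k} \<Longrightarrow> p_count m k j = 0"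
  unfolding p_count_def by (rule sum.neutral) (use nth_S in force)

lemma p_count_pos:
  assumes "p_count m k j > 0"
  obtains s where "s \<in> S" "Pvar s \<in> keys m" "s ! k = j"
proof -
  have "\<exists>s\<in>S. lookup m (Pvar s) * of_bool (s ! k = j) \<noteq> 0"
    using assms unfolding p_count_def by (metis (mono_tags, lifting) less_irrefl sum.neutral)
  then show ?thesis using that by (auto simp: in_keys_iff)
qed

text \<open>In each direction the values contributed by the axis variables are the smallest ones, which
  separates them from the contributions of the \<open>p\<close> variables.\<close>

lemma standard_exponent_inj:
  assumes m: "keys m \<subseteq> V" "standard m" and m': "keys m' \<subseteq> V" "standard m'"
    and eq: "\<And>x. x \<in> parameters \<Longrightarrow> exponent m x = exponent m' x"
  shows "m = m'"
proof -
  have sep: "j \<le> j'" if *: "standard m" "k < n" "j \<in> {1..ds ! k}" "u_count m k j > 0" "p_count m k j' > 0"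
    for m k j j'
  proof -
    obtain s where s: "s \<in> S" "Pvar s \<in> keys m" "s ! k = j'" using *(5) by (rule p_count_pos)
    show ?thesis
    proof (cases "j = 1")
      case True
      then show ?thesis using s nth_S[OF s(1) *(2)] by auto
    next
      case False
      then have "2 \<le> j" "j \<le> ds ! k" using * by auto
      moreover from this have "Uvar (axis k j) \<in> keys m"
        using * u_count_axis[of k j m] by (simp add: in_keys_iff)
      ultimately show ?thesis using *(1,2) s unfolding standard_def by blast
    qed
  qed
  have u: "u_count m k j = u_count m' k j" if k: "k < n" and j: "j \<in> {1..ds ! k}" for k j
  proof (rule separated_sum_unique[where d = "ds ! k" and a = "u_count m k" and a' = "u_count m' k" and j = j and b = "p_count m k" and b' = "p_count m' k"])
    show "u_count m k j + p_count m k j = u_count m' k j + p_count m' k j" if "j \<in> {1..ds ! k}" for j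
      using eq[of "Factor k j"] that k by (simp add: exponent_Factor add.commute)
    show "(\<Sum>j=1..ds ! k. u_count m k j) = (\<Sum>j=1..ds ! k. u_count m' k j)"
      unfolding sum_u_count[OF k] using eq[of Scale] by simp
  qed (use sep m(2) m'(2) k j in blast)+
  have p: "p_count m k j = p_count m' k j" if k: "k < n" for k j
    using eq[of "Factor k j"] u[OF k, of j] k p_count_outside[OF k]
    by (cases "j \<in> {1..ds ! k}") (simp_all add: exponent_Factor)
  have U: "lookup m (Uvar s) = lookup m' (Uvar s)" if s: "s \<in> S" "s \<noteq> ones" for s
  proof (cases "s \<in> Axis")
    case True
    then show ?thesis
    proof (cases rule: Axis_cases)
      case (2 i j)
      then show ?thesis using u[of i j] by (simp add: u_count_axis)
    qed (use s in simp)
  next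
    case False
    then show ?thesis using s eq[of "Free s"] by (simp add: exponent_Free)
  qed
  \<comment> \<open>Several axis indices may share the value 1 in a direction, so the exponent at
    \<open>ones\<close> is read off from the total instead.\<close>
  have "(\<Sum>s\<in>Axis. lookup m (Uvar s)) = (\<Sum>s\<in>Axis. lookup m' (Uvar s))"
    using eq[of Scale] by (simp add: exponent_Scale)
  moreover have "(\<Sum>s\<in>Axis - {ones}. lookup m (Uvar s)) = (\<Sum>s\<in>Axis - {ones}. lookup m' (Uvar s))"
    by (rule sum.cong) (use U Axis_S in auto)
  ultimately have "lookup m (Uvar ones) = lookup m' (Uvar ones)"
    using ones_Axis by (simp add: sum.remove[of Axis ones])
  with U have U': "lookup m (Uvar s) = lookup m' (Uvar s)" if "s \<in> S" for s
    using that by (cases "s = ones") auto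
  have marg: "image_mset (\<lambda>s. s ! k) (p_multiset m) = image_mset (\<lambda>s. s ! k) (p_multiset m')" if "k < n" for k
    by (rule multiset_eqI) (simp add: count_marginal p that)
  have "p_multiset m = p_multiset m'"
  proof (rule standard_lists_unique[of _ n])
    show "size (p_multiset m) = size (p_multiset m')"
      using arg_cong[OF marg[OF n_pos], of size] by simp
  qed (use m(2) m'(2) marg in \<open>auto simp: p_multiset_iff length_S standard_def\<close>)
  then have P: "lookup m (Pvar s) = lookup m' (Pvar s)" if "s \<in> S" for s
    using that count_p_multiset[of m s] count_p_multiset[of m' s] by simp
  show ?thesis
  proof (rule poly_mapping_eqI)
    fix v
    show "lookup m v = lookup m' v"
    proof (cases "v \<in> V")
      case True
      then show ?thesis using P U' by (auto simp: pu_vars_def)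
    next
      case False
      then have "v \<notin> keys m" "v \<notin> keys m'" using m(1) m'(1) by auto
      then show ?thesis by (simp add: in_keys_iff)
    qed
  qed
qed

text \<open>\<open>param\<close> is built from sums, differences and products only, so it commutes
  with specialising the curve parameter.\<close>

lemma poly_param:
  "poly (param a t u v) z = param (\<lambda>k j. poly (a k j) z) (poly t z) (\<lambda>s. poly (u s) z) v"
proof (cases v)
  case (Pvar s)
  then show ?thesis by (simp add: rank1_def poly_prod)
next
  case (Uvar s)
  have tot: "poly (total a k) z = total (\<lambda>k j. poly (a k j) z) k" for k
    by (simp add: total_def poly_sum)
  have "poly (param_u' a t u r) z = param_u' (\<lambda>k j. poly (a k j) z) (poly t z) (\<lambda>s. poly (u s) z) r" for r
    by (simp add: param_u'_def marginal_def poly_sum poly_prod tot)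
  then show ?thesis using Uvar by (simp add: param_u_def poly_sum poly_prod tot)
qed

definition param_ideal :: "nat list var mpoly set" where
  "param_ideal = {f \<in> carrier (poly_ring V). \<forall>x\<in>{param a t u | a t u. True}. eval x f = 0}"

lemma param_ideal_iff: "f \<in> param_ideal \<longleftrightarrow> f \<in> carrier (poly_ring V) \<and> (\<forall>a t u. eval (param a t u) f = 0)"
  by (auto simp: param_ideal_def)

lemma ideal_param_ideal: "ideal param_ideal (poly_ring V)"
  unfolding param_ideal_def by (rule ideal_vanishing)

section \<open>Degrees along a monomial curve in parameter space\<close>

context
  fixes w :: "parameter \<Rightarrow> nat"
  assumes w_pos: "\<And>x. x \<in> parameters \<Longrightarrow> 1 \<le> w x"
    and w_Free: "\<And>s. s \<in> S - Axis \<Longrightarrow> w (Free s) < w Scale"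
    and w_Factor: "\<And>k j. k < n \<Longrightarrow> 2 \<le> j \<Longrightarrow> j \<le> ds ! k \<Longrightarrow> w (Factor k j) < w (Factor k 1)"
begin

text \<open>Each parameter becomes a power of one variable. By \<open>w_Factor\<close> the value 1
  dominates in every \<open>total\<close>, and by \<open>w_Free\<close> a free coordinate lies below
  anything containing \<open>t\<close>.\<close>

definition "wa k j = monom (1 :: complex) (w (Factor k j))"
definition "wt = monom (1 :: complex) (w Scale)"
definition "wu s = monom (1 :: complex) (w (Free s))"

definition weight :: "nat list var \<Rightarrow> nat" where
  "weight v = (\<Sum>x\<in>parameters. w x * incidence v x)"

lemma sum_of_bool_nth:
  assumes "s \<in> S"
  shows "(\<Sum>k<n. \<Sum>j=1..ds ! k. w (Factor k j) * of_bool (s ! k = j)) = (\<Sum>k<n. w (Factor k (s ! k)))"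
proof (rule sum.cong)
  fix k assume "k \<in> {..<n}"
  then have "s ! k \<in> {1..ds ! k}" using nth_S assms by blast
  then show "(\<Sum>j=1..ds ! k. w (Factor k j) * of_bool (s ! k = j)) = w (Factor k (s ! k))"
    by (simp add: of_bool_def if_distrib sum.delta cong: if_cong)
qed simp

lemma weight_P: "s \<in> S \<Longrightarrow> weight (Pvar s) = (\<Sum>k<n. w (Factor k (s ! k)))"
  by (simp add: weight_def sum_parameters sum_of_bool_nth[unfolded One_nat_def] del: sum_mult_of_bool_eq)

lemma weight_Axis: "s \<in> Axis \<Longrightarrow> weight (Uvar s) = w Scale + (\<Sum>k<n. w (Factor k (s ! k)))"
  using Axis_S by (simp add: weight_def sum_parameters sum_of_bool_nth[unfolded One_nat_def] subset_iff del: sum_mult_of_bool_eq)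

lemma weight_free: "s \<in> S - Axis \<Longrightarrow> weight (Uvar s) = w (Free s)"
proof -
  assume s: "s \<in> S - Axis"
  have "(\<Sum>r\<in>S - Axis. w (Free r) * of_bool (r = s)) = (\<Sum>r\<in>S - Axis. if r = s then w (Free s) else 0)"
    by (rule sum.cong) auto
  then show ?thesis using s by (simp add: weight_def sum_parameters)
qed

lemma weight_axis:
  assumes "i < n" "j \<in> {1..ds ! i}"
  shows "weight (Uvar (axis i j)) = w Scale + (w (Factor i j) + (\<Sum>k\<in>{..<n} - {i}. w (Factor k 1)))"
proof -
  have "(\<Sum>k<n. w (Factor k (axis i j ! k))) = w (Factor i j) + (\<Sum>k\<in>{..<n} - {i}. w (Factor k (axis i j ! k)))"
    using assms by (simp add: sum.remove[of "{..<n}" i] axis_nth)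
  also have "(\<Sum>k\<in>{..<n} - {i}. w (Factor k (axis i j ! k))) = (\<Sum>k\<in>{..<n} - {i}. w (Factor k 1))"
    by (rule sum.cong) (auto simp: axis_nth)
  moreover have "axis i j \<in> Axis" unfolding Axis_def using assms by blast
  ultimately show ?thesis by (simp add: weight_Axis)
qed

lemma weight_ones: "weight (Uvar ones) = w Scale + (\<Sum>k<n. w (Factor k 1))"
  by (simp add: weight_Axis ones_Axis) (simp add: ones_def)

lemma w_Scale_pos: "0 < w Scale"
  using w_pos[of Scale] by simp

lemma monic_total:
  assumes "k < n"
  shows "monic_deg (w (Factor k 1)) (total wa k)"
proof -
  have "{1..ds ! k} = insert 1 {2..ds ! k}" using positive assms by auto
  then have "total wa k = wa k 1 + (\<Sum>j=2..ds ! k. wa k j)" by (simp add: total_def)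
  moreover have "degree (\<Sum>j=2..ds ! k. wa k j) < w (Factor k 1)"
    using w_Factor assms w_pos[of "Factor k 1"] positive
    by (intro degree_sum_less) (auto simp: wa_def degree_monom_eq)
  ultimately show ?thesis by (simp add: monic_deg_add wa_def monic_deg_monom)
qed

text \<open>All subtracted terms have smaller degree. On an axis they are free coordinates, below
  \<open>w Scale\<close>; at \<open>ones\<close> an axis coordinate contributes
  \<open>Factor i j\<close> with \<open>j \<ge> 2\<close> where the leading product has
  \<open>Factor i 1\<close>.\<close>

lemma monic_param:
  assumes "v \<in> V"
  shows "monic_deg (weight v) (param wa wt wu v)"
proof -
  have free: "monic_deg (weight (Uvar s)) (param_u wa wt wu s)" if "s \<in> S - Axis" for s
    using that by (simp add: weight_free param_u_free wu_def monic_deg_monom)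
  have axis: "monic_deg (weight (Uvar (axis i j))) (param_u wa wt wu (axis i j))"
    if ij: "i < n" "2 \<le> j" "j \<le> ds ! i" for i j
  proof -
    have w: "weight (Uvar (axis i j)) = w Scale + (w (Factor i j) + (\<Sum>k\<in>{..<n} - {i}. w (Factor k 1)))"
      using ij by (intro weight_axis) auto
    have "monic_deg (weight (Uvar (axis i j))) (marginal wa wt i j)"
      unfolding w marginal_def
      by (intro monic_deg_mult monic_deg_prod monic_total)
        (auto simp: wa_def wt_def monic_deg_monom)
    moreover have "degree (\<Sum>r | r \<in> S \<and> r ! i = j \<and> r \<noteq> axis i j. wu r) < weight (Uvar (axis i j))"
    proof (rule degree_sum_less)
      show "0 < weight (Uvar (axis i j))" using w w_Scale_pos by simp
      fix r assume r: "r \<in> {r. r \<in> S \<and> r ! i = j \<and> r \<noteq> axis i j}"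
      then have "r \<in> S - Axis" using Axis_eq_axis ij by blast
      then show "degree (wu r) < weight (Uvar (axis i j))"
        using w w_Free[of r] by (simp add: wu_def degree_monom_eq)
    qed
    ultimately show ?thesis using ij by (simp add: param_u_axis monic_deg_diff)
  qed
  have ones: "monic_deg (weight (Uvar ones)) (param_u wa wt wu ones)"
    unfolding param_u_ones
  proof (rule monic_deg_diff)
    show "monic_deg (weight (Uvar ones)) (wt * (\<Prod>k<n. total wa k))"
      unfolding weight_ones
      by (intro monic_deg_mult monic_deg_prod monic_total) (auto simp: wt_def monic_deg_monom)
    show "degree (\<Sum>r\<in>S - {ones}. param_u wa wt wu r) < weight (Uvar ones)"
    proof (rule degree_sum_less)
      show "0 < weight (Uvar ones)" using weight_ones w_Scale_pos by simp
      fix r assume r: "r \<in> S - {ones}"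
      show "degree (param_u wa wt wu r) < weight (Uvar ones)"
      proof (cases "r \<in> Axis")
        case False
        then have "r \<in> S - Axis" using r by auto
        then show ?thesis
          using free[of r] w_Free[of r] by (simp add: monic_deg_def weight_free weight_ones)
      next
        case True
        then obtain i j where ij: "i < n" "2 \<le> j" "j \<le> ds ! i" "r = axis i j"
          using r by (cases rule: Axis_cases) auto
        have "weight (Uvar r) = w Scale + (w (Factor i j) + (\<Sum>k\<in>{..<n} - {i}. w (Factor k 1)))"
          using ij unfolding ij(4) by (intro weight_axis) auto
        also have "\<dots> < w Scale + (w (Factor i 1) + (\<Sum>k\<in>{..<n} - {i}. w (Factor k 1)))"
          using w_Factor[OF ij(1-3)] by simp
        also have "\<dots> = weight (Uvar ones)"
          using ij(1) by (simp add: weight_ones sum.remove[of "{..<n}" i])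
        finally show ?thesis using axis[OF ij(1-3)] ij(4) by (simp add: monic_deg_def)
      qed
    qed
  qed
  show ?thesis
  proof (cases v)
    case (Pvar s)
    then have s: "s \<in> S" using assms by (auto simp: pu_vars_def)
    show ?thesis
      unfolding Pvar weight_P[OF s] param_simps rank1_def
      by (intro monic_deg_prod) (simp add: wa_def monic_deg_monom)
  next
    case (Uvar s)
    then have "s \<in> S" using assms by (auto simp: pu_vars_def)
    then show ?thesis unfolding Uvar param_simps
      using free[of s] ones axis by (cases "s \<in> Axis") (auto elim!: Axis_cases)
  qed
qed

lemma monic_meval:
  assumes "keys m \<subseteq> V"
  shows "monic_deg (\<Sum>x\<in>parameters. w x * exponent m x) (meval (param wa wt wu) m)"
proof -
  have "(\<Sum>v\<in>V. lookup m v * weight v) = (\<Sum>x\<in>parameters. w x * exponent m x)"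
    unfolding weight_def exponent_def sum_distrib_left
    by (subst sum.swap) (simp add: mult_ac)
  moreover have "monic_deg (\<Sum>v\<in>V. lookup m v * weight v) (meval (param wa wt wu) m)"
    unfolding meval_superset[OF finite_V assms]
    by (intro monic_deg_prod monic_deg_power monic_param)
  ultimately show ?thesis by simp
qed

end

lemma standard_independent:
  assumes f: "f \<in> param_ideal" and std: "\<And>m. m \<in> keys f \<Longrightarrow> standard m"
  shows "f = 0"
proof (rule ccontr)
  assume "f \<noteq> 0"
  then have ne: "keys f \<noteq> {}" using sum_single_keys[of f] by auto
  have fV: "keys m \<subseteq> V" if "m \<in> keys f" for m
    using f that by (auto simp: param_ideal_iff carrier_poly_ring)
  \<comment> \<open>\<open>Scale\<close> must outweigh every free coordinate and
    \<open>Factor k 1\<close> every other factor in its direction; two ranks suffice.\<close>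
  define rank :: "parameter \<Rightarrow> nat"
    where "rank x = (case x of Scale \<Rightarrow> 1 | Factor k j \<Rightarrow> of_bool (j = 1) | Free s \<Rightarrow> 0)" for x
  obtain w where w: "\<And>x. x \<in> parameters \<Longrightarrow> 1 \<le> w x"
    "\<And>x y. x \<in> parameters \<Longrightarrow> y \<in> parameters \<Longrightarrow> rank x < rank y \<Longrightarrow> w x < w y"
    and inj: "\<And>E E' x. E \<in> exponent ` keys f \<Longrightarrow> E' \<in> exponent ` keys f \<Longrightarrow>
      (\<Sum>x\<in>parameters. w x * E x) = (\<Sum>x\<in>parameters. w x * E' x) \<Longrightarrow> x \<in> parameters \<Longrightarrow> E x = E' x"
    using separating_weights[of parameters "exponent ` keys f" rank] by auto
  have wF: "w (Free s) < w Scale" if "s \<in> S - Axis" for s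
    using that by (intro w) (auto simp: rank_def)
  have wA: "w (Factor k j) < w (Factor k 1)" if "k < n" "2 \<le> j" "j \<le> ds ! k" for k j
    using that by (intro w) (auto simp: rank_def)
  let ?x = "param (wa w) (wt w) (wu w)"
  have "peval ?x f \<noteq> 0"
    unfolding peval_def
  proof (rule sum_monic_neq_0[where d = "\<lambda>m. \<Sum>x\<in>parameters. w x * exponent m x"])
    show "inj_on (\<lambda>m. \<Sum>x\<in>parameters. w x * exponent m x) (keys f)"
    proof (rule inj_onI)
      fix m m' assume m: "m \<in> keys f" "m' \<in> keys f"
        "(\<Sum>x\<in>parameters. w x * exponent m x) = (\<Sum>x\<in>parameters. w x * exponent m' x)"
      show "m = m'"
        by (rule standard_exponent_inj) (use m fV std inj in auto)
    qed
    show "monic_deg (\<Sum>x\<in>parameters. w x * exponent m x) (meval ?x m)" if "m \<in> keys f" for m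
      by (rule monic_meval[OF w(1) wF wA fV[OF that]])
  qed (use ne in \<open>auto simp: in_keys_iff\<close>)
  moreover have "poly (peval ?x f) z = 0" for z
    using f unfolding poly_peval poly_param by (simp add: param_ideal_iff)
  then have "peval ?x f = 0" using poly_all_0_iff_0 by blast
  ultimately show False by simp
qed

end

section \<open>Tangent spaces and the likelihood correspondence\<close>

interpretation coords: vector_space scale
  by (rule vector_space_scale)

lemma sum_fun_apply: "(\<Sum>a\<in>A. f a) x = (\<Sum>a\<in>A. f a x)"
  by (induction A rule: infinite_finite_induct) auto

lemma vanishing_ideal_vanishes:
  assumes "f \<in> vanishing_ideal S M"
  shows "f \<in> carrier (poly_ring S)" "\<And>x. x \<in> \<Union>M \<Longrightarrow> eval x f = 0"
proof -
  have "vanishing_ideal S M \<subseteq> {f \<in> carrier (poly_ring S). \<forall>x\<in>\<Union>M. eval x f = 0}"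
    unfolding vanishing_ideal_def by (rule genideal_poly_ring(3)[OF _ ideal_vanishing]) auto
  then show "f \<in> carrier (poly_ring S)" "\<And>x. x \<in> \<Union>M \<Longrightarrow> eval x f = 0" using assms by auto
qed

lemma vanishing_idealI:
  assumes "f \<in> carrier (poly_ring S)" "homogeneous a f" "\<And>x. x \<in> \<Union>M \<Longrightarrow> eval x f = 0"
  shows "f \<in> vanishing_ideal S M"
  unfolding vanishing_ideal_def by (rule subsetD[OF genideal_poly_ring(2)]) (use assms in auto)

lemma subspace_tangent_space: "coords.subspace (tangent_space S M x)"
  unfolding coords.subspace_def tangent_space_def vecs_def
  by (auto simp: scale_def distrib_left sum.distrib mult.left_commute sum_distrib_left[symmetric])

lemma vecs_subset_span:
  assumes "finite S"
  shows "vecs S \<subseteq> coords.span ((\<lambda>s t. of_bool (t = s)) ` S)"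
proof
  fix v :: "'a \<Rightarrow> complex" assume v: "v \<in> vecs S"
  have "v = (\<Sum>s\<in>S. scale (v s) (\<lambda>t. of_bool (t = s)))"
  proof
    fix t
    have "(\<Sum>s\<in>S. scale (v s) (\<lambda>t. of_bool (t = s))) t = (\<Sum>s\<in>S. if s = t then v s else 0)"
      unfolding sum_fun_apply by (rule sum.cong) (auto simp: scale_def)
    then show "v t = (\<Sum>s\<in>S. scale (v s) (\<lambda>t. of_bool (t = s))) t"
      using v assms by (simp add: vecs_def)
  qed
  also have "\<dots> \<in> coords.span ((\<lambda>s t. of_bool (t = s)) ` S)"
    by (intro coords.span_sum coords.span_scale coords.span_base) auto
  finally show "v \<in> coords.span ((\<lambda>s t. of_bool (t = s)) ` S)" .
qed

text \<open>The image of a basis stays independent. Comparing cardinalities needs the finite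
  spanning set of \<open>vecs S\<close>, because the ambient function space may be infinite
  dimensional.\<close>

lemma dim_le_of_injective:
  assumes S: "finite S" and L: "Vector_Spaces.linear scale scale L"
    and T: "coords.subspace T" and T': "coords.subspace T'" "T' \<subseteq> vecs S"
    and maps: "L ` T \<subseteq> T'" and inj: "\<And>v. v \<in> T \<Longrightarrow> L v = 0 \<Longrightarrow> v = 0"
  shows "coords.dim T \<le> coords.dim T'"
proof -
  interpret L: Vector_Spaces.linear scale scale L by fact
  obtain B where B: "B \<subseteq> T" "coords.independent B" "T \<subseteq> coords.span B" "card B = coords.dim T"
    using coords.basis_exists by blast
  obtain B' where B': "B' \<subseteq> T'" "coords.independent B'" "T' \<subseteq> coords.span B'" "card B' = coords.dim T'"
    using coords.basis_exists by blast
  have "B' \<subseteq> coords.span ((\<lambda>s t. of_bool (t = s)) ` S)"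
    using B'(1) T'(2) vecs_subset_span[OF S] by blast
  then have fin: "finite B'" using coords.independent_span_bound[OF _ B'(2)] S by blast
  have "coords.span B \<subseteq> T" using B(1) T by (rule coords.span_minimal)
  then have "inj_on L (coords.span B)"
    by (intro inj_onI) (metis L.diff coords.span_diff eq_iff_diff_eq_0 inj subsetD)
  then have "coords.independent (L ` B)" "inj_on L B"
    using L.independent_injective_image[OF B(2)] coords.span_superset inj_on_subset by blast+
  moreover have "L ` B \<subseteq> coords.span B'" using B(1) maps B'(3) by blast
  ultimately have "card (L ` B) \<le> card B'" using coords.independent_span_bound[OF fin] by blast
  then show ?thesis using B(4) B'(4) card_image[OF \<open>inj_on L B\<close>] by simp
qed

lemma zariski_closure_superset: "X \<subseteq> zariski_closure S X"
  by (auto simp: zariski_closure_def)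

text \<open>A single bihomogeneous polynomial already cuts out a closed set, so vanishing on
  \<open>X\<close> extends to the closure.\<close>

lemma bihom_vanishing_ideal_closure:
  assumes "X \<subseteq> proj_space S \<times> proj_space S"
  shows "bihom_vanishing_ideal S (zariski_closure S X) = bihom_vanishing_ideal S X"
proof -
  have "(\<forall>(q, r)\<in>zariski_closure S X. \<forall>x\<in>q. \<forall>y\<in>r. eval (pu_point x y) f = 0) \<longleftrightarrow>
      (\<forall>(q, r)\<in>X. \<forall>x\<in>q. \<forall>y\<in>r. eval (pu_point x y) f = 0)" (is "?L \<longleftrightarrow> ?R")
    if f: "f \<in> bihom_polys S" for f
  proof
    assume ?L then show ?R using zariski_closure_superset by blast
  next
    assume ?R
    then have "X \<subseteq> bizeros S {f}" using assms by (auto simp: bizeros_def)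
    then have "zariski_closure S X \<subseteq> bizeros S {f}" using f by (auto simp: zariski_closure_def)
    then show ?L by (auto simp: bizeros_def)
  qed
  then show ?thesis unfolding bihom_vanishing_ideal_def
    by (intro arg_cong[where f = "genideal _"] Collect_cong) blast
qed

lemma proj_pt_self: "x \<in> proj_pt x"
  unfolding proj_pt_def by (intro CollectI exI[of _ 1]) (simp add: scale_def)

text \<open>With \<open>R = UNIV\<close> this is the total degree, with the range of
  \<open>Pvar\<close> or \<open>Uvar\<close> a component of the bidegree.\<close>

definition block_degree :: "'v set \<Rightarrow> 'v mono \<Rightarrow> nat" where
  "block_degree R m = (\<Sum>v\<in>keys m \<inter> R. lookup m v)"

lemma block_degree_superset:
  "finite A \<Longrightarrow> keys m \<subseteq> A \<Longrightarrow> block_degree R m = (\<Sum>v\<in>A \<inter> R. lookup m v)"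
  unfolding block_degree_def by (rule sum.mono_neutral_left) (auto simp: in_keys_iff)

lemma block_degree_add: "block_degree R (m + m') = block_degree R m + block_degree R m'"
  using block_degree_superset[of "keys m \<union> keys m'"]
  by (simp add: keys_add_nat lookup_add sum.distrib)

lemma block_degree_single: "block_degree R (single v (Suc 0)) = of_bool (v \<in> R)"
  by (auto simp: block_degree_def)

lemma bihomogeneous_block:
  "bihomogeneous a b f \<longleftrightarrow> (\<forall>m\<in>keys f. block_degree (range Pvar) m = a \<and> block_degree (range Uvar) m = b)"
  by (simp add: bihomogeneous_def block_degree_def)

lemma bihomogeneous_mult:
  "bihomogeneous a b f \<Longrightarrow> bihomogeneous c d g \<Longrightarrow> bihomogeneous (a + c) (b + d) (f * g)"
  using keys_mult[of f g] by (fastforce simp: bihomogeneous_block block_degree_add)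

lemma bihomogeneous_diff:
  "bihomogeneous a b f \<Longrightarrow> bihomogeneous a b g \<Longrightarrow> bihomogeneous a b (f - g)"
  using keys_diff_subset[of f g] by (auto simp: bihomogeneous_block)

lemma bihomogeneous_sum:
  "(\<And>i. i \<in> A \<Longrightarrow> bihomogeneous a b (f i)) \<Longrightarrow> bihomogeneous a b (sum f A)"
  using keys_sum_subset[of f A] by (fastforce simp: bihomogeneous_block)

lemma bihomogeneous_Pvar: "bihomogeneous 1 0 (Var (Pvar s))"
  by (auto simp: bihomogeneous_block Var_def block_degree_single)

lemma bihomogeneous_Uvar: "bihomogeneous 0 1 (Var (Uvar s))"
  by (auto simp: bihomogeneous_block Var_def block_degree_single)

context format
begin

text \<open>Entries of one column share a bidegree, and since \<open>c < c'\<close> only column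
  \<open>c'\<close> can be the column of marginals.\<close>

lemma minors_bihom: "minors \<subseteq> bihom_polys S"
proof
  fix g assume g: "g \<in> minors"
  then obtain i where i: "i < n" "g \<in> minors2 (M_matrix ds i)" by (auto simp: minors_def)
  let ?M = "M_matrix ds i"
  obtain r r' c c' where g': "g = ?M $$ (r, c) * ?M $$ (r', c') - ?M $$ (r, c') * ?M $$ (r', c)"
    and rc: "r < r'" "r' < ds ! i" "c < c'" "c' < Suc (ncol i)"
    using i(2) by (auto simp: minors2_def)
  have P: "bihomogeneous 1 0 (?M $$ (r, c))" if "r < ds ! i" "c < ncol i" for r c
    using that i by (simp add: M_entry bihomogeneous_Pvar del: One_nat_def)
  have U: "bihomogeneous 0 1 (?M $$ (r, ncol i))" if "r < ds ! i" for r
    unfolding M_entry_last[OF that] by (intro bihomogeneous_sum bihomogeneous_Uvar)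
  have "\<exists>a b. bihomogeneous a b (?M $$ (r, c')) \<and> bihomogeneous a b (?M $$ (r', c'))"
    using P[of r c'] P[of r' c'] U[of r] U[of r'] rc by (cases "c' = ncol i") auto
  then obtain a b where ab: "bihomogeneous a b (?M $$ (r, c'))" "bihomogeneous a b (?M $$ (r', c'))" by blast
  have "bihomogeneous (a + 1) (b + 0) g"
    unfolding g'
    \<comment> \<open>Commuting the first product puts the factor from column \<open>c'\<close> in
      front in both terms.\<close>
    by (subst mult.commute, intro bihomogeneous_diff bihomogeneous_mult ab P) (use rc in auto)
  moreover have "g \<in> carrier (poly_ring V)" using i minors2_carrier by blast
  ultimately show "g \<in> bihom_polys S" unfolding bihom_polys_def by blast
qed

section \<open>The cone over the model and its tangent spaces\<close>

abbreviation M :: "nat list point set" where "M \<equiv> independence_model ds"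

lemma cone_iff: "x \<in> \<Union>M \<longleftrightarrow> x \<in> vecs S \<and> x \<noteq> 0 \<and> (\<exists>a. \<forall>s\<in>S. x s = rank1 a s)"
proof
  assume "x \<in> \<Union>M"
  then obtain y c a where y: "y \<in> vecs S" "y \<noteq> 0" "\<And>s. s \<in> S \<Longrightarrow> y s = rank1 a s"
    and c: "c \<noteq> 0" "x = scale c y"
    by (auto simp: independence_model_def proj_pt_def rank1_def)
  note n0 = n_pos
  \<comment> \<open>The scalar of the representative is absorbed into the factor in position
    0.\<close>
  have "x s = rank1 (a(0 := \<lambda>j. c * a 0 j)) s" if "s \<in> S" for s
  proof -
    have "(\<Prod>k\<in>{..<n} - {0}. (a(0 := \<lambda>j. c * a 0 j)) k (s ! k)) = (\<Prod>k\<in>{..<n} - {0}. a k (s ! k))"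
      by (rule prod.cong) auto
    then show ?thesis
      using that n0 by (simp add: c scale_def y rank1_def prod.remove[of "{..<n}" 0])
  qed
  moreover have "x \<in> vecs S" using y c by (simp add: vecs_def scale_def)
  moreover have "x \<noteq> 0" using y(2) c by (auto simp: scale_def fun_eq_iff)
  ultimately show "x \<in> vecs S \<and> x \<noteq> 0 \<and> (\<exists>a. \<forall>s\<in>S. x s = rank1 a s)" by blast
next
  assume "x \<in> vecs S \<and> x \<noteq> 0 \<and> (\<exists>a. \<forall>s\<in>S. x s = rank1 a s)"
  then have "proj_pt x \<in> M" by (auto simp: independence_model_def rank1_def)
  then show "x \<in> \<Union>M" using proj_pt_self by blast
qed

lemma model_subset_proj_space: "M \<subseteq> proj_space S"
  by (auto simp: independence_model_def proj_space_def)

lemma proj_pt_in_model: "x \<in> \<Union>M \<Longrightarrow> proj_pt x \<in> M"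
  unfolding cone_iff by (auto simp: independence_model_def rank1_def)

text \<open>Varying the single factor \<open>b i\<close> in direction \<open>h\<close> moves
  \<open>y\<close> along a line in the cone, and polynomials vanishing on the cone have derivative 0
  along it.\<close>

lemma tangent_vector:
  assumes y: "y \<in> \<Union>M" "\<And>s. s \<in> S \<Longrightarrow> y s = rank1 b s" and i: "i < n"
  shows "(\<lambda>s. if s \<in> S then h (s ! i) * (\<Prod>k\<in>{..<n} - {i}. b k (s ! k)) else 0) \<in> tangent_space S M y"
    (is "?v \<in> _")
  unfolding tangent_space_def
proof (intro CollectI conjI ballI)
  show "?v \<in> vecs S" by (simp add: vecs_def)
  fix f assume f: "f \<in> vanishing_ideal S M"
  let ?c = "\<lambda>z s. y s + z * ?v s"
  have line: "?c z s = rank1 (b(i := \<lambda>j. b i j + z * h j)) s" if "s \<in> S" for z s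
  proof -
    have "(\<Prod>k\<in>{..<n} - {i}. (b(i := \<lambda>j. b i j + z * h j)) k (s ! k)) = (\<Prod>k\<in>{..<n} - {i}. b k (s ! k))"
      by (rule prod.cong) auto
    then show ?thesis
      using that i by (simp add: y(2) rank1_def prod.remove[of "{..<n}" i] distrib_right)
  qed
  \<comment> \<open>\<open>\<Union>M\<close> excludes the origin, so the line is used only near 0,
    where a nonzero coordinate stays nonzero.\<close>
  obtain s0 where s0: "y s0 \<noteq> 0" using y(1) unfolding cone_iff by (auto simp: fun_eq_iff)
  have "open {z. y s0 + z * ?v s0 \<noteq> 0}"
    by (intro open_Collect_neq continuous_intros)
  then have "\<forall>\<^sub>F z in nhds 0. z \<in> {z. y s0 + z * ?v s0 \<noteq> 0}"
    by (rule eventually_nhds_in_open) (use s0 in simp)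
  then have ev: "\<forall>\<^sub>F z in nhds 0. eval (?c z) f = 0"
  proof eventually_elim
    case (elim z)
    have "?c z \<in> \<Union>M"
      unfolding cone_iff
    proof (intro conjI exI ballI)
      show "?c z \<in> vecs S" using y(1) unfolding cone_iff by (auto simp: vecs_def)
      show "?c z \<noteq> 0"
      proof
        assume "?c z = 0"
        from fun_cong[OF this, of s0] elim show False by simp
      qed
    qed (rule line)
    then show ?case using vanishing_ideal_vanishes(2)[OF f] by blast
  qed
  have "((\<lambda>z. eval (?c z) f) has_field_derivative (\<Sum>s\<in>S. eval y (partial s f) * ?v s)) (at 0)"
    by (rule eval_has_derivative_line) (use vanishing_ideal_vanishes(1)[OF f] in \<open>auto simp: carrier_poly_ring\<close>)
  then have "((\<lambda>z. 0) has_field_derivative (\<Sum>s\<in>S. eval y (partial s f) * ?v s)) (at 0)"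
    using DERIV_cong_ev[OF refl ev refl] by blast
  then show "(\<Sum>s\<in>S. eval y (partial s f) * ?v s) = 0"
    using DERIV_const DERIV_unique by blast
qed

text \<open>This is the differential of the quadric \<open>f\<close>, which exchanges the entries of
  \<open>s\<close> and \<open>t\<close> at \<open>i\<close> and vanishes on rank one
  tensors.\<close>

lemma tangent_relation:
  assumes v: "v \<in> tangent_space S M x" and st: "s \<in> S" "t \<in> S" and i: "i < n"
  shows "v s * x t + x s * v t = v (s[i := t ! i]) * x (t[i := s ! i]) + x (s[i := t ! i]) * v (t[i := s ! i])"
proof -
  let ?s = "s[i := t ! i]" and ?t = "t[i := s ! i]"
  define f where "f = Var s * Var t - Var ?s * Var ?t"
  have S: "?s \<in> S" "?t \<in> S" using st nth_S i by (auto intro!: update_S simp del: atLeastAtMost_iff)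
  have "f \<in> vanishing_ideal S M"
  proof (rule vanishing_idealI)
    show "f \<in> carrier (poly_ring S)" unfolding f_def by (intro carrier_poly_ring_closed st S)
    have "keys f \<subseteq> {single s 1 + single t 1, single ?s 1 + single ?t 1}"
      unfolding f_def Var_mult_Var using keys_diff_subset by fastforce
    moreover have "block_degree UNIV (single s (1::nat) + single t 1) = 2" for s t :: "nat list"
      by (simp add: block_degree_add block_degree_single)
    ultimately show "homogeneous 2 f"
      by (auto simp: homogeneous_def block_degree_def)
    fix y assume "y \<in> \<Union>M"
    then obtain a where a: "\<And>s. s \<in> S \<Longrightarrow> y s = rank1 a s" unfolding cone_iff by blast
    have "rank1 a s = a i (s ! i) * (\<Prod>k\<in>{..<n} - {i}. a k (s ! k))" "rank1 a t = a i (t ! i) * (\<Prod>k\<in>{..<n} - {i}. a k (t ! k))"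
      using rank1_update[OF st(1) i, of a "s ! i"] rank1_update[OF st(2) i, of a "t ! i"] by simp_all
    then show "eval y f = 0" using st S i by (simp add: f_def a rank1_update)
  qed
  then have z: "(\<Sum>s\<in>S. eval x (partial s f) * v s) = 0"
    using v unfolding tangent_space_def by blast
  \<comment> \<open>The derivative along \<open>v\<close> is computed twice, through
    \<open>partial\<close> and by the product rule.\<close>
  have 1: "((\<lambda>z. eval (\<lambda>s. x s + z * v s) f) has_field_derivative (\<Sum>s\<in>S. eval x (partial s f) * v s)) (at 0)"
    by (rule eval_has_derivative_line)
      (use carrier_poly_ring[of f S] st S in \<open>auto simp: f_def carrier_poly_ring_closed\<close>)
  have 2: "((\<lambda>z. eval (\<lambda>s. x s + z * v s) f) has_field_derivative
      (v s * x t + x s * v t - (v ?s * x ?t + x ?s * v ?t))) (at 0)"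
    unfolding f_def eval_diff eval_mult eval_Var
    by (auto intro!: derivative_eq_intros simp: algebra_simps)
  from DERIV_unique[OF 1 2] z show ?thesis by simp
qed

text \<open>Dividing by \<open>x\<close> turns the relations from the quadrics into additive ones.
  Changing one entry then has an effect independent of the other entries, so
  \<open>v s / x s\<close> is a constant plus functions of single entries.\<close>

lemma torus_tangent:
  assumes v: "v \<in> tangent_space S M x" and x: "\<And>s. s \<in> S \<Longrightarrow> x s = rank1 a s" "\<And>s. s \<in> S \<Longrightarrow> x s \<noteq> 0"
    and r: "r \<in> S" and s: "s \<in> S"
  shows "v s = x s * (v r / x r + (\<Sum>i<n. v (r[i := s ! i]) / x (r[i := s ! i]) - v r / x r))"
proof -
  define w where "w s = v s / x s" for s
  have rel: "w s + w t = w (s[i := t ! i]) + w (t[i := s ! i])" if st: "s \<in> S" "t \<in> S" and i: "i < n" for s t i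
  proof -
    let ?s = "s[i := t ! i]" and ?t = "t[i := s ! i]"
    have S: "?s \<in> S" "?t \<in> S" using st nth_S i by (auto intro!: update_S simp del: atLeastAtMost_iff)
    have "rank1 a s = a i (s ! i) * (\<Prod>k\<in>{..<n} - {i}. a k (s ! k))" "rank1 a t = a i (t ! i) * (\<Prod>k\<in>{..<n} - {i}. a k (t ! k))"
      using rank1_update[OF st(1) i, of a "s ! i"] rank1_update[OF st(2) i, of a "t ! i"] by simp_all
    then have eq: "x s * x t = x ?s * x ?t" using st S i by (simp add: x(1) rank1_update)
    have nz: "x s \<noteq> 0" "x t \<noteq> 0" "x ?s \<noteq> 0" "x ?t \<noteq> 0" using x(2) st S by auto
    have "w s + w t = (v s * x t + x s * v t) / (x s * x t)"
      using nz by (simp add: w_def field_simps)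
    also have "\<dots> = (v ?s * x ?t + x ?s * v ?t) / (x ?s * x ?t)"
      using tangent_relation[OF v st i] eq by simp
    also have "\<dots> = w ?s + w ?t" using nz by (simp add: w_def field_simps)
    finally show ?thesis .
  qed
  have len: "length s = n" "length r = n" using length_S r s by auto
  \<comment> \<open>The entries of \<open>r\<close> are replaced by those of \<open>s\<close> one by
    one from the left; \<open>rel\<close> compares each step with the same change made in
    \<open>r\<close> itself.\<close>
  have "take k s @ drop k r \<in> S \<and> w (take k s @ drop k r) = w r + (\<Sum>i<k. w (r[i := s ! i]) - w r)" if "k \<le> n" for k
    using that
  proof (induction k)
    case 0
    then show ?case using r by simp
  next
    case (Suc k)
    let ?m = "take k s @ drop k r" and ?t = "r[k := s ! k]"
    have k: "k < n" using Suc(2) by simp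
    have m: "?m \<in> S" "w ?m = w r + (\<Sum>i<k. w (r[i := s ! i]) - w r)" using Suc by auto
    have t: "?t \<in> S" using nth_S[OF s k] by (intro update_S r)
    have mk: "?m ! k = r ! k" "?t ! k = s ! k" using len k by (auto simp: nth_append)
    have next_m: "?m[k := ?t ! k] = take (Suc k) s @ drop (Suc k) r"
      unfolding mk using len k by (auto intro!: nth_equalityI simp: nth_append nth_list_update min_def)
    have "w ?m + w ?t = w (?m[k := ?t ! k]) + w (?t[k := ?m ! k])"
      by (rule rel[OF m(1) t k])
    also have "?t[k := ?m ! k] = r" unfolding mk by simp
    finally have "w (take (Suc k) s @ drop (Suc k) r) = w ?m + w ?t - w r" unfolding next_m by simp
    moreover have "?m[k := ?t ! k] \<in> S" using nth_S[OF s k] mk by (intro update_S m) simp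
    ultimately show ?case using m(2) next_m by simp
  qed
  from this[OF order_refl] have "w s = w r + (\<Sum>i<n. w (r[i := s ! i]) - w r)" using len by simp
  then have "v s / x s = v r / x r + (\<Sum>i<n. v (r[i := s ! i]) / x (r[i := s ! i]) - v r / x r)"
    by (simp only: w_def)
  then show ?thesis using x(2)[OF s] by (metis nonzero_mult_div_cancel_left times_divide_eq_right)
qed

text \<open>A tangent vector at \<open>x\<close> is given by a constant and one function per
  direction. \<open>L\<close> sends it to the tangent vector at \<open>y\<close> with the same data,
  and it is injective because the data are normalised at an index \<open>r\<close> with
  \<open>y r \<noteq> 0\<close>. Points of the model with all coordinates nonzero are therefore
  smooth.\<close>

lemma torus_dim_le:
  assumes x: "\<And>s. s \<in> S \<Longrightarrow> x s = rank1 a s" "\<And>s. s \<in> S \<Longrightarrow> x s \<noteq> 0"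
    and y: "y \<in> \<Union>M"
  shows "coords.dim (tangent_space S M x) \<le> coords.dim (tangent_space S M y)"
proof -
  obtain b where b: "\<And>s. s \<in> S \<Longrightarrow> y s = rank1 b s" and y0: "y \<noteq> 0" "y \<in> vecs S"
    using y unfolding cone_iff by blast
  obtain r where yr: "y r \<noteq> 0" using y0(1) by (auto simp: fun_eq_iff)
  then have r: "r \<in> S" using y0(2) by (auto simp: vecs_def)
  note n0 = n_pos
  define h where "h v i j = v (r[i := j]) / x (r[i := j]) - v r / x r" for v i j
  \<comment> \<open>The constant is realised as a rescaling of the factor in direction 0, so every
    summand has the form in \<open>tangent_vector\<close>.\<close>
  define L where "L v = (\<lambda>s. if s \<in> S then (v r / x r * b 0 (s ! 0)) * (\<Prod>k\<in>{..<n} - {0}. b k (s ! k)) else 0) +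
    (\<Sum>i<n. (\<lambda>s. if s \<in> S then h v i (s ! i) * (\<Prod>k\<in>{..<n} - {i}. b k (s ! k)) else 0))" for v
  have L_apply: "L v s = (if s \<in> S then v r / x r * rank1 b s +
      (\<Sum>i<n. h v i (s ! i) * (\<Prod>k\<in>{..<n} - {i}. b k (s ! k))) else 0)" for v s
    using n0 by (simp add: L_def sum_fun_apply rank1_def prod.remove[of "{..<n}" 0])
  have h_r: "h v i (r ! i) = 0" for v i by (simp add: h_def)
  show ?thesis
  proof (rule dim_le_of_injective[OF finite_S _ subspace_tangent_space subspace_tangent_space])
    show "Vector_Spaces.linear scale scale L"
    proof (intro Vector_Spaces.linear_iff[THEN iffD2] conjI allI vector_space_scale)
      fix v v'
      show "L (v + v') = L v + L v'"
        by (rule ext) (simp add: L_apply h_def add_divide_distrib algebra_simps sum.distrib sum_subtractf)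
    next
      fix c v
      show "L (scale c v) = scale c (L v)"
        by (rule ext) (simp add: L_apply h_def scale_def algebra_simps sum_distrib_left)
    qed
    show "tangent_space S M y \<subseteq> vecs S" by (auto simp: tangent_space_def)
    show "L ` tangent_space S M x \<subseteq> tangent_space S M y"
    proof clarify
      fix v
      show "L v \<in> tangent_space S M y"
        unfolding L_def
        by (intro coords.subspace_add[OF subspace_tangent_space] coords.subspace_sum[OF subspace_tangent_space]
          tangent_vector[OF y b, where h = "\<lambda>j. v r / x r * b 0 j"] tangent_vector[OF y b]) (use n0 in auto)
    qed
    fix v assume v: "v \<in> tangent_space S M x" and Lv: "L v = 0"
    \<comment> \<open>At \<open>r\<close> only the constant contributes and, once it is 0, at
      \<open>r[i := j]\<close> only \<open>h v i j\<close>.\<close>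
    have "L v r = v r / x r * rank1 b r" using r by (simp add: L_apply h_r)
    then have c: "v r / x r = 0" using Lv yr b[OF r] by simp
    have h0: "h v i j = 0" if i: "i < n" and j: "j \<in> {1..ds ! i}" for i j
    proof -
      have rj: "r[i := j] \<in> S" using r j by (rule update_S)
      have "L v (r[i := j]) = (\<Sum>l<n. h v l (r[i := j] ! l) * (\<Prod>k\<in>{..<n} - {l}. b k (r[i := j] ! k)))"
        using rj by (simp add: L_apply c)
      also have "\<dots> = (\<Sum>l<n. if l = i then h v i j * (\<Prod>k\<in>{..<n} - {i}. b k (r ! k)) else 0)"
      proof (rule sum.cong)
        fix l assume l: "l \<in> {..<n}"
        show "h v l (r[i := j] ! l) * (\<Prod>k\<in>{..<n} - {l}. b k (r[i := j] ! k)) =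
          (if l = i then h v i j * (\<Prod>k\<in>{..<n} - {i}. b k (r ! k)) else 0)"
        proof (cases "l = i")
          case True
          have "(\<Prod>k\<in>{..<n} - {i}. b k (r[i := j] ! k)) = (\<Prod>k\<in>{..<n} - {i}. b k (r ! k))"
            by (rule prod.cong) auto
          then show ?thesis using True i length_S[OF r] by simp
        next
          case False
          then show ?thesis using h_r by simp
        qed
      qed simp
      finally have "h v i j * (\<Prod>k\<in>{..<n} - {i}. b k (r ! k)) = 0" using i Lv by simp
      moreover have "rank1 b r = b i (r ! i) * (\<Prod>k\<in>{..<n} - {i}. b k (r ! k))"
        unfolding rank1_def using i by (intro prod.remove) auto
      ultimately show ?thesis using yr b[OF r] by auto
    qed
    show "v = 0"
    proof
      fix s
      show "v s = 0 s"
      proof (cases "s \<in> S")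
        case True
        have "v s = x s * (v r / x r + (\<Sum>i<n. h v i (s ! i)))"
          using torus_tangent[OF v x r True] by (simp only: h_def)
        also have "(\<Sum>i<n. h v i (s ! i)) = 0"
          by (rule sum.neutral) (use h0 nth_S[OF True] in blast)
        finally show ?thesis using c by simp
      next
        case False
        then show ?thesis using v by (simp add: tangent_space_def vecs_def)
      qed
    qed
  qed
qed

text \<open>Each \<open>h i\<close> depends on one entry, and grouping by that entry brings in the
  marginals of \<open>y\<close>. The constant counts as a function of the entry in position
  0.\<close>

lemma sum_zero_fibers:
  fixes y :: "nat list \<Rightarrow> complex"
  assumes y: "\<And>i j. i < n \<Longrightarrow> j \<in> {1..ds ! i} \<Longrightarrow> (\<Sum>s | s \<in> S \<and> s ! i = j. y s) = 0"
  shows "(\<Sum>s\<in>S. y s * (c + (\<Sum>i<n. h i (s ! i)))) = 0"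
proof -
  have fib: "(\<Sum>s\<in>S. y s * g (s ! i)) = 0" if i: "i < n" for i g
  proof -
    have "(\<Sum>s\<in>S. y s * g (s ! i)) = (\<Sum>j=1..ds ! i. \<Sum>s | s \<in> S \<and> s ! i = j. y s * g (s ! i))"
      by (rule sum_fibers[OF i, symmetric])
    also have "\<dots> = (\<Sum>j=1..ds ! i. (\<Sum>s | s \<in> S \<and> s ! i = j. y s) * g j)"
      by (intro sum.cong refl) (auto simp: sum_distrib_right intro!: sum.cong)
    also have "\<dots> = 0" by (intro sum.neutral ballI) (use y[OF i] in simp)
    finally show ?thesis .
  qed
  from fib[OF n_pos, of "\<lambda>_. c"] have "(\<Sum>s\<in>S. y s * c) = 0" .
  moreover have "(\<Sum>s\<in>S. y s * (\<Sum>i<n. h i (s ! i))) = (\<Sum>i<n. \<Sum>s\<in>S. y s * h i (s ! i))"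
    by (subst sum.swap) (simp add: sum_distrib_left)
  moreover have "(\<Sum>i<n. \<Sum>s\<in>S. y s * h i (s ! i)) = 0"
    by (intro sum.neutral ballI fib) simp
  ultimately show ?thesis by (simp add: distrib_left sum.distrib)
qed

section \<open>Critical points of the likelihood function\<close>

definition critical :: "(nat list point \<times> nat list point) set" where
  "critical = {(q, r) \<in> (smooth_locus S M - hyperplanes S) \<times> proj_space S.
     \<forall>p\<in>q. \<forall>u\<in>r. \<forall>v\<in>tangent_space S M p. dlog_likelihood S u p v = 0}"

text \<open>By \<open>torus_tangent\<close> the one-form pairs the difference of \<open>u\<close>
  and \<open>l\<close> times \<open>p\<close>, which has zero marginals, with a sum of functions of
  single entries. Smoothness comes from \<open>torus_dim_le\<close>.\<close>

lemma criticalI: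
  assumes p: "p \<in> vecs S" "\<And>s. s \<in> S \<Longrightarrow> p s = rank1 a s" "\<And>s. s \<in> S \<Longrightarrow> p s \<noteq> 0" "(\<Sum>s\<in>S. p s) \<noteq> 0"
    and u: "u \<in> vecs S" "u \<noteq> 0"
    and marg: "\<And>i j. i < n \<Longrightarrow> j \<in> {1..ds ! i} \<Longrightarrow>
      (\<Sum>s | s \<in> S \<and> s ! i = j. u s) = l * (\<Sum>s | s \<in> S \<and> s ! i = j. p s)"
  shows "(proj_pt p, proj_pt u) \<in> critical"
proof -
  note n0 = n_pos
  have p0: "p \<noteq> 0" using p(3) ones_S by (auto simp: fun_eq_iff)
  have cone: "p \<in> \<Union>M" unfolding cone_iff using p p0 by blast
  have q: "proj_pt p \<in> M" using cone by (rule proj_pt_in_model)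
  have rep: "(\<exists>a. \<forall>s\<in>S. x s = rank1 a s) \<and> (\<forall>s\<in>S. x s \<noteq> 0)" if "x \<in> proj_pt p" for x
  proof -
    have "x \<in> \<Union>M" using q that by blast
    moreover obtain c where "c \<noteq> 0" "x = scale c p" using \<open>x \<in> proj_pt p\<close> by (auto simp: proj_pt_def)
    ultimately show ?thesis using p(3) unfolding cone_iff by (auto simp: scale_def)
  qed
  have "proj_pt p \<in> smooth_locus S M"
    unfolding smooth_locus_def
  proof (intro CollectI conjI q ballI)
    fix x y assume "x \<in> proj_pt p" "y \<in> \<Union>M"
    then show "coords.dim (tangent_space S M x) \<le> coords.dim (tangent_space S M y)"
      using rep torus_dim_le by blast
  qed
  moreover have "proj_pt p \<notin> hyperplanes S"
    using p(3,4) proj_pt_self unfolding hyperplanes_def by blast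
  moreover have "proj_pt u \<in> proj_space S" using u by (auto simp: proj_space_def)
  moreover have "dlog_likelihood S u' p' v = 0"
    if p': "p' \<in> proj_pt p" and u': "u' \<in> proj_pt u" and v: "v \<in> tangent_space S M p'" for p' u' v
  proof -
    obtain a' where a': "\<And>s. s \<in> S \<Longrightarrow> p' s = rank1 a' s" and nz: "\<And>s. s \<in> S \<Longrightarrow> p' s \<noteq> 0"
      using rep[OF p'] by blast
    obtain c where c: "c \<noteq> 0" "p' = scale c p" using p' by (auto simp: proj_pt_def)
    obtain d where d: "u' = scale d u" using u' by (auto simp: proj_pt_def)
    \<comment> \<open>All representatives of both points must be tested; scaling them by
      \<open>c\<close> and \<open>d\<close> changes the factor accordingly.\<close>
    define l' where "l' = l * d / c"
    have marg': "(\<Sum>s | s \<in> S \<and> s ! i = j. u' s) = l' * (\<Sum>s | s \<in> S \<and> s ! i = j. p' s)"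
      if "i < n" "j \<in> {1..ds ! i}" for i j
      using marg[OF that] c by (simp add: d scale_def sum_distrib_left[symmetric] l'_def)
    have "(\<Sum>s\<in>S. u' s) = (\<Sum>j=1..ds ! 0. \<Sum>s | s \<in> S \<and> s ! 0 = j. u' s)"
      by (rule sum_fibers[OF n0, symmetric])
    also have "\<dots> = (\<Sum>j=1..ds ! 0. l' * (\<Sum>s | s \<in> S \<and> s ! 0 = j. p' s))"
      by (rule sum.cong) (use marg'[OF n0] in auto)
    also have "\<dots> = l' * (\<Sum>s\<in>S. p' s)"
      unfolding sum_distrib_left[symmetric] sum_fibers[OF n0] ..
    finally have "(\<Sum>s\<in>S. u' s) = l' * (\<Sum>s\<in>S. p' s)" .
    moreover have "(\<Sum>s\<in>S. p' s) \<noteq> 0" using p(4) c by (simp add: scale_def sum_distrib_left[symmetric])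
    ultimately have quot: "(\<Sum>s\<in>S. u' s) / (\<Sum>s\<in>S. p' s) = l'" by simp
    define h where "h i j = v (ones[i := j]) / p' (ones[i := j]) - v ones / p' ones" for i j
    have "dlog_likelihood S u' p' v = (\<Sum>s\<in>S. (u' s - l' * p' s) * (v ones / p' ones + (\<Sum>i<n. h i (s ! i))))"
      unfolding dlog_likelihood_def quot
    proof (rule sum.cong)
      fix s assume s: "s \<in> S"
      have vs: "v s = p' s * (v ones / p' ones + (\<Sum>i<n. h i (s ! i)))"
        using torus_tangent[OF v a' nz ones_S s] by (simp only: h_def)
      have "(u' s / p' s - l') * (p' s * k) = (u' s - l' * p' s) * k" for k
        using nz[OF s] by (simp add: field_simps)
      then show "(u' s / p' s - l') * v s = (u' s - l' * p' s) * (v ones / p' ones + (\<Sum>i<n. h i (s ! i)))"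
        unfolding vs .
    qed simp
    also have "\<dots> = 0"
      by (rule sum_zero_fibers) (simp add: sum_subtractf marg' sum_distrib_left[symmetric])
    finally show ?thesis .
  qed
  ultimately show ?thesis unfolding critical_def by blast
qed

text \<open>The restriction of \<open>p\<close> to a slice is a tangent vector. Testing the one-form
  on it shows that the marginals of \<open>u\<close> are proportional to those of \<open>p\<close>,
  and \<open>minors_vanish\<close> applies.\<close>

lemma critical_minors_vanish:
  assumes qr: "(q, r) \<in> critical" and p: "p \<in> q" and u: "u \<in> r" and g: "g \<in> minors"
  shows "eval (pu_point p u) g = 0"
proof -
  have q: "q \<in> M" "q \<notin> hyperplanes S" "q \<in> proj_space S"
    using qr model_subset_proj_space by (auto simp: critical_def smooth_locus_def)
  have cone: "p \<in> \<Union>M" using q p by blast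
  then obtain a where a: "\<And>s. s \<in> S \<Longrightarrow> p s = rank1 a s" unfolding cone_iff by blast
  obtain x where x: "x \<in> q" "\<And>s. s \<in> S \<Longrightarrow> x s \<noteq> 0" using q(2,3) by (auto simp: hyperplanes_def)
  have nz: "p s \<noteq> 0" if "s \<in> S" for s
    using q(3) p x that by (auto simp: proj_space_def proj_pt_def scale_def)
  define l where "l = (\<Sum>s\<in>S. u s) / (\<Sum>s\<in>S. p s)"
  have marg: "(\<Sum>s | s \<in> S \<and> s ! i = j. u s) = l * (a i j * (\<Prod>k\<in>{..<n} - {i}. total a k))"
    if i: "i < n" and j: "j \<in> {1..ds ! i}" for i j
  proof -
    \<comment> \<open>The derivative of \<open>p\<close> when the value \<open>a i j\<close> alone
      is rescaled.\<close>
    define v where "v = (\<lambda>s. if s \<in> S then (of_bool (s ! i = j) * a i (s ! i)) * (\<Prod>k\<in>{..<n} - {i}. a k (s ! k)) else 0)"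
    have vs: "v s = of_bool (s ! i = j) * p s" if "s \<in> S" for s
      using that i a[OF that] by (simp add: v_def rank1_def prod.remove[of "{..<n}" i])
    have "v \<in> tangent_space S M p"
      unfolding v_def by (rule tangent_vector[OF cone a i])
    then have "dlog_likelihood S u p v = 0" using qr p u by (auto simp: critical_def)
    moreover have "dlog_likelihood S u p v = (\<Sum>s | s \<in> S \<and> s ! i = j. u s - l * p s)"
      unfolding dlog_likelihood_def l_def[symmetric]
      by (rule sum.mono_neutral_cong_right) (use nz in \<open>auto simp: vs field_simps\<close>)
    ultimately have "(\<Sum>s | s \<in> S \<and> s ! i = j. u s) = l * (\<Sum>s | s \<in> S \<and> s ! i = j. p s)"
      by (simp add: sum_subtractf sum_distrib_left)
    also have "(\<Sum>s | s \<in> S \<and> s ! i = j. p s) = (\<Sum>s | s \<in> S \<and> s ! i = j. rank1 a s)"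
      by (rule sum.cong) (use a in auto)
    finally show ?thesis by (simp only: sum_rank1_fiber[OF i j])
  qed
  show ?thesis
    unfolding pu_point_def
  proof (rule minors_vanish[OF g a])
    fix i assume i: "i < n"
    show "\<exists>l. \<forall>j\<in>{1..ds ! i}. (\<Sum>s | s \<in> S \<and> s ! i = j. u s) = l * a i j"
      by (intro exI[of _ "l * (\<Prod>k\<in>{..<n} - {i}. total a k)"]) (simp add: marg[OF i] mult_ac)
  qed
qed

text \<open>A parameter point need not yield a critical point. It is joined by a line to one where
  the open conditions hold; \<open>f\<close> then vanishes at all but finitely many points of the
  line, hence on all of it.\<close>

lemma vanishing_on_critical:
  assumes f: "f \<in> carrier (poly_ring V)"
    and van: "\<And>q r x y. (q, r) \<in> critical \<Longrightarrow> x \<in> q \<Longrightarrow> y \<in> r \<Longrightarrow> eval (pu_point x y) f = 0"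
  shows "f \<in> param_ideal"
  unfolding param_ideal_iff
proof (intro conjI f allI)
  fix a :: "nat \<Rightarrow> nat \<Rightarrow> complex" and t u
  \<comment> \<open>At 0 all factors and the scale are 1 and the free coordinates 0; at 1 the line
    reaches the given parameters.\<close>
  define A :: "nat \<Rightarrow> nat \<Rightarrow> complex poly" where "A k j = [:1, a k j - 1:]" for k j
  define T :: "complex poly" where "T = [:1, t - 1:]"
  define U :: "nat list \<Rightarrow> complex poly" where "U s = [:0, u s:]" for s
  let ?x = "param A T U"
  \<comment> \<open>Where \<open>G\<close> is nonzero, \<open>criticalI\<close> applies; the last
    factor ensures that the vector of u coordinates is not 0.\<close>
  define G where "G = (\<Prod>s\<in>S. rank1 A s) * (\<Sum>s\<in>S. rank1 A s) * (\<Sum>s\<in>S. param_u A T U s)"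
  have "poly (peval ?x f * G) z = 0" for z
  proof (cases "poly G z = 0")
    case False
    let ?a = "\<lambda>k j. poly (A k j) z" and ?t = "poly T z" and ?u = "\<lambda>s. poly (U s) z"
    have P: "poly (rank1 A s) z = rank1 ?a s" "poly (param_u A T U s) z = param_u ?a ?t ?u s" for s
      using poly_param[of A T U "Pvar s" z] poly_param[of A T U "Uvar s" z] by simp_all
    define p where "p s = (if s \<in> S then rank1 ?a s else 0)" for s
    define y where "y s = (if s \<in> S then param_u ?a ?t ?u s else 0)" for s
    have nz: "\<And>s. s \<in> S \<Longrightarrow> p s \<noteq> 0" "(\<Sum>s\<in>S. p s) \<noteq> 0" "(\<Sum>s\<in>S. y s) \<noteq> 0"
      using False by (auto simp: G_def poly_prod poly_sum P p_def y_def)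
    have "(proj_pt p, proj_pt y) \<in> critical"
    proof (rule criticalI[where a = ?a and l = ?t])
      show "y \<noteq> 0" using nz(3) by auto
      fix i j assume ij: "i < n" "j \<in> {1..ds ! i}"
      have "(\<Sum>s | s \<in> S \<and> s ! i = j. y s) = (\<Sum>s | s \<in> S \<and> s ! i = j. param_u ?a ?t ?u s)"
        "(\<Sum>s | s \<in> S \<and> s ! i = j. p s) = (\<Sum>s | s \<in> S \<and> s ! i = j. rank1 ?a s)"
        by (auto simp: y_def p_def intro!: sum.cong)
      then show "(\<Sum>s | s \<in> S \<and> s ! i = j. y s) = ?t * (\<Sum>s | s \<in> S \<and> s ! i = j. p s)"
        using ij by (simp add: sum_param_u_fiber sum_rank1_fiber marginal_def)
    qed (use nz in \<open>auto simp: p_def y_def vecs_def\<close>)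
    then have "eval (pu_point p y) f = 0" using van proj_pt_self by blast
    moreover have "eval (pu_point p y) f = eval (param ?a ?t ?u) f"
      by (rule eval_cong) (use f in \<open>fastforce simp: carrier_poly_ring pu_vars_def pu_point_def p_def y_def\<close>)
    ultimately show ?thesis by (simp add: poly_peval poly_param)
  qed simp
  then have "peval ?x f * G = 0" using poly_all_0_iff_0 by blast
  \<comment> \<open>At 0 all coordinates of \<open>p\<close> are 1, and both sums equal the product
    of the \<open>ds ! k\<close>.\<close>
  moreover have "poly G 0 \<noteq> 0"
  proof -
    have r: "poly (rank1 A s) 0 = 1" for s
      by (simp add: rank1_def poly_prod A_def)
    have tot: "poly (total A k) 0 = of_nat (ds ! k)" for k
      by (simp add: total_def poly_sum A_def)
    have "poly (\<Sum>s\<in>S. param_u A T U s) 0 = (\<Prod>k<n. of_nat (ds ! k))"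
      unfolding sum_param_u by (simp add: poly_prod tot T_def)
    moreover have "poly (\<Sum>s\<in>S. rank1 A s) 0 = (\<Prod>k<n. of_nat (ds ! k))"
      unfolding sum_rank1 by (simp add: poly_prod tot)
    moreover have "(\<Prod>k<n. of_nat (ds ! k) :: complex) \<noteq> 0" using positive by fastforce
    ultimately show ?thesis by (simp add: G_def poly_prod r)
  qed
  ultimately have "peval ?x f = 0" by auto
  then have "poly (peval ?x f) 1 = 0" by simp
  then show "eval (param a t u) f = 0"
    unfolding poly_peval poly_param by (simp add: A_def T_def U_def)
qed

end

section \<open>The likelihood ideal\<close>

context format
begin

lemma ideal_minors2_ideal: "i < n \<Longrightarrow> ideal (ideal_minors2 V (M_matrix ds i)) (poly_ring V)"
  unfolding ideal_minors2_def by (intro genideal_poly_ring minors2_carrier)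

lemma minors2_subset_ideal: "i < n \<Longrightarrow> minors2 (M_matrix ds i) \<subseteq> ideal_minors2 V (M_matrix ds i)"
  unfolding ideal_minors2_def by (intro genideal_poly_ring minors2_carrier)

lemma independence_ideal_ideal: "ideal (independence_ideal ds) (poly_ring V)"
proof (rule ideal_poly_ringI)
  note D = ideal_poly_ringD[OF ideal_minors2_ideal]
  show "independence_ideal ds \<subseteq> carrier (poly_ring V)"
    unfolding independence_ideal_def using D(1) by (force intro!: carrier_poly_ring_sum)
  show "0 \<in> independence_ideal ds"
    unfolding independence_ideal_def using D(2) by (intro CollectI exI[of _ "\<lambda>_. 0"]) auto
  fix f g
  show "f + g \<in> independence_ideal ds" if fg: "f \<in> independence_ideal ds" "g \<in> independence_ideal ds"
  proof -
    obtain f' where f: "f = (\<Sum>i<n. f' i)" "\<forall>i<n. f' i \<in> ideal_minors2 V (M_matrix ds i)"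
      using fg(1) unfolding independence_ideal_def by blast
    obtain g' where g: "g = (\<Sum>i<n. g' i)" "\<forall>i<n. g' i \<in> ideal_minors2 V (M_matrix ds i)"
      using fg(2) unfolding independence_ideal_def by blast
    show ?thesis unfolding independence_ideal_def
      using f g D(3) by (intro CollectI exI[of _ "\<lambda>i. f' i + g' i"]) (simp add: sum.distrib)
  qed
  show "f * g \<in> independence_ideal ds" if fg: "f \<in> carrier (poly_ring V)" "g \<in> independence_ideal ds"
  proof -
    obtain g' where g: "g = (\<Sum>i<n. g' i)" "\<forall>i<n. g' i \<in> ideal_minors2 V (M_matrix ds i)"
      using fg(2) unfolding independence_ideal_def by blast
    show ?thesis unfolding independence_ideal_def
      using fg(1) g D(4) by (intro CollectI exI[of _ "\<lambda>i. f * g' i"]) (simp add: sum_distrib_left)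
  qed
qed

lemma minors_subset: "minors \<subseteq> independence_ideal ds"
proof
  fix g assume "g \<in> minors"
  then obtain i where i: "i < n" "g \<in> minors2 (M_matrix ds i)" by (auto simp: minors_def)
  then have g: "g \<in> ideal_minors2 V (M_matrix ds i)" using minors2_subset_ideal by blast
  have "g = (\<Sum>k<n. if k = i then g else 0)" using i(1) by simp
  moreover have "\<forall>k<n. (if k = i then g else 0) \<in> ideal_minors2 V (M_matrix ds k)"
    using g ideal_poly_ringD(2)[OF ideal_minors2_ideal] by simp
  ultimately show "g \<in> independence_ideal ds"
    unfolding independence_ideal_def by (intro CollectI exI[of _ "\<lambda>k. if k = i then g else 0"] conjI)
qed

text \<open>Together with \<open>minors_subset\<close> this identifies the sum of the ideals as the
  ideal generated by all the minors.\<close>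

lemma independence_ideal_least:
  assumes K: "ideal K (poly_ring V)" and sub: "minors \<subseteq> K"
  shows "independence_ideal ds \<subseteq> K"
proof
  fix f assume "f \<in> independence_ideal ds"
  then obtain f' where f: "f = (\<Sum>i<n. f' i)" "\<forall>i<n. f' i \<in> ideal_minors2 V (M_matrix ds i)"
    unfolding independence_ideal_def by blast
  have "ideal_minors2 V (M_matrix ds i) \<subseteq> K" if i: "i < n" for i
    unfolding ideal_minors2_def
    by (rule genideal_poly_ring(3)[OF minors2_carrier[OF i] K]) (use sub i in \<open>auto simp: minors_def\<close>)
  then have mem: "f' i \<in> K" if "i < n" for i using f(2) that by blast
  have "(\<Sum>i<k. f' i) \<in> K" if "k \<le> n" for k
    using that by (induction k) (auto intro!: ideal_poly_ringD(2,3)[OF K] mem)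
  then show "f \<in> K" using f(1) by simp
qed

text \<open>If neither polynomial vanishes on the image, a line in parameter space through witnesses
  for both carries two nonzero polynomials in one variable, whose product cannot vanish.\<close>

lemma primeideal_param_ideal: "primeideal param_ideal (poly_ring V)"
proof (rule primeidealI[OF ideal_param_ideal cring_poly_ring])
  have "1 \<notin> param_ideal" by (simp add: param_ideal_iff)
  then show "carrier (poly_ring V) \<noteq> param_ideal" using carrier_poly_ring_1 by metis
  fix f g
  assume fg: "f \<in> carrier (poly_ring V)" "g \<in> carrier (poly_ring V)"
    and prod: "f \<otimes>\<^bsub>poly_ring V\<^esub> g \<in> param_ideal"
  show "f \<in> param_ideal \<or> g \<in> param_ideal"
  proof (rule ccontr)
    assume "\<not> (f \<in> param_ideal \<or> g \<in> param_ideal)"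
    then obtain a t u b s v where nz: "eval (param a t u) f \<noteq> 0" "eval (param b s v) g \<noteq> 0"
      using fg unfolding param_ideal_iff by blast
    \<comment> \<open>The line passes through the witness for \<open>f\<close> at 0 and through the
      one for \<open>g\<close> at 1.\<close>
    let ?x = "param (\<lambda>k j. [:a k j, b k j - a k j:]) [:t, s - t:] (\<lambda>r. [:u r, v r - u r:])"
    have "poly (peval ?x f * peval ?x g) z = 0" for z
      unfolding poly_mult poly_peval poly_param eval_mult[symmetric]
      using prod by (simp add: param_ideal_iff del: eval_mult)
    then have "peval ?x f * peval ?x g = 0" using poly_all_0_iff_0 by blast
    then have "poly (peval ?x f) 0 = 0 \<or> poly (peval ?x g) 1 = 0" by auto
    then show False using nz unfolding poly_peval poly_param by simp
  qed
qed

lemma independence_ideal_groebner: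
  "independence_ideal ds = param_ideal"
  "groebner_basis V (lex_less (pu_order ds)) minors (independence_ideal ds)"
proof -
  have sub: "independence_ideal ds \<subseteq> param_ideal"
  proof (rule independence_ideal_least[OF ideal_param_ideal])
    show "minors \<subseteq> param_ideal"
      using minors_bihom minors_vanish_param by (auto simp: param_ideal_iff bihom_polys_def)
  qed
  note G = groebner_basis_standard[where vs = "pu_order ds" and Std = standard and I = "independence_ideal ds"
      and J = param_ideal and G = minors, unfolded set_pu_order, OF independence_ideal_ideal ideal_param_ideal sub
      finite_minors minors_subset]
  show "independence_ideal ds = param_ideal"
    by (rule G(1)) (use nonstandard_reducible standard_independent in blast)+
  show "groebner_basis V (lex_less (pu_order ds)) minors (independence_ideal ds)"
    by (rule G(2)) (use nonstandard_reducible standard_independent in blast)+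
qed

text \<open>The likelihood ideal lies between two ideals already known to be equal: it contains the
  minors, which are bihomogeneous and vanish on \<open>critical\<close>, and its generators lie in
  \<open>param_ideal\<close>.\<close>

lemma likelihood_ideal_eq: "likelihood_ideal S M = independence_ideal ds"
proof
  have sub: "critical \<subseteq> proj_space S \<times> proj_space S"
    using model_subset_proj_space by (auto simp: critical_def smooth_locus_def)
  let ?F = "{f \<in> bihom_polys S. \<forall>(q, r)\<in>critical. \<forall>x\<in>q. \<forall>y\<in>r. eval (pu_point x y) f = 0}"
  have eq: "likelihood_ideal S M = genideal (poly_ring V) ?F"
    using bihom_vanishing_ideal_closure[OF sub]
    by (simp add: likelihood_ideal_def likelihood_correspondence_def critical_def bihom_vanishing_ideal_def)
  have F: "?F \<subseteq> carrier (poly_ring V)" by (auto simp: bihom_polys_def)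
  have "?F \<subseteq> param_ideal"
  proof
    fix f assume f: "f \<in> ?F"
    show "f \<in> param_ideal"
    proof (rule vanishing_on_critical)
      show "f \<in> carrier (poly_ring V)" using f F by (rule subsetD[rotated])
      show "eval (pu_point x y) f = 0" if "(q, r) \<in> critical" "x \<in> q" "y \<in> r" for q r x y
        using f that by auto
    qed
  qed
  then show "likelihood_ideal S M \<subseteq> independence_ideal ds"
    unfolding eq independence_ideal_groebner(1)
    by (rule genideal_poly_ring(3)[OF F ideal_param_ideal])
  show "independence_ideal ds \<subseteq> likelihood_ideal S M"
    unfolding eq
  proof (rule independence_ideal_least[OF genideal_poly_ring(1)[OF F]])
    have "g \<in> ?F" if "g \<in> minors" for g
      using minors_bihom that by (auto intro: critical_minors_vanish[OF _ _ _ that])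
    then show "minors \<subseteq> genideal (poly_ring V) ?F" using genideal_poly_ring(2)[OF F] by (meson subset_iff)
  qed
qed

end

theorem theorem3p2:
  fixes ds :: "nat list"
  assumes "length ds \<ge> 1"
    and "\<forall>i<length ds. ds ! i \<ge> 1"
  shows "primeideal (independence_ideal ds) (poly_ring (pu_vars (indices ds))) \<and>
    independence_ideal ds = likelihood_ideal (indices ds) (independence_model ds) \<and>
    groebner_basis (pu_vars (indices ds)) (lex_less (pu_order ds))
      (\<Union>i<length ds. minors2 (M_matrix ds i)) (independence_ideal ds)"
proof -
  interpret format ds by unfold_locales (use assms in auto)
  show ?thesis
    using primeideal_param_ideal independence_ideal_groebner likelihood_ideal_eq
    by (simp add: minors_def)
qed

end
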